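(* Let $k$ be a positive integer, and consider the commutative polynomial algebra $\mathcal{Y}^{(k)}=\mathbb{C}[Y_w\mid w\in[k]^*,|w|\ge2]$. Let $\Delta:\mathcal{Y}^{(k)}\to\mathcal{Y}^{(k)}\otimes\mathcal{Y}^{(k)}$ be the unital algebra homomorphism determined by $\Delta(Y_w)=\sum_{\pi\in NC(n)}Y_{w;\pi}\otimes Y_{w;K(\pi)}$ for every $w\in[k]^*$ with $|w|=n\ge2$; let $\varepsilon:\mathcal{Y}^{(k)}\to\mathbb{C}$ be the unital algebra homomorphism determined by $\varepsilon(Y_w)=0$ for every $w\in[k]^*$ with $|w|\ge2$; and for $n\ge0$ let $$\mathcal{Y}^{(k)}_n:=\mathrm{span}\{Y_{w_1}\cdots Y_{w_q}\mid q\ge1,\ w_1,\dots,w_q\in[k]^*,\ |w_1|,\dots,|w_q|\ge1,\ |w_1|+\cdots+|w_q|=n+q\}.$$ With the comultiplication $\Delta$, the counit $\varepsilon$ and the grading $(\mathcal{Y}^{(k)}_n)_{n\ge0}$, $\mathcal{Y}^{(k)}$ becomes a graded connected Hopf algebra.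
   Context: $[k]^*$ is the set of finite words over $\{1,\dots,k\}$, $|w|$ is the length of $w$. For $w=(i_1,\dots,i_n)$ and $A=\{b_1<\dots<b_m\}\subseteq\{1,\dots,n\}$, $w|A:=(i_{b_1},\dots,i_{b_m})$. $NC(n)$ is the lattice of non-crossing partitions of $\{1,\dots,n\}$ with maximum $1_n$ (one block). For $\pi\in NC(n)$, $P_\pi$ is the permutation of $\{1,\dots,n\}$ which maps cyclically $b_1\mapsto b_2\mapsto\cdots\mapsto b_m\mapsto b_1$ on every block $\{b_1<\dots<b_m\}$ of $\pi$. The Kreweras complement $K(\pi)\in NC(n)$ is determined by $P_{K(\pi)}=P_\pi^{-1}P_{1_n}$ (composition of maps). Conventions: $Y_w:=1$ if $|w|=1$, and $Y_{w;\pi}:=\prod_{A\text{ block of }\pi}Y_{w|A}$ for $|w|=n\ge1$ and $\pi\in NC(n)$. A bialgebra $\mathcal{B}$ over $\mathbb{C}$ is graded if $\mathcal{B}=\oplus_{n\ge0}\mathcal{B}_n$ with $1_{\mathcal{B}}\in\mathcal{B}_0$, $\mathcal{B}_m\mathcal{B}_n\subseteq\mathcal{B}_{m+n}$, $\varepsilon|_{\mathcal{B}_n}=0$ for $n\ge1$, and $\Delta(\mathcal{B}_n)\subseteq\oplus_{i=0}^n\mathcal{B}_i\otimes\mathcal{B}_{n-i}$; it is connected if $\mathcal{B}_0=\mathbb{C}1_{\mathcal{B}}$. It is a Hopf algebra if the identity map is invertible under convolution in the algebra of linear maps $\mathcal{B}\to\mathcal{B}$. *)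

theory Defs
  imports Complex_Main "HOL-Library.Poly_Mapping" "HOL-Library.Disjoint_Sets"
begin

section \<open>Complex vector spaces and algebras\<close>

class scaleC =
  fixes scaleC :: "complex \<Rightarrow> 'a \<Rightarrow> 'a"  (infixr \<open>*\<^sub>C\<close> 75)

class complex_vector = scaleC + ab_group_add +
  assumes scaleC_add_right: "a *\<^sub>C (x + y) = a *\<^sub>C x + a *\<^sub>C y"
    and scaleC_add_left: "(a + b) *\<^sub>C x = a *\<^sub>C x + b *\<^sub>C x"
    and scaleC_scaleC: "a *\<^sub>C b *\<^sub>C x = (a * b) *\<^sub>C x"
    and scaleC_one: "1 *\<^sub>C x = x"

class complex_algebra_1 = complex_vector + ring_1 +
  assumes mult_scaleC_left: "(a *\<^sub>C x) * y = a *\<^sub>C (x * y)"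
    and mult_scaleC_right: "x * (a *\<^sub>C y) = a *\<^sub>C (x * y)"

global_interpretation complex_vector:
  vector_space "scaleC :: complex \<Rightarrow> 'a \<Rightarrow> 'a::complex_vector"
  by unfold_locales (simp_all add: scaleC_add_right scaleC_add_left scaleC_scaleC scaleC_one)

abbreviation clinear :: "('a::complex_vector \<Rightarrow> 'b::complex_vector) \<Rightarrow> bool" where
  "clinear \<equiv> Vector_Spaces.linear scaleC scaleC"

lemma clinearI:
  assumes "\<And>x y. f (x + y) = f x + f y" "\<And>c x. f (c *\<^sub>C x) = c *\<^sub>C f x"
  shows "clinear (f :: 'a::complex_vector \<Rightarrow> 'b::complex_vector)"
  using assms by unfold_locales auto

lemma clinear_add: "clinear f \<Longrightarrow> f (x + y) = f x + f y"
  and clinear_scale: "clinear f \<Longrightarrow> f (c *\<^sub>C x) = c *\<^sub>C f x"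
  and clinear_0: "clinear f \<Longrightarrow> f 0 = 0"
  and clinear_diff: "clinear f \<Longrightarrow> f (x - y) = f x - f y"
  and clinear_sum: "clinear f \<Longrightarrow> f (sum h S) = (\<Sum>i\<in>S. f (h i))"
  subgoal by (simp add: Vector_Spaces.linear_iff)
  subgoal by (simp add: Vector_Spaces.linear_iff)
  subgoal using module_hom.zero Vector_Spaces.linear.axioms by (metis module_hom_iff_linear)
  subgoal using module_hom.diff by (metis module_hom_iff_linear)
  subgoal using module_hom.sum by (metis module_hom_iff_linear)
  done

definition cbilinear :: "('a::complex_vector \<Rightarrow> 'b::complex_vector \<Rightarrow> 'c::complex_vector) \<Rightarrow> bool"
  where "cbilinear \<beta> \<longleftrightarrow> (\<forall>b. clinear (\<lambda>a. \<beta> a b)) \<and> (\<forall>a. clinear (\<lambda>b. \<beta> a b))"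

lemma cbilinearI:
  assumes "\<And>a a' b. \<beta> (a + a') b = \<beta> a b + \<beta> a' b" "\<And>c a b. \<beta> (c *\<^sub>C a) b = c *\<^sub>C \<beta> a b"
    "\<And>a b b'. \<beta> a (b + b') = \<beta> a b + \<beta> a b'" "\<And>c a b. \<beta> a (c *\<^sub>C b) = c *\<^sub>C \<beta> a b"
  shows "cbilinear \<beta>"
  unfolding cbilinear_def using assms by (auto intro!: clinearI)

definition calgebra_hom :: "('a::complex_algebra_1 \<Rightarrow> 'b::complex_algebra_1) \<Rightarrow> bool" where
  "calgebra_hom f \<longleftrightarrow> clinear f \<and> f 1 = 1 \<and> (\<forall>x y. f (x * y) = f x * f y)"

instantiation complex :: complex_algebra_1
begin
definition scaleC_complex :: "complex \<Rightarrow> complex \<Rightarrow> complex" where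
  "scaleC_complex = (*)"
instance by standard (simp_all add: scaleC_complex_def algebra_simps)
end

instantiation poly_mapping :: (type, complex_vector) complex_vector
begin
lift_definition scaleC_poly_mapping :: "complex \<Rightarrow> ('a \<Rightarrow>\<^sub>0 'b) \<Rightarrow> 'a \<Rightarrow>\<^sub>0 'b"
  is "\<lambda>c p k. c *\<^sub>C p k"
  by (erule finite_subset[rotated]) auto
instance
  by standard (rule poly_mapping_eqI; simp add: scaleC_poly_mapping.rep_eq lookup_add
      scaleC_add_right scaleC_add_left scaleC_scaleC scaleC_one)+
end

lemma lookup_scaleC: "Poly_Mapping.lookup (c *\<^sub>C p) k = c *\<^sub>C Poly_Mapping.lookup p k"
  by (simp add: scaleC_poly_mapping.rep_eq)

lemma scaleC_single: "c *\<^sub>C Poly_Mapping.single k v = Poly_Mapping.single k (c *\<^sub>C v)"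
  by (rule poly_mapping_eqI) (simp add: lookup_scaleC lookup_single when_def)

lemma poly_mapping_eq_sum_single:
  "(p :: 'a \<Rightarrow>\<^sub>0 'b::comm_monoid_add) = (\<Sum>k\<in>Poly_Mapping.keys p. Poly_Mapping.single k (Poly_Mapping.lookup p k))"
  by (rule poly_mapping_eqI)
    (simp add: lookup_sum lookup_single when_def sum.delta in_keys_iff)

lemma poly_mapping_single_induct [case_names single add]:
  assumes single: "\<And>k v. P (Poly_Mapping.single k v)"
    and add: "\<And>p q. P p \<Longrightarrow> P q \<Longrightarrow> P (p + q)"
  shows "P (p :: 'a \<Rightarrow>\<^sub>0 'b::comm_monoid_add)"
proof -
  have "P (\<Sum>k\<in>K. Poly_Mapping.single k (Poly_Mapping.lookup p k))" if "finite K" for K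
    using that
  proof (induction K)
    case empty
    show ?case using single[of undefined 0] by simp
  qed (simp add: single add)
  from this[of "Poly_Mapping.keys p"] show ?thesis
    using poly_mapping_eq_sum_single[of p] by simp
qed

instance poly_mapping :: (monoid_add, complex_algebra_1) complex_algebra_1
proof
  fix c :: complex and p q :: "'a \<Rightarrow>\<^sub>0 'b"
  have s: "(c *\<^sub>C Poly_Mapping.single k v) * q = c *\<^sub>C (Poly_Mapping.single k v * q)" for k v
    by (induction q rule: poly_mapping_single_induct)
      (simp_all add: scaleC_single mult_single mult_scaleC_left distrib_left scaleC_add_right)
  show "(c *\<^sub>C p) * q = c *\<^sub>C (p * q)"
    by (induction p rule: poly_mapping_single_induct)
      (simp_all add: s distrib_right scaleC_add_right)
  have t: "p * (c *\<^sub>C Poly_Mapping.single k v) = c *\<^sub>C (p * Poly_Mapping.single k v)" for k v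
    by (induction p rule: poly_mapping_single_induct)
      (simp_all add: scaleC_single mult_single mult_scaleC_right distrib_right scaleC_add_right)
  show "p * (c *\<^sub>C q) = c *\<^sub>C (p * q)"
    by (induction q rule: poly_mapping_single_induct)
      (simp_all add: t distrib_left scaleC_add_right)
qed

text \<open>The linear extension of a map defined on the basis of the free vector space on \<open>'i\<close>.\<close>

definition free_lift :: "('i \<Rightarrow> 'a::complex_vector) \<Rightarrow> ('i \<Rightarrow>\<^sub>0 complex) \<Rightarrow> 'a" where
  "free_lift g p = (\<Sum>i\<in>Poly_Mapping.keys p. Poly_Mapping.lookup p i *\<^sub>C g i)"

lemma free_lift_superset:
  assumes "finite K" "Poly_Mapping.keys p \<subseteq> K"
  shows "free_lift g p = (\<Sum>i\<in>K. Poly_Mapping.lookup p i *\<^sub>C g i)"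
  unfolding free_lift_def using assms
  by (intro sum.mono_neutral_left) (auto simp: in_keys_iff)

lemma clinear_free_lift: "clinear (free_lift g)"
proof (rule clinearI)
  fix p q :: "'a \<Rightarrow>\<^sub>0 complex" and c
  let ?K = "Poly_Mapping.keys p \<union> Poly_Mapping.keys q"
  have "Poly_Mapping.keys (p + q) \<subseteq> ?K" by (rule keys_add)
  then show "free_lift g (p + q) = free_lift g p + free_lift g q"
    by (simp add: free_lift_superset[of ?K] lookup_add scaleC_add_left sum.distrib)
  have "Poly_Mapping.keys (c *\<^sub>C p) \<subseteq> Poly_Mapping.keys p"
    by (auto simp: in_keys_iff lookup_scaleC scaleC_complex_def)
  then show "free_lift g (c *\<^sub>C p) = c *\<^sub>C free_lift g p"
    by (simp add: free_lift_superset[of "Poly_Mapping.keys p"] lookup_scaleC scaleC_complex_def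
        complex_vector.scale_sum_right)
qed

lemma free_lift_single [simp]: "free_lift g (Poly_Mapping.single i c) = c *\<^sub>C g i"
  by (simp add: free_lift_def)


section \<open>Tensor products\<close>

definition tensor_relators :: "('a::complex_vector \<times> 'b::complex_vector \<Rightarrow>\<^sub>0 complex) set" where
  "tensor_relators =
     (let \<delta> = \<lambda>a b. Poly_Mapping.single (a, b) 1 in
       {\<delta> (a + a') b - (\<delta> a b + \<delta> a' b) | a a' b. True} \<union>
       {\<delta> a (b + b') - (\<delta> a b + \<delta> a b') | a b b'. True} \<union>
       {\<delta> (c *\<^sub>C a) b - c *\<^sub>C \<delta> a b | c a b. True} \<union>
       {\<delta> a (c *\<^sub>C b) - c *\<^sub>C \<delta> a b | c a b. True})"

definition tensor_rel ::
  "('a::complex_vector \<times> 'b::complex_vector \<Rightarrow>\<^sub>0 complex) \<Rightarrow> ('a \<times> 'b \<Rightarrow>\<^sub>0 complex) \<Rightarrow> bool" where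
  "tensor_rel p q \<longleftrightarrow> p - q \<in> complex_vector.span tensor_relators"

lemma equivp_tensor_rel:
  "equivp (tensor_rel :: ('a::complex_vector \<times> 'b::complex_vector \<Rightarrow>\<^sub>0 complex) \<Rightarrow> _)"
proof (rule equivpI)
  show "reflp (tensor_rel :: ('a \<times> 'b \<Rightarrow>\<^sub>0 complex) \<Rightarrow> _)"
    by (auto simp: reflp_def tensor_rel_def complex_vector.span_zero)
  show "symp (tensor_rel :: ('a \<times> 'b \<Rightarrow>\<^sub>0 complex) \<Rightarrow> _)"
  proof (rule sympI)
    fix p q :: "'a \<times> 'b \<Rightarrow>\<^sub>0 complex"
    assume "tensor_rel p q"
    then have "- (p - q) \<in> complex_vector.span tensor_relators"
      unfolding tensor_rel_def by (rule complex_vector.span_neg)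
    then show "tensor_rel q p" by (simp add: tensor_rel_def)
  qed
  show "transp (tensor_rel :: ('a \<times> 'b \<Rightarrow>\<^sub>0 complex) \<Rightarrow> _)"
  proof (rule transpI)
    fix p q r :: "'a \<times> 'b \<Rightarrow>\<^sub>0 complex"
    assume "tensor_rel p q" "tensor_rel q r"
    then have "(p - q) + (q - r) \<in> complex_vector.span tensor_relators"
      unfolding tensor_rel_def by (rule complex_vector.span_add)
    then show "tensor_rel p r" by (simp add: tensor_rel_def)
  qed
qed

quotient_type (overloaded) ('a, 'b) tensor (infixr \<open>\<otimes>\<^sub>t\<close> 22) =
  "('a::complex_vector \<times> 'b::complex_vector) \<Rightarrow>\<^sub>0 complex" / tensor_rel
  by (rule equivp_tensor_rel)

lemma tensor_rel_eqI: "p = q \<Longrightarrow> tensor_rel p q"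
  by (simp add: tensor_rel_def complex_vector.span_zero)

instantiation tensor :: (complex_vector, complex_vector) complex_vector
begin
lift_definition zero_tensor :: "('a, 'b) tensor" is 0 .
lift_definition plus_tensor :: "('a, 'b) tensor \<Rightarrow> ('a, 'b) tensor \<Rightarrow> ('a, 'b) tensor" is "(+)"
proof -
  fix p q p' q' :: "'a \<times> 'b \<Rightarrow>\<^sub>0 complex"
  assume "tensor_rel p q" "tensor_rel p' q'"
  moreover have "p + p' - (q + q') = (p - q) + (p' - q')" by simp
  ultimately show "tensor_rel (p + p') (q + q')"
    unfolding tensor_rel_def by (simp only: complex_vector.span_add)
qed
lift_definition uminus_tensor :: "('a, 'b) tensor \<Rightarrow> ('a, 'b) tensor" is uminus
proof -
  fix p q :: "'a \<times> 'b \<Rightarrow>\<^sub>0 complex"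
  assume "tensor_rel p q"
  moreover have "- p - - q = - (p - q)" by simp
  ultimately show "tensor_rel (- p) (- q)"
    unfolding tensor_rel_def by (simp only: complex_vector.span_neg)
qed
lift_definition minus_tensor :: "('a, 'b) tensor \<Rightarrow> ('a, 'b) tensor \<Rightarrow> ('a, 'b) tensor" is "(-)"
proof -
  fix p q p' q' :: "'a \<times> 'b \<Rightarrow>\<^sub>0 complex"
  assume "tensor_rel p q" "tensor_rel p' q'"
  moreover have "p - p' - (q - q') = (p - q) - (p' - q')" by simp
  ultimately show "tensor_rel (p - p') (q - q')"
    unfolding tensor_rel_def by (simp only: complex_vector.span_diff)
qed
lift_definition scaleC_tensor :: "complex \<Rightarrow> ('a, 'b) tensor \<Rightarrow> ('a, 'b) tensor" is scaleC
proof -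
  fix c and p q :: "'a \<times> 'b \<Rightarrow>\<^sub>0 complex"
  assume "tensor_rel p q"
  moreover have "c *\<^sub>C p - c *\<^sub>C q = c *\<^sub>C (p - q)"
    by (rule complex_vector.scale_right_diff_distrib[symmetric])
  ultimately show "tensor_rel (c *\<^sub>C p) (c *\<^sub>C q)"
    unfolding tensor_rel_def by (simp only: complex_vector.span_scale)
qed
instance
proof
  fix r s t :: "('a, 'b) tensor" and c d :: complex
  show "r + s + t = r + (s + t)"
    by transfer (rule tensor_rel_eqI, rule add.assoc)
  show "r + s = s + r"
    by transfer (rule tensor_rel_eqI, rule add.commute)
  show "0 + r = r"
    by transfer (rule tensor_rel_eqI, simp)
  show "- r + r = 0"
    by transfer (rule tensor_rel_eqI, simp)
  show "r - s = r + - s"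
    by transfer (rule tensor_rel_eqI, simp)
  show "c *\<^sub>C (r + s) = c *\<^sub>C r + c *\<^sub>C s"
    by transfer (rule tensor_rel_eqI, rule scaleC_add_right)
  show "(c + d) *\<^sub>C r = c *\<^sub>C r + d *\<^sub>C r"
    by transfer (rule tensor_rel_eqI, rule scaleC_add_left)
  show "c *\<^sub>C d *\<^sub>C r = (c * d) *\<^sub>C r"
    by transfer (rule tensor_rel_eqI, rule scaleC_scaleC)
  show "1 *\<^sub>C r = r"
    by transfer (rule tensor_rel_eqI, rule scaleC_one)
qed
end

lift_definition tens :: "'a::complex_vector \<Rightarrow> 'b::complex_vector \<Rightarrow> 'a \<otimes>\<^sub>t 'b" (infixr \<open>\<otimes>\<close> 75)
  is "\<lambda>a b. Poly_Mapping.single (a, b) 1" .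

lemma cbilinear_tens: "cbilinear (\<otimes>)"
proof (rule cbilinearI)
  fix a a' :: 'a and b b' :: 'b and c
  show "(a + a') \<otimes> b = a \<otimes> b + a' \<otimes> b"
    by (transfer, unfold tensor_rel_def, rule complex_vector.span_base,
        unfold tensor_relators_def Let_def) blast
  show "a \<otimes> (b + b') = a \<otimes> b + a \<otimes> b'"
    by (transfer, unfold tensor_rel_def, rule complex_vector.span_base,
        unfold tensor_relators_def Let_def) blast
  show "(c *\<^sub>C a) \<otimes> b = c *\<^sub>C (a \<otimes> b)"
    by (transfer, unfold tensor_rel_def, rule complex_vector.span_base,
        unfold tensor_relators_def Let_def) blast
  show "a \<otimes> (c *\<^sub>C b) = c *\<^sub>C (a \<otimes> b)"
    by (transfer, unfold tensor_rel_def, rule complex_vector.span_base,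
        unfold tensor_relators_def Let_def) blast
qed

lemmas tens_add_left = clinear_add[OF cbilinear_tens[unfolded cbilinear_def, THEN conjunct1, rule_format]]
  and tens_add_right = clinear_add[OF cbilinear_tens[unfolded cbilinear_def, THEN conjunct2, rule_format]]
  and tens_scale_left = clinear_scale[OF cbilinear_tens[unfolded cbilinear_def, THEN conjunct1, rule_format]]
  and tens_scale_right = clinear_scale[OF cbilinear_tens[unfolded cbilinear_def, THEN conjunct2, rule_format]]

lemma tensor_induct [case_names tens add]:
  assumes tens: "\<And>a b. P (a \<otimes> b)"
    and add: "\<And>s t. P s \<Longrightarrow> P t \<Longrightarrow> P (s + t)"
  shows "P t"
proof -
  have "P (abs_tensor p)" for p
  proof (induction p rule: poly_mapping_single_induct)
    case (single k v)
    have "abs_tensor (Poly_Mapping.single k v) = v *\<^sub>C (fst k \<otimes> snd k)"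
      by (simp add: tens.abs_eq scaleC_tensor.abs_eq scaleC_single scaleC_complex_def)
    also have "\<dots> = (v *\<^sub>C fst k) \<otimes> snd k"
      by (rule tens_scale_left[symmetric])
    finally have "abs_tensor (Poly_Mapping.single k v) = (v *\<^sub>C fst k) \<otimes> snd k" .
    then show ?case using tens by simp
  next
    case (add p q)
    then show ?case using assms(2) by (simp flip: plus_tensor.abs_eq)
  qed
  then show ?thesis by (induction t rule: tensor.abs_induct)
qed

text \<open>
  The linear map on the tensor product induced by a bilinear map, defined through an arbitrary
  representative. It is only meaningful for bilinear \<open>\<beta>\<close>; for these the next lemmas state the
  universal property.
\<close>

definition tensor_lift ::
  "('a::complex_vector \<Rightarrow> 'b::complex_vector \<Rightarrow> 'c::complex_vector) \<Rightarrow> 'a \<otimes>\<^sub>t 'b \<Rightarrow> 'c" where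
  "tensor_lift \<beta> t = free_lift (\<lambda>(a, b). \<beta> a b) (rep_tensor t)"

lemma tensor_lift_abs:
  assumes "cbilinear \<beta>"
  shows "tensor_lift \<beta> (abs_tensor p) = free_lift (\<lambda>(a, b). \<beta> a b) p"
proof -
  let ?F = "free_lift (\<lambda>(a, b). \<beta> a b)"
  have lin: "clinear ?F" by (rule clinear_free_lift)
  have l: "clinear (\<lambda>a. \<beta> a b)" and r: "clinear (\<beta> a)" for a b
    using assms by (auto simp: cbilinear_def)
  note simps = clinear_diff[OF lin] clinear_add[OF lin] clinear_scale[OF lin] scaleC_one
    clinear_add[OF l] clinear_scale[OF l] clinear_add[OF r] clinear_scale[OF r]
  have gen: "?F x = 0" if "x \<in> tensor_relators" for x
    using that unfolding tensor_relators_def Let_def by (auto simp: simps)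
  have "?F x = 0" if "x \<in> complex_vector.span tensor_relators" for x
    using that
    by (induction rule: complex_vector.span_induct_alt) (simp_all add: simps gen clinear_0[OF lin])
  moreover have "tensor_rel (rep_tensor (abs_tensor p)) p"
    by (rule rep_abs_rsp_left[OF Quotient3_tensor]) (rule equivp_reflp[OF equivp_tensor_rel])
  ultimately have "?F (rep_tensor (abs_tensor p) - p) = 0"
    by (simp add: tensor_rel_def)
  then show ?thesis by (simp add: simps tensor_lift_def)
qed

lemma tensor_lift_add_fun: "tensor_lift (\<lambda>a b. \<beta> a b + \<gamma> a b) t = tensor_lift \<beta> t + tensor_lift \<gamma> t"
  by (simp add: tensor_lift_def free_lift_def case_prod_beta scaleC_add_right sum.distrib)

lemma tensor_lift_scale_fun: "tensor_lift (\<lambda>a b. c *\<^sub>C \<beta> a b) t = c *\<^sub>C tensor_lift \<beta> t"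
  by (simp add: tensor_lift_def free_lift_def case_prod_beta scaleC_scaleC mult.commute
      complex_vector.scale_sum_right)

lemma clinear_tensor_lift:
  assumes "cbilinear \<beta>"
  shows "clinear (tensor_lift \<beta>)"
proof (rule clinearI)
  fix s t c
  show "tensor_lift \<beta> (s + t) = tensor_lift \<beta> s + tensor_lift \<beta> t"
    by (induction s rule: tensor.abs_induct; induction t rule: tensor.abs_induct)
      (simp add: plus_tensor.abs_eq tensor_lift_abs[OF assms] clinear_add[OF clinear_free_lift])
  show "tensor_lift \<beta> (c *\<^sub>C s) = c *\<^sub>C tensor_lift \<beta> s"
    by (induction s rule: tensor.abs_induct)
      (simp add: scaleC_tensor.abs_eq tensor_lift_abs[OF assms] clinear_scale[OF clinear_free_lift])
qed

lemma tensor_lift_tens: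
  assumes "cbilinear \<beta>"
  shows "tensor_lift \<beta> (a \<otimes> b) = \<beta> a b"
  unfolding tens.abs_eq by (simp add: tensor_lift_abs[OF assms] scaleC_one)

lemma tensor_lift_unique:
  assumes "clinear f" "cbilinear \<beta>" "\<And>a b. f (a \<otimes> b) = \<beta> a b"
  shows "f = tensor_lift \<beta>"
proof
  fix t show "f t = tensor_lift \<beta> t"
    by (induction t rule: tensor_induct)
      (simp_all add: assms(3) tensor_lift_tens[OF assms(2)] clinear_add[OF assms(1)]
        clinear_add[OF clinear_tensor_lift[OF assms(2)]])
qed

definition tensor_map ::
  "('a::complex_vector \<Rightarrow> 'c::complex_vector) \<Rightarrow> ('b::complex_vector \<Rightarrow> 'd::complex_vector) \<Rightarrow>
   'a \<otimes>\<^sub>t 'b \<Rightarrow> 'c \<otimes>\<^sub>t 'd" where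
  "tensor_map f g = tensor_lift (\<lambda>a b. f a \<otimes> g b)"

definition tensor_assoc ::
  "('a::complex_vector \<otimes>\<^sub>t 'b::complex_vector) \<otimes>\<^sub>t 'c::complex_vector \<Rightarrow> 'a \<otimes>\<^sub>t ('b \<otimes>\<^sub>t 'c)" where
  "tensor_assoc = tensor_lift (\<lambda>s c. tensor_lift (\<lambda>a b. a \<otimes> (b \<otimes> c)) s)"

lemma tensor_map_tens:
  assumes "clinear f" "clinear g"
  shows "tensor_map f g (a \<otimes> b) = f a \<otimes> g b"
  unfolding tensor_map_def
  by (rule tensor_lift_tens, rule cbilinearI)
    (simp_all add: clinear_add[OF assms(1)] clinear_scale[OF assms(1)] clinear_add[OF assms(2)]
      clinear_scale[OF assms(2)] tens_add_left tens_add_right tens_scale_left tens_scale_right)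

lemma tensor_assoc_tens: "tensor_assoc ((a \<otimes> b) \<otimes> c) = a \<otimes> (b \<otimes> c)"
proof -
  have *: "cbilinear (\<lambda>a b. a \<otimes> (b \<otimes> c))" for c :: 'c
    by (rule cbilinearI)
      (simp_all add: tens_add_left tens_add_right tens_scale_left tens_scale_right)
  have "cbilinear (\<lambda>s c. tensor_lift (\<lambda>(a::'a) (b::'b). a \<otimes> (b \<otimes> (c::'c))) s)"
  proof (rule cbilinearI)
    fix s :: "'a \<otimes>\<^sub>t 'b" and c c' :: 'c and d :: complex
    show "tensor_lift (\<lambda>a b. a \<otimes> b \<otimes> (c + c')) s =
        tensor_lift (\<lambda>a b. a \<otimes> b \<otimes> c) s + tensor_lift (\<lambda>a b. a \<otimes> b \<otimes> c') s"
      by (simp add: tens_add_right tensor_lift_add_fun)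
    show "tensor_lift (\<lambda>a b. a \<otimes> b \<otimes> (d *\<^sub>C c)) s = d *\<^sub>C tensor_lift (\<lambda>a b. a \<otimes> b \<otimes> c) s"
      by (simp add: tens_scale_right tensor_lift_scale_fun)
  qed (simp_all add: clinear_add[OF clinear_tensor_lift[OF *]] clinear_scale[OF clinear_tensor_lift[OF *]])
  then show ?thesis
    unfolding tensor_assoc_def by (simp add: tensor_lift_tens *)
qed

lemma tens_zero_left: "0 \<otimes> b = 0" and tens_zero_right: "a \<otimes> 0 = 0"
  using tens_scale_left[of 0 0 b] tens_scale_right[of a 0 0] by simp_all

lemma tens_eq_0:
  assumes "a \<otimes> b = 0"
  shows "a = 0 \<or> b = 0"
proof (rule ccontr)
  assume "\<not> (a = 0 \<or> b = 0)"
  then have a: "complex_vector.independent {a}" and b: "complex_vector.independent {b}"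
    by (simp_all add: complex_vector.dependent_single)
  interpret va: vector_space_pair "scaleC :: complex \<Rightarrow> 'a \<Rightarrow> 'a" "scaleC :: complex \<Rightarrow> complex \<Rightarrow> complex"
    by unfold_locales
  interpret vb: vector_space_pair "scaleC :: complex \<Rightarrow> 'b \<Rightarrow> 'b" "scaleC :: complex \<Rightarrow> complex \<Rightarrow> complex"
    by unfold_locales
  obtain f :: "'a \<Rightarrow> complex" where f: "clinear f" "f a = 1"
    using va.linear_independent_extend[OF a, of "\<lambda>_. 1"] by auto
  obtain g :: "'b \<Rightarrow> complex" where g: "clinear g" "g b = 1"
    using vb.linear_independent_extend[OF b, of "\<lambda>_. 1"] by auto
  have *: "cbilinear (\<lambda>x y. f x * g y)"
    by (rule cbilinearI)
      (simp_all add: clinear_add[OF f(1)] clinear_scale[OF f(1)] clinear_add[OF g(1)]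
        clinear_scale[OF g(1)] distrib_left distrib_right mult_scaleC_left mult_scaleC_right)
  show False
    using tensor_lift_tens[OF *, of a b] f g assms clinear_0[OF clinear_tensor_lift[OF *]] by simp
qed

subsection \<open>The tensor product of two algebras\<close>

definition tensor_mult ::
  "'a::complex_algebra_1 \<otimes>\<^sub>t 'b::complex_algebra_1 \<Rightarrow> 'a \<otimes>\<^sub>t 'b \<Rightarrow> 'a \<otimes>\<^sub>t 'b" where
  "tensor_mult s t = tensor_lift (\<lambda>a b. tensor_lift (\<lambda>c d. (a * c) \<otimes> (b * d)) t) s"

lemma cbilinear_tens_mult: "cbilinear (\<lambda>c d. (a * c) \<otimes> (b * d))"
  for a :: "'a::complex_algebra_1" and b :: "'b::complex_algebra_1"
  by (rule cbilinearI)
    (simp_all add: distrib_left mult_scaleC_right tens_add_left tens_add_right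
      tens_scale_left tens_scale_right)

lemma cbilinear_tens_mult2:
  "cbilinear (\<lambda>(a::'a::complex_algebra_1) (b::'b::complex_algebra_1).
     tensor_lift (\<lambda>c d. (a * c) \<otimes> (b * d)) t)"
proof (rule cbilinearI)
  fix a a' :: 'a and b b' :: 'b and c :: complex
  note s = distrib_right mult_scaleC_left tens_add_left tens_add_right tens_scale_left
    tens_scale_right tensor_lift_add_fun tensor_lift_scale_fun
  show "tensor_lift (\<lambda>c d. ((a + a') * c) \<otimes> (b * d)) t =
    tensor_lift (\<lambda>c d. (a * c) \<otimes> (b * d)) t + tensor_lift (\<lambda>c d. (a' * c) \<otimes> (b * d)) t"
    by (simp add: s)
  show "tensor_lift (\<lambda>ca d. ((c *\<^sub>C a) * ca) \<otimes> (b * d)) t =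
    c *\<^sub>C tensor_lift (\<lambda>c d. (a * c) \<otimes> (b * d)) t"
    by (simp add: s)
  show "tensor_lift (\<lambda>c d. (a * c) \<otimes> ((b + b') * d)) t =
    tensor_lift (\<lambda>c d. (a * c) \<otimes> (b * d)) t + tensor_lift (\<lambda>c d. (a * c) \<otimes> (b' * d)) t"
    by (simp add: s)
  show "tensor_lift (\<lambda>ca d. (a * ca) \<otimes> ((c *\<^sub>C b) * d)) t =
    c *\<^sub>C tensor_lift (\<lambda>c d. (a * c) \<otimes> (b * d)) t"
    by (simp add: s)
qed

lemma tensor_mult_tens: "tensor_mult (a \<otimes> b) (c \<otimes> d) = (a * c) \<otimes> (b * d)"
  unfolding tensor_mult_def tensor_lift_tens[OF cbilinear_tens_mult2]
  by (rule tensor_lift_tens[OF cbilinear_tens_mult])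

lemma tensor_mult_add_left: "tensor_mult (s + s') t = tensor_mult s t + tensor_mult s' t"
  and tensor_mult_scale_left: "tensor_mult (c *\<^sub>C s) t = c *\<^sub>C tensor_mult s t"
  unfolding tensor_mult_def
  using clinear_tensor_lift[OF cbilinear_tens_mult2, of t] by (simp_all add: clinear_add clinear_scale)

lemma tensor_mult_add_right: "tensor_mult s (t + t') = tensor_mult s t + tensor_mult s t'"
  and tensor_mult_scale_right: "tensor_mult s (c *\<^sub>C t) = c *\<^sub>C tensor_mult s t"
  by (simp_all add: tensor_mult_def clinear_add[OF clinear_tensor_lift[OF cbilinear_tens_mult]]
      clinear_scale[OF clinear_tensor_lift[OF cbilinear_tens_mult]]
      tensor_lift_add_fun tensor_lift_scale_fun)

lemma tensor_mult_assoc: "tensor_mult (tensor_mult r s) t = tensor_mult r (tensor_mult s t)"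
proof (induction r rule: tensor_induct)
  case r: (tens a b)
  show ?case
  proof (induction s rule: tensor_induct)
    case s: (tens c d)
    show ?case
      by (induction t rule: tensor_induct)
        (simp_all add: tensor_mult_tens mult.assoc tensor_mult_add_right)
  qed (simp add: tensor_mult_add_left tensor_mult_add_right)
qed (simp add: tensor_mult_add_left)

instantiation tensor :: (complex_algebra_1, complex_algebra_1) complex_algebra_1
begin
definition one_tensor :: "('a, 'b) tensor" where
  "one_tensor = 1 \<otimes> 1"
definition times_tensor :: "('a, 'b) tensor \<Rightarrow> ('a, 'b) tensor \<Rightarrow> ('a, 'b) tensor" where
  "times_tensor = tensor_mult"
instance
proof
  fix r s t :: "('a, 'b) tensor" and c
  show "r * s * t = r * (s * t)"
    by (simp add: times_tensor_def tensor_mult_assoc)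
  show "1 * r = r"
    by (induction r rule: tensor_induct)
      (simp_all add: times_tensor_def one_tensor_def tensor_mult_tens tensor_mult_add_right)
  show "r * 1 = r"
    by (induction r rule: tensor_induct)
      (simp_all add: times_tensor_def one_tensor_def tensor_mult_tens tensor_mult_add_left)
  show "(0 :: ('a, 'b) tensor) \<noteq> 1"
    unfolding one_tensor_def using tens_eq_0[of "1::'a" "1::'b"] by force
qed (simp_all add: times_tensor_def tensor_mult_add_left tensor_mult_add_right
      tensor_mult_scale_left tensor_mult_scale_right)
end

lemma tens_mult_tens: "(a \<otimes> b) * (c \<otimes> d) = (a * c) \<otimes> (b * d)"
  by (simp add: times_tensor_def tensor_mult_tens)

class complex_comm_algebra_1 = complex_algebra_1 + comm_ring_1

instance complex :: complex_comm_algebra_1 ..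
instance poly_mapping :: (comm_monoid_add, complex_comm_algebra_1) complex_comm_algebra_1 ..

instance tensor :: (complex_comm_algebra_1, complex_comm_algebra_1) complex_comm_algebra_1
proof
  fix r s :: "('a, 'b) tensor"
  have *: "(a \<otimes> b) * s = s * (a \<otimes> b)" for a :: 'a and b :: 'b
    by (induction s rule: tensor_induct)
      (simp_all add: tens_mult_tens mult.commute distrib_left distrib_right)
  show "r * s = s * r"
    by (induction r rule: tensor_induct) (simp_all add: * distrib_left distrib_right)
qed (simp_all add: distrib_right)


section \<open>Graded connected Hopf algebras\<close>

locale bialgebra =
  fixes \<Delta> :: "'a::complex_algebra_1 \<Rightarrow> 'a \<otimes>\<^sub>t 'a" and \<epsilon> :: "'a \<Rightarrow> complex"
  assumes hom_\<Delta>: "calgebra_hom \<Delta>"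
    and hom_\<epsilon>: "calgebra_hom \<epsilon>"
    and coassoc: "tensor_assoc (tensor_map \<Delta> id (\<Delta> x)) = tensor_map id \<Delta> (\<Delta> x)"
    and counit_left: "tensor_lift (\<lambda>a b. \<epsilon> a *\<^sub>C b) (\<Delta> x) = x"
    and counit_right: "tensor_lift (\<lambda>a b. \<epsilon> b *\<^sub>C a) (\<Delta> x) = x"

definition is_direct_sum :: "(nat \<Rightarrow> 'a::complex_vector set) \<Rightarrow> bool" where
  "is_direct_sum B \<longleftrightarrow> (\<forall>n. complex_vector.subspace (B n)) \<and>
     (\<forall>x. \<exists>!f. (\<forall>n. f n \<in> B n) \<and> finite {n. f n \<noteq> 0} \<and> x = (\<Sum>n | f n \<noteq> 0. f n))"

definition tensor_sub :: "'a::complex_vector set \<Rightarrow> 'b::complex_vector set \<Rightarrow> ('a \<otimes>\<^sub>t 'b) set" where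
  "tensor_sub V W = complex_vector.span {a \<otimes> b | a b. a \<in> V \<and> b \<in> W}"

text \<open>
  The sum of the subspaces \<open>B i \<otimes> B (n - i)\<close> below is automatically direct when the \<open>B i\<close> form a
  direct sum decomposition.
\<close>

locale graded_bialgebra = bialgebra \<Delta> \<epsilon>
  for \<Delta> :: "'a::complex_algebra_1 \<Rightarrow> 'a \<otimes>\<^sub>t 'a" and \<epsilon> :: "'a \<Rightarrow> complex" +
  fixes B :: "nat \<Rightarrow> 'a set"
  assumes direct_sum: "is_direct_sum B"
    and one_in_grade_0: "1 \<in> B 0"
    and mult_grade: "x \<in> B m \<Longrightarrow> y \<in> B n \<Longrightarrow> x * y \<in> B (m + n)"
    and counit_grade: "n \<ge> 1 \<Longrightarrow> x \<in> B n \<Longrightarrow> \<epsilon> x = 0"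
    and comult_grade: "x \<in> B n \<Longrightarrow>
      \<Delta> x \<in> {\<Sum>i\<le>n. t i | t. \<forall>i\<le>n. t i \<in> tensor_sub (B i) (B (n - i))}"

locale graded_connected_bialgebra = graded_bialgebra +
  assumes connected: "B 0 = complex_vector.span {1}"

definition convolution ::
  "('a::complex_algebra_1 \<Rightarrow> 'a \<otimes>\<^sub>t 'a) \<Rightarrow> ('a \<Rightarrow> 'a) \<Rightarrow> ('a \<Rightarrow> 'a) \<Rightarrow> 'a \<Rightarrow> 'a" where
  "convolution \<Delta> f g x = tensor_lift (\<lambda>a b. f a * g b) (\<Delta> x)"

text \<open>The unit of the convolution algebra is \<open>x \<mapsto> \<epsilon>(x) 1\<close>.\<close>

locale hopf_algebra = bialgebra +
  assumes antipode: "\<exists>S. clinear S \<and> convolution \<Delta> S id = (\<lambda>x. \<epsilon> x *\<^sub>C 1) \<and>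
    convolution \<Delta> id S = (\<lambda>x. \<epsilon> x *\<^sub>C 1)"

locale graded_connected_hopf_algebra = graded_connected_bialgebra + hopf_algebra


section \<open>Non-crossing partitions\<close>

definition NC :: "nat \<Rightarrow> nat set set set" where
  "NC n = {\<pi>. partition_on {1..n} \<pi> \<and>
     \<not> (\<exists>A\<in>\<pi>. \<exists>B\<in>\<pi>. A \<noteq> B \<and>
         (\<exists>a b c d. a < b \<and> b < c \<and> c < d \<and> a \<in> A \<and> c \<in> A \<and> b \<in> B \<and> d \<in> B))}"

definition block_of :: "nat set set \<Rightarrow> nat \<Rightarrow> nat set" where
  "block_of \<pi> i = (THE A. A \<in> \<pi> \<and> i \<in> A)"

text \<open>Permutations of \<open>{1..n}\<close> are extended to \<open>nat\<close> by the identity.\<close>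

definition part_perm :: "nat set set \<Rightarrow> nat \<Rightarrow> nat" where
  "part_perm \<pi> i =
     (if i \<notin> \<Union>\<pi> then i
      else if \<exists>j\<in>block_of \<pi> i. i < j then Min {j \<in> block_of \<pi> i. i < j}
      else Min (block_of \<pi> i))"

definition kreweras :: "nat \<Rightarrow> nat set set \<Rightarrow> nat set set" where
  "kreweras n \<pi> =
     (THE \<sigma>. \<sigma> \<in> NC n \<and> part_perm \<sigma> = inv (part_perm \<pi>) \<circ> part_perm {{1..n}})"


section \<open>The algebra of the variables \<open>Y\<^sub>w\<close>\<close>

text \<open>
  The alphabet is a type \<open>'k\<close>; \<open>[k]\<close> corresponds to a finite \<open>'k\<close> with \<open>CARD('k) = k\<close>.
  Polynomials are finitely supported functions on the monomials \<open>'k idx \<Rightarrow>\<^sub>0 nat\<close>.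
\<close>

typedef 'k idx = "{w :: 'k list. length w \<ge> 2}"
  by (rule exI[of _ "[undefined, undefined]"]) simp

type_synonym 'k Yalg = "('k idx \<Rightarrow>\<^sub>0 nat) \<Rightarrow>\<^sub>0 complex"

text \<open>\<open>Y [] = 1\<close> is a junk value that is never used.\<close>

definition Y :: "'k list \<Rightarrow> 'k Yalg" where
  "Y w = (if length w \<ge> 2
     then Poly_Mapping.single (Poly_Mapping.single (Abs_idx w) 1) 1 else 1)"

definition subword :: "'k list \<Rightarrow> nat set \<Rightarrow> 'k list" where
  "subword w A = map (\<lambda>b. w ! (b - 1)) (sorted_list_of_set A)"

definition Y_part :: "'k list \<Rightarrow> nat set set \<Rightarrow> 'k Yalg" where
  "Y_part w \<pi> = (\<Prod>A\<in>\<pi>. Y (subword w A))"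

text \<open>Evaluation of polynomials at elements of a commutative algebra.\<close>

definition poly_eval ::
  "('v \<Rightarrow> 'a::complex_comm_algebra_1) \<Rightarrow> (('v \<Rightarrow>\<^sub>0 nat) \<Rightarrow>\<^sub>0 complex) \<Rightarrow> 'a" where
  "poly_eval f = free_lift (\<lambda>m. \<Prod>v\<in>Poly_Mapping.keys m. f v ^ Poly_Mapping.lookup m v)"

definition Y_comult :: "'k Yalg \<Rightarrow> 'k Yalg \<otimes>\<^sub>t 'k Yalg" where
  "Y_comult = poly_eval (\<lambda>v. let w = Rep_idx v; n = length w in
     \<Sum>\<pi>\<in>NC n. Y_part w \<pi> \<otimes> Y_part w (kreweras n \<pi>))"

definition Y_counit :: "'k Yalg \<Rightarrow> complex" where
  "Y_counit = poly_eval (\<lambda>_. 0)"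

definition Y_grade :: "nat \<Rightarrow> 'k Yalg set" where
  "Y_grade n = complex_vector.span
     {prod_list (map Y ws) | ws. length ws \<ge> 1 \<and> (\<forall>w\<in>set ws. length w \<ge> 1) \<and>
        sum_list (map length ws) = n + length ws}"

lemma monomial_eval_superset:
  assumes "finite K" "Poly_Mapping.keys m \<subseteq> K"
  shows "(\<Prod>v\<in>Poly_Mapping.keys m. f v ^ Poly_Mapping.lookup m v) = (\<Prod>v\<in>K. (f v :: 'a::comm_monoid_mult) ^ Poly_Mapping.lookup m v)"
  using assms by (intro prod.mono_neutral_left) (auto simp: in_keys_iff)

lemma monomial_eval_add:
  "(\<Prod>v\<in>Poly_Mapping.keys (m + m'). f v ^ Poly_Mapping.lookup (m + m') v) =
   (\<Prod>v\<in>Poly_Mapping.keys m. (f v :: 'a::comm_monoid_mult) ^ Poly_Mapping.lookup m v) * (\<Prod>v\<in>Poly_Mapping.keys m'. f v ^ Poly_Mapping.lookup m' v)"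
proof -
  let ?K = "Poly_Mapping.keys m \<union> Poly_Mapping.keys m'"
  have "Poly_Mapping.keys (m + m') \<subseteq> ?K" by (rule keys_add)
  then show ?thesis
    unfolding monomial_eval_superset[of ?K "m + m'", OF _ keys_add, simplified]
      monomial_eval_superset[of ?K m, simplified] monomial_eval_superset[of ?K m', simplified]
    by (simp add: lookup_add power_add prod.distrib)
qed

lemma calgebra_hom_poly_eval: "calgebra_hom (poly_eval f)"
  unfolding calgebra_hom_def
proof (intro conjI allI)
  let ?M = "\<lambda>m. \<Prod>v\<in>Poly_Mapping.keys m. f v ^ Poly_Mapping.lookup m v"
  show lin: "clinear (poly_eval f)"
    unfolding poly_eval_def by (rule clinear_free_lift)
  show "poly_eval f 1 = 1"
    by (simp add: poly_eval_def scaleC_one flip: single_one)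
  fix p q
  have "poly_eval f (Poly_Mapping.single m c * q) = poly_eval f (Poly_Mapping.single m c) * poly_eval f q"
    for m c
  proof (induction q rule: poly_mapping_single_induct)
    case (single m' c')
    then show ?case
      by (simp add: poly_eval_def mult_single monomial_eval_add mult_scaleC_left mult_scaleC_right
          scaleC_scaleC mult.commute)
  qed (simp add: distrib_left clinear_add[OF lin])
  then show "poly_eval f (p * q) = poly_eval f p * poly_eval f q"
    by (induction p rule: poly_mapping_single_induct)
      (simp_all add: distrib_right clinear_add[OF lin])
qed

lemma poly_eval_Y:
  assumes "length w \<ge> 2"
  shows "poly_eval f (Y w) = f (Abs_idx w)"
  using assms by (simp add: poly_eval_def Y_def scaleC_one)

text \<open>An algebra homomorphism on \<open>'k Yalg\<close> is determined by its values on the generators.\<close>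

lemma Yalg_hom_unique:
  fixes \<phi> \<psi> :: "'k Yalg \<Rightarrow> 'a::complex_algebra_1"
  assumes "calgebra_hom \<phi>" "calgebra_hom \<psi>" "\<And>w. length w \<ge> 2 \<Longrightarrow> \<phi> (Y w) = \<psi> (Y w)"
  shows "\<phi> = \<psi>"
proof
  have lin: "clinear \<phi>" "clinear \<psi>" and one: "\<phi> 1 = 1" "\<psi> 1 = 1"
    and mult: "\<phi> (x * y) = \<phi> x * \<phi> y" "\<psi> (x * y) = \<psi> x * \<psi> y" for x y
    using assms(1,2) by (auto simp: calgebra_hom_def)
  have var: "\<phi> (Poly_Mapping.single (Poly_Mapping.single v 1) 1) =
      \<psi> (Poly_Mapping.single (Poly_Mapping.single v 1) 1)" for v
    using assms(3)[of "Rep_idx v"] Rep_idx[of v] by (simp add: Y_def Rep_idx_inverse)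
  have pow: "\<phi> (Poly_Mapping.single (Poly_Mapping.single v e) 1) =
      \<psi> (Poly_Mapping.single (Poly_Mapping.single v e) 1)" for v e
  proof (induction e)
    case (Suc e)
    have "Poly_Mapping.single (Poly_Mapping.single v (Suc e)) (1::complex) =
        Poly_Mapping.single (Poly_Mapping.single v 1) 1 * Poly_Mapping.single (Poly_Mapping.single v e) 1"
      by (simp add: mult_single flip: single_add)
    then show ?case by (simp add: mult var[simplified] Suc)
  qed (simp add: one)
  have mon: "\<phi> (Poly_Mapping.single m 1) = \<psi> (Poly_Mapping.single m 1)" for m
  proof (induction m rule: poly_mapping_single_induct)
    case (add m m')
    have "Poly_Mapping.single (m + m') (1::complex) = Poly_Mapping.single m 1 * Poly_Mapping.single m' 1"
      by (simp add: mult_single)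
    then show ?case by (simp add: mult add)
  qed (rule pow)
  fix p show "\<phi> p = \<psi> p"
  proof (induction p rule: poly_mapping_single_induct)
    case (single m c)
    have "Poly_Mapping.single m c = c *\<^sub>C Poly_Mapping.single m 1"
      by (simp add: scaleC_single scaleC_complex_def)
    then show ?case by (simp add: clinear_scale[OF lin(1)] clinear_scale[OF lin(2)] mon)
  qed (simp add: clinear_add[OF lin(1)] clinear_add[OF lin(2)])
qed

lemma Y_comult_characterization:
  "calgebra_hom \<phi> \<and> (\<forall>w. length w \<ge> 2 \<longrightarrow>
      \<phi> (Y w) = (\<Sum>\<pi>\<in>NC (length w). Y_part w \<pi> \<otimes> Y_part w (kreweras (length w) \<pi>)))
   \<longleftrightarrow> \<phi> = Y_comult"
proof -
  have hom: "calgebra_hom Y_comult"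
    unfolding Y_comult_def by (rule calgebra_hom_poly_eval)
  have val: "Y_comult (Y w) = (\<Sum>\<pi>\<in>NC (length w). Y_part w \<pi> \<otimes> Y_part w (kreweras (length w) \<pi>))"
    if "length w \<ge> 2" for w :: "'a list"
    using that by (simp add: Y_comult_def poly_eval_Y Abs_idx_inverse Let_def)
  show ?thesis using hom val by (auto intro: Yalg_hom_unique)
qed

lemma Y_counit_characterization:
  "calgebra_hom \<phi> \<and> (\<forall>w. length w \<ge> 2 \<longrightarrow> \<phi> (Y w) = 0) \<longleftrightarrow> \<phi> = Y_counit"
proof -
  have hom: "calgebra_hom Y_counit"
    unfolding Y_counit_def by (rule calgebra_hom_poly_eval)
  have val: "Y_counit (Y w) = 0" if "length w \<ge> 2" for w :: "'a list"
    using that by (simp add: Y_counit_def poly_eval_Y)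
  show ?thesis using hom val by (auto intro: Yalg_hom_unique)
qed

end

theory Submission
  imports Defs
begin

text \<open>
  The structure of the proof is that of the incidence Hopf algebra of the non-crossing partition
  lattices.  Every axiom of a bialgebra is an identity between algebra homomorphisms on a polynomial
  algebra, so it is enough to compare both sides on the generators \<open>Y\<^sub>w\<close>; there it becomes a
  statement about non-crossing partitions of \<open>S = {1, \<dots>, |w|}\<close>, written in terms of the permutations
  \<open>P\<^sub>\<pi>\<close>.

  Everything rests on an explicit description of the Kreweras complement: two points \<open>x < y\<close> of \<open>S\<close>
  lie in the same block of \<open>K(\<pi>)\<close> iff the points \<open>z\<close> with \<open>x < z \<le> y\<close> form a union of blocks of
  \<open>\<pi>\<close>.  In this form \<open>K(\<pi>)\<close> is visibly a non-crossing partition, and following a point \<open>x\<close> through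
  \<open>P\<^sub>K\<^sub>(\<^sub>\<pi>\<^sub>)\<close> and \<open>P\<^sub>\<pi>\<close> shows \<open>P\<^sub>\<pi> P\<^sub>K\<^sub>(\<^sub>\<pi>\<^sub>) = P\<^sub>1\<close> (\<open>part_perm_kreweras_step\<close>).  The same computation tells
  at which points \<open>P\<^sub>K\<^sub>(\<^sub>\<pi>\<^sub>)\<close> increases, and counting these gives \<open>|\<pi>| + |K(\<pi>)| = |S| + 1\<close>
  (\<open>card_kreweras_on\<close>), which is compatibility of \<open>\<Delta>\<close> with the grading.

  For coassociativity, multiplying out \<open>\<Delta>(Y\<^sub>w\<^sub>;\<^sub>\<pi>)\<close> over the blocks of \<open>\<pi>\<close> gives the sum of
  \<open>Y\<^sub>w\<^sub>;\<^sub>\<rho> \<otimes> Y\<^sub>w\<^sub>;\<^sub>\<sigma>\<close> over all \<open>\<rho> \<le> \<pi>\<close>, where \<open>\<sigma>\<close> is the complement of \<open>\<rho>\<close> relative to \<open>\<pi>\<close>, that is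
  \<open>P\<^sub>\<rho> P\<^sub>\<sigma> = P\<^sub>\<pi>\<close> (\<open>Y_comult_Y_part\<close>).  Hence both iterated coproducts of \<open>Y\<^sub>w\<close> are sums over
  factorizations \<open>P\<^sub>\<rho> P\<^sub>\<sigma> P\<^sub>\<tau> = P\<^sub>1\<close>: one is indexed by the pairs \<open>\<rho> \<le> \<pi>\<close>, the other by the pairs
  \<open>\<rho>, \<sigma>\<close> with \<open>\<sigma> \<le> K(\<rho>)\<close>.  The map sending \<open>(\<pi>, \<rho>)\<close> to \<open>(\<rho>, \<sigma>)\<close> is injective and lands in the
  second index set.  As \<open>K\<close> is a bijection, both index sets have as many elements as the order
  relation of the lattice, so the map is a bijection (\<open>bij_betw_factorizations\<close>); surjectivity never
  has to be proved directly.

  The counit axioms say that only the partition into singletons has a complement with one block, and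
  conversely.  The grading is the decomposition by a weight of monomials in which \<open>Y\<^sub>w\<close> has weight
  \<open>|w| - 1\<close>; degree 0 consists of the constants because all generators have positive weight.

  Finally, a graded connected bialgebra always has an antipode: with \<open>J = id - \<epsilon>1\<close>, the geometric
  series of the convolution powers of \<open>-J\<close> is a finite sum at each element and inverts the
  identity (\<open>graded_connected_hopf\<close>).
\<close>

section \<open>Partitions and their permutations\<close>

text \<open>
  On a block \<open>A\<close> the permutation \<open>P\<^sub>\<pi>\<close> is the cycle on \<open>A\<close> in increasing order.  Treating this cycle
  for an arbitrary finite set \<open>A\<close> covers both \<open>P\<^sub>\<pi>\<close> and the long cycle \<open>P\<^sub>1\<close> on the ground set.
\<close>

definition cyclic_succ :: "nat set \<Rightarrow> nat \<Rightarrow> nat" where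
  "cyclic_succ A x = (if \<exists>y\<in>A. x < y then Min {y \<in> A. x < y} else Min A)"

text \<open>
  The working description of the cycle, free of minima: either \<open>y\<close> is the next element after \<open>x\<close>, or
  the cycle wraps around from the largest element to the smallest.
\<close>

lemma cyclic_succ_iff:
  assumes "finite A" "x \<in> A" "y \<in> A"
  shows "cyclic_succ A x = y \<longleftrightarrow>
    (x < y \<and> (\<forall>z\<in>A. \<not> (x < z \<and> z < y))) \<or> (\<forall>z\<in>A. y \<le> z \<and> z \<le> x)"
proof (cases "\<exists>y\<in>A. x < y")
  case True
  then have "cyclic_succ A x = y \<longleftrightarrow> y \<in> {y \<in> A. x < y} \<and> (\<forall>z\<in>{y \<in> A. x < y}. y \<le> z)"
    unfolding cyclic_succ_def using assms by (subst if_P, simp, subst Min_eq_iff) auto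
  then show ?thesis using True assms by (auto simp: not_less)
next
  case False
  then have "cyclic_succ A x = y \<longleftrightarrow> y \<in> A \<and> (\<forall>z\<in>A. y \<le> z)"
    unfolding cyclic_succ_def using assms by (subst if_not_P, simp, subst Min_eq_iff) auto
  then show ?thesis using False assms by (auto simp: not_less)
qed

lemma cyclic_succ_in: "finite A \<Longrightarrow> x \<in> A \<Longrightarrow> cyclic_succ A x \<in> A"
  using Min_in[of A] Min_in[of "{y \<in> A. x < y}"] by (fastforce simp: cyclic_succ_def)

lemma inj_on_cyclic_succ:
  assumes "finite A"
  shows "inj_on (cyclic_succ A) A"
proof (rule linorder_inj_onI)
  fix x x' assume x: "x < x'" "x \<in> A" "x' \<in> A"
  define y where "y = cyclic_succ A x"
  have y: "y \<in> A" unfolding y_def using assms x by (intro cyclic_succ_in)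
  have "cyclic_succ A x = y" by (simp add: y_def)
  then have "(x < y \<and> (\<forall>z\<in>A. \<not> (x < z \<and> z < y))) \<or> (\<forall>z\<in>A. y \<le> z \<and> z \<le> x)"
    using cyclic_succ_iff[OF assms x(2) y] by simp
  then have "\<not> ((x' < y \<and> (\<forall>z\<in>A. \<not> (x' < z \<and> z < y))) \<or> (\<forall>z\<in>A. y \<le> z \<and> z \<le> x'))"
    using x y by (meson leD less_trans)
  then have "cyclic_succ A x' \<noteq> y" unfolding cyclic_succ_iff[OF assms x(3) y] .
  then show "cyclic_succ A x \<noteq> cyclic_succ A x'" by (simp add: y_def)
qed auto

lemma cyclic_succ_surj:
  assumes "finite A" "y \<in> A"
  obtains x where "x \<in> A" "cyclic_succ A x = y"
proof -
  have "cyclic_succ A ` A = A"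
    using assms by (intro endo_inj_surj inj_on_cyclic_succ) (auto intro: cyclic_succ_in)
  then show thesis using that assms(2) by (metis imageE)
qed

text \<open>
  The cycle is transitive on \<open>A\<close>: it climbs from \<open>x\<close> to the maximum, jumps to the minimum and from
  there reaches every element.
\<close>

lemma cyclic_succ_closed_subset:
  assumes A: "finite A" and x: "x \<in> A" "x \<in> C"
    and closed: "\<And>y. y \<in> A \<Longrightarrow> y \<in> C \<Longrightarrow> cyclic_succ A y \<in> C"
  shows "A \<subseteq> C"
proof -
  have up: "y \<in> C" if "x \<in> A" "x \<in> C" "y \<in> A" "x \<le> y" for x y
    using that(3,4)
  proof (induction y rule: less_induct)
    case (less y)
    obtain z where z: "z \<in> A" "cyclic_succ A z = y"
      using cyclic_succ_surj[OF A less.prems(1)] by blast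
    show ?case
    proof (cases "y = x")
      case False
      then have "x < y" using less.prems by simp
      moreover have "(z < y \<and> (\<forall>u\<in>A. \<not> (z < u \<and> u < y))) \<or> (\<forall>u\<in>A. y \<le> u \<and> u \<le> z)"
        using z cyclic_succ_iff[OF A z(1) less.prems(1)] by simp
      ultimately have "x \<le> z" "z < y" using that(1) by (meson leD not_le)+
      then have "z \<in> C" using less z by blast
      then show ?thesis using closed[OF z(1)] z by simp
    qed (use that in simp)
  qed
  have "Max A \<in> C" using up[OF x Max_in[OF A]] A x Max_ge[OF A x(1)] by blast
  then have "cyclic_succ A (Max A) \<in> C" using closed[of "Max A"] Max_in[OF A] x by blast
  moreover have "cyclic_succ A (Max A) = Min A"
    using A x by (subst cyclic_succ_iff) (auto intro: Max_in Min_in)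
  ultimately have "Min A \<in> C" by simp
  moreover have "Min A \<in> A" using Min_in[OF A] x(1) by blast
  ultimately show ?thesis using up[of "Min A"] Min_le[OF A] by (intro subsetI) auto
qed

lemma partition_on_blockD:
  assumes "partition_on S \<pi>" "A \<in> \<pi>" "B \<in> \<pi>" "x \<in> A" "x \<in> B"
  shows "A = B"
  using assms by (auto simp: partition_on_def disjoint_def)

lemma partition_on_blockE:
  assumes "partition_on S \<pi>" "x \<in> S"
  obtains A where "A \<in> \<pi>" "x \<in> A"
  using assms by (auto simp: partition_on_def)

lemma finite_block: "finite S \<Longrightarrow> partition_on S \<pi> \<Longrightarrow> A \<in> \<pi> \<Longrightarrow> finite A"
  by (auto simp: partition_on_def intro: finite_subset)

lemma block_subset: "partition_on S \<pi> \<Longrightarrow> A \<in> \<pi> \<Longrightarrow> A \<subseteq> S"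
  by (auto simp: partition_on_def)

lemma block_nonempty: "partition_on S \<pi> \<Longrightarrow> A \<in> \<pi> \<Longrightarrow> A \<noteq> {}"
  by (auto simp: partition_on_def)

lemma block_of_eq:
  assumes "partition_on S \<pi>" "A \<in> \<pi>" "x \<in> A"
  shows "block_of \<pi> x = A"
  unfolding block_of_def using assms by (auto intro!: the_equality dest: partition_on_blockD)

lemma part_perm_eq_cyclic_succ:
  assumes "partition_on S \<pi>" "A \<in> \<pi>" "x \<in> A"
  shows "part_perm \<pi> x = cyclic_succ A x"
  using assms(2,3) unfolding part_perm_def block_of_eq[OF assms] cyclic_succ_def by auto

lemma part_perm_outside: "partition_on S \<pi> \<Longrightarrow> x \<notin> S \<Longrightarrow> part_perm \<pi> x = x"
  by (auto simp: part_perm_def partition_on_def)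

lemma part_perm_in_block:
  assumes "finite S" "partition_on S \<pi>" "A \<in> \<pi>" "x \<in> A"
  shows "part_perm \<pi> x \<in> A"
  using assms finite_block[OF assms(1-3)] by (simp add: part_perm_eq_cyclic_succ cyclic_succ_in)

lemma part_perm_in:
  assumes "finite S" "partition_on S \<pi>" "x \<in> S"
  shows "part_perm \<pi> x \<in> S"
proof -
  obtain A where "A \<in> \<pi>" "x \<in> A" using partition_on_blockE[OF assms(2,3)] .
  then show ?thesis using part_perm_in_block[OF assms(1,2)] block_subset[OF assms(2)] by blast
qed

lemma part_perm_inj:
  assumes S: "finite S" "partition_on S \<pi>"
  shows "inj (part_perm \<pi>)"
proof (rule injI)
  fix x y assume eq: "part_perm \<pi> x = part_perm \<pi> y"
  show "x = y"
  proof (cases "x \<in> S \<and> y \<in> S")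
    case True
    obtain A where A: "A \<in> \<pi>" "x \<in> A" using True partition_on_blockE[OF S(2)] by blast
    obtain B where B: "B \<in> \<pi>" "y \<in> B" using True partition_on_blockE[OF S(2)] by blast
    have "A = B"
      using partition_on_blockD[OF S(2) A(1) B(1) part_perm_in_block[OF S A]]
        part_perm_in_block[OF S B] unfolding eq by blast
    then show ?thesis
      using eq A B inj_onD[OF inj_on_cyclic_succ[OF finite_block[OF S A(1)]], of x y]
      by (simp add: part_perm_eq_cyclic_succ[OF S(2)])
  next
    case False
    have "part_perm \<pi> z \<in> S \<longleftrightarrow> z \<in> S" for z
      using part_perm_in[OF S, of z] part_perm_outside[OF S(2), of z] by (cases "z \<in> S") auto
    then have "x \<notin> S" "y \<notin> S" using False eq by metis+
    then show ?thesis using eq part_perm_outside[OF S(2)] by simp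
  qed
qed

lemma part_perm_surj_on:
  assumes S: "finite S" "partition_on S \<pi>"
  shows "part_perm \<pi> ` S = S"
  using S by (intro endo_inj_surj inj_on_subset[OF part_perm_inj[OF S]]) (auto intro: part_perm_in)

lemma part_perm_bij:
  assumes S: "finite S" "partition_on S \<pi>"
  shows "bij (part_perm \<pi>)"
proof -
  have "y \<in> range (part_perm \<pi>)" for y
  proof (cases "y \<in> S")
    case True
    then have "y \<in> part_perm \<pi> ` S" using part_perm_surj_on[OF S] by simp
    then show ?thesis by blast
  next
    case False
    then have "part_perm \<pi> y = y" by (rule part_perm_outside[OF S(2)])
    then show ?thesis by (rule range_eqI[OF sym])
  qed
  then show ?thesis using part_perm_inj[OF S] by (auto simp: bij_def)
qed

text \<open>
  The blocks are the orbits of the permutation.  Consequently equations between partitions can be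
  proved by comparing permutations.
\<close>

lemma part_perm_determines_partition:
  assumes S: "finite S" and p: "partition_on S \<pi>" "partition_on S \<pi>'"
    and eq: "\<And>x. x \<in> S \<Longrightarrow> part_perm \<pi> x = part_perm \<pi>' x"
  shows "\<pi> = \<pi>'"
proof -
  have sub: "A \<subseteq> C"
    if p: "partition_on S \<pi>" "partition_on S \<pi>'"
      and eq: "\<And>x. x \<in> S \<Longrightarrow> part_perm \<pi> x = part_perm \<pi>' x"
      and A: "A \<in> \<pi>" "C \<in> \<pi>'" "x \<in> A" "x \<in> C" for \<pi> \<pi>' A C x
  proof (rule cyclic_succ_closed_subset[OF finite_block[OF S p(1) A(1)] A(3,4)])
    fix y assume "y \<in> A" "y \<in> C"
    then have "cyclic_succ A y = part_perm \<pi>' y"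
      using part_perm_eq_cyclic_succ[OF p(1) A(1)] eq block_subset[OF p(1) A(1)] by force
    then show "cyclic_succ A y \<in> C" using part_perm_in_block[OF S p(2) A(2) \<open>y \<in> C\<close>] by simp
  qed
  have "\<pi> \<subseteq> \<pi>'"
    if p: "partition_on S \<pi>" "partition_on S \<pi>'"
      and eq: "\<And>x. x \<in> S \<Longrightarrow> part_perm \<pi> x = part_perm \<pi>' x" for \<pi> \<pi>'
  proof
    fix A assume A: "A \<in> \<pi>"
    then obtain x where x: "x \<in> A" using block_nonempty[OF p(1)] by blast
    then obtain C where C: "C \<in> \<pi>'" "x \<in> C"
      using block_subset[OF p(1) A] partition_on_blockE[OF p(2)] by blast
    have "A = C" using sub[OF p eq A C(1) x C(2)] sub[OF p(2,1) eq[symmetric] C(1) A C(2) x] by simp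
    then show "A \<in> \<pi>'" using C by simp
  qed
  from this[OF p eq] this[OF p(2,1) eq[symmetric]] show ?thesis by blast
qed

text \<open>
  In every block exactly one point, the maximum, is not moved upwards.
\<close>

lemma card_weak_descents:
  assumes S: "finite S" "partition_on S \<pi>"
  shows "card {x \<in> S. part_perm \<pi> x \<le> x} = card \<pi>"
proof -
  have "bij_betw Max \<pi> {x \<in> S. part_perm \<pi> x \<le> x}"
  proof (rule bij_betw_imageI)
    show "inj_on Max \<pi>"
    proof (rule inj_onI)
      fix A B assume "A \<in> \<pi>" "B \<in> \<pi>" "Max A = Max B"
      then show "A = B"
        using Max_in[OF finite_block[OF S \<open>A \<in> \<pi>\<close>] block_nonempty[OF S(2) \<open>A \<in> \<pi>\<close>]]
          Max_in[OF finite_block[OF S \<open>B \<in> \<pi>\<close>] block_nonempty[OF S(2) \<open>B \<in> \<pi>\<close>]]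
        by (intro partition_on_blockD[OF S(2), of A B "Max A"]) simp_all
    qed
    show "Max ` \<pi> = {x \<in> S. part_perm \<pi> x \<le> x}"
    proof (intro equalityI subsetI)
      fix x assume "x \<in> Max ` \<pi>"
      then obtain A where A: "A \<in> \<pi>" "x = Max A" by blast
      note fin = finite_block[OF S A(1)]
      have x: "x \<in> A" using Max_in[OF fin block_nonempty[OF S(2) A(1)]] A by simp
      have "part_perm \<pi> x \<le> x" using part_perm_in_block[OF S A(1) x] A fin by simp
      then show "x \<in> {x \<in> S. part_perm \<pi> x \<le> x}" using x block_subset[OF S(2) A(1)] by auto
    next
      fix x assume "x \<in> {x \<in> S. part_perm \<pi> x \<le> x}"
      then have x: "x \<in> S" "part_perm \<pi> x \<le> x" by auto
      then obtain A where A: "A \<in> \<pi>" "x \<in> A" using partition_on_blockE[OF S(2)] by blast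
      note fin = finite_block[OF S A(1)]
      have "\<forall>z\<in>A. z \<le> x"
        using x part_perm_eq_cyclic_succ[OF S(2) A] cyclic_succ_iff[OF fin A(2) cyclic_succ_in[OF fin A(2)]]
        by auto
      then have "x = Max A" using A fin by (intro Max_eqI[symmetric]) auto
      then show "x \<in> Max ` \<pi>" using A by blast
    qed
  qed
  then show ?thesis by (simp add: bij_betw_same_card)
qed

section \<open>The Kreweras complement\<close>

text \<open>
  Arbitrary ground sets are needed because the coproduct of \<open>Y\<^sub>w\<^sub>;\<^sub>\<pi>\<close> involves the non-crossing
  partitions of each block of \<open>\<pi>\<close>.
\<close>

definition noncrossing_partitions :: "nat set \<Rightarrow> nat set set set" where
  "noncrossing_partitions S = {\<pi>. partition_on S \<pi> \<and>
     \<not> (\<exists>A\<in>\<pi>. \<exists>B\<in>\<pi>. A \<noteq> B \<and>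
         (\<exists>a b c d. a < b \<and> b < c \<and> c < d \<and> a \<in> A \<and> c \<in> A \<and> b \<in> B \<and> d \<in> B))}"

lemma NC_eq_noncrossing_partitions: "NC n = noncrossing_partitions {1..n}"
  by (simp add: NC_def noncrossing_partitions_def)

lemma noncrossing_partition_on: "\<pi> \<in> noncrossing_partitions S \<Longrightarrow> partition_on S \<pi>"
  by (simp add: noncrossing_partitions_def)

lemma noncrossingD:
  assumes "\<pi> \<in> noncrossing_partitions S" "A \<in> \<pi>" "B \<in> \<pi>"
    "a < b" "b < c" "c < d" "a \<in> A" "c \<in> A" "b \<in> B" "d \<in> B"
  shows "A = B"
proof (rule ccontr)
  assume "A \<noteq> B"
  moreover have "\<exists>a b c d. a < b \<and> b < c \<and> c < d \<and> a \<in> A \<and> c \<in> A \<and> b \<in> B \<and> d \<in> B"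
    by (rule exI[of _ a], rule exI[of _ b], rule exI[of _ c], rule exI[of _ d]) (simp add: assms(4-))
  ultimately have "\<exists>A\<in>\<pi>. \<exists>B\<in>\<pi>. A \<noteq> B \<and>
      (\<exists>a b c d. a < b \<and> b < c \<and> c < d \<and> a \<in> A \<and> c \<in> A \<and> b \<in> B \<and> d \<in> B)"
    using assms(2,3) by (intro bexI[of _ A] bexI[of _ B] conjI)
  then show False
    using assms(1)[unfolded noncrossing_partitions_def mem_Collect_eq, THEN conjunct2]
    by (rule notE[rotated])
qed

lemma noncrossingI:
  assumes "partition_on S \<pi>"
    and "\<And>A B a b c d. A \<in> \<pi> \<Longrightarrow> B \<in> \<pi> \<Longrightarrow> a < b \<Longrightarrow> b < c \<Longrightarrow> c < d \<Longrightarrow>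
      a \<in> A \<Longrightarrow> c \<in> A \<Longrightarrow> b \<in> B \<Longrightarrow> d \<in> B \<Longrightarrow> A = B"
  shows "\<pi> \<in> noncrossing_partitions S"
  using assms unfolding noncrossing_partitions_def by blast

lemma finite_noncrossing_partitions: "finite S \<Longrightarrow> finite (noncrossing_partitions S)"
  by (rule finite_subset[OF _ finitely_many_partition_on[of S]]) (auto simp: noncrossing_partitions_def)

text \<open>
  For \<open>x \<le> y\<close> the condition says that no block of \<open>\<pi>\<close> contains both a point of \<open>{x<..y}\<close> and a point
  outside of it.  In the usual picture of the complement, with a copy \<open>z'\<close> of each point placed
  directly after \<open>z\<close>, these are the \<open>x'\<close> and \<open>y'\<close> that are not separated by an arc of \<open>\<pi>\<close>.
\<close>

definition kreweras_rel :: "nat set \<Rightarrow> nat set set \<Rightarrow> (nat \<times> nat) set" where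
  "kreweras_rel S \<pi> = {(x, y). x \<in> S \<and> y \<in> S \<and>
     (\<forall>B\<in>\<pi>. \<forall>z\<in>B. \<forall>w\<in>B. z \<in> {min x y<..max x y} \<longrightarrow> w \<in> {min x y<..max x y})}"

definition kreweras_on :: "nat set \<Rightarrow> nat set set \<Rightarrow> nat set set" where
  "kreweras_on S \<pi> = S // kreweras_rel S \<pi>"

lemma equiv_kreweras_rel: "equiv S (kreweras_rel S \<pi>)"
proof (rule equivI)
  show "kreweras_rel S \<pi> \<subseteq> S \<times> S" "refl_on S (kreweras_rel S \<pi>)"
    by (auto simp: kreweras_rel_def refl_on_def)
  show "sym (kreweras_rel S \<pi>)"
  proof (rule symI)
    fix x y assume "(x, y) \<in> kreweras_rel S \<pi>"
    then show "(y, x) \<in> kreweras_rel S \<pi>"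
      unfolding kreweras_rel_def mem_Collect_eq prod.case min.commute[of y x] max.commute[of y x]
      by (elim conjE) (intro conjI)
  qed
  show "trans (kreweras_rel S \<pi>)"
  proof (rule transI)
    fix x y z assume xyz: "(x, y) \<in> kreweras_rel S \<pi>" "(y, z) \<in> kreweras_rel S \<pi>"
    let ?I = "\<lambda>x y. {min x y<..max x y}"
    \<comment> \<open>up to order, the interval from x to z is the symmetric difference of the other two\<close>
    have *: "u \<in> ?I x z \<longleftrightarrow> (u \<in> ?I x y) \<noteq> (u \<in> ?I y z)" for u
      by (auto simp: min_def max_def)
    have iff: "u \<in> ?I a b \<longleftrightarrow> v \<in> ?I a b"
      if "(a, b) \<in> kreweras_rel S \<pi>" "B \<in> \<pi>" "u \<in> B" "v \<in> B" for a b B u v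
    proof -
      have "\<forall>B\<in>\<pi>. \<forall>z\<in>B. \<forall>w\<in>B. z \<in> ?I a b \<longrightarrow> w \<in> ?I a b"
        using that(1) unfolding kreweras_rel_def mem_Collect_eq prod.case by (elim conjE)
      from bspec[OF bspec[OF bspec[OF this that(2)] that(3)] that(4)]
        bspec[OF bspec[OF bspec[OF this that(2)] that(4)] that(3)] show ?thesis by blast
    qed
    have "v \<in> ?I x z" if "B \<in> \<pi>" "u \<in> B" "v \<in> B" "u \<in> ?I x z" for B u v
      using that(4) unfolding * iff[OF xyz(1) that(1-3)] iff[OF xyz(2) that(1-3)] .
    moreover have "x \<in> S" "z \<in> S" using xyz by (simp_all only: kreweras_rel_def mem_Collect_eq prod.case)
    ultimately show "(x, z) \<in> kreweras_rel S \<pi>" unfolding kreweras_rel_def by blast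
  qed
qed

lemma partition_on_kreweras_on: "partition_on S (kreweras_on S \<pi>)"
  unfolding kreweras_on_def by (rule partition_on_quotient[OF equiv_kreweras_rel])

lemma kreweras_on_sameblock_iff:
  assumes "A \<in> kreweras_on S \<pi>" "x \<in> A"
  shows "y \<in> A \<longleftrightarrow> (x, y) \<in> kreweras_rel S \<pi>"
proof -
  obtain a where a: "A = kreweras_rel S \<pi> `` {a}"
    using assms(1) by (auto simp: kreweras_on_def elim: quotientE)
  then have "kreweras_rel S \<pi> `` {a} = kreweras_rel S \<pi> `` {x}"
    using assms(2) by (intro equiv_class_eq[OF equiv_kreweras_rel]) simp
  then show ?thesis using a by simp
qed

lemma kreweras_relI:
  assumes "x \<in> S" "y \<in> S" "x \<le> y"
    and "\<And>B z w. B \<in> \<pi> \<Longrightarrow> z \<in> B \<Longrightarrow> w \<in> B \<Longrightarrow> x < z \<Longrightarrow> z \<le> y \<Longrightarrow> x < w \<and> w \<le> y"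
  shows "(x, y) \<in> kreweras_rel S \<pi>" "(y, x) \<in> kreweras_rel S \<pi>"
proof -
  have "\<forall>B\<in>\<pi>. \<forall>z\<in>B. \<forall>w\<in>B. z \<in> {x<..y} \<longrightarrow> w \<in> {x<..y}"
  proof (intro ballI impI)
    fix B z w assume "B \<in> \<pi>" "z \<in> B" "w \<in> B" "z \<in> {x<..y}"
    then show "w \<in> {x<..y}" using assms(4)[of B z w] by simp
  qed
  then have *: "x \<in> S \<and> y \<in> S \<and> (\<forall>B\<in>\<pi>. \<forall>z\<in>B. \<forall>w\<in>B. z \<in> {x<..y} \<longrightarrow> w \<in> {x<..y})"
    using assms(1,2) by (intro conjI)
  show "(x, y) \<in> kreweras_rel S \<pi>"
    unfolding kreweras_rel_def mem_Collect_eq prod.case min_absorb1[OF assms(3)] max_absorb2[OF assms(3)]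
    by (rule *)
  show "(y, x) \<in> kreweras_rel S \<pi>"
    unfolding kreweras_rel_def mem_Collect_eq prod.case min_absorb2[OF assms(3)] max_absorb1[OF assms(3)]
    using * by (elim conjE) (intro conjI)
qed

lemma kreweras_relD:
  assumes "(x, y) \<in> kreweras_rel S \<pi>" "x \<le> y" "B \<in> \<pi>" "z \<in> B" "w \<in> B" "x < z" "z \<le> y"
  shows "x < w \<and> w \<le> y"
proof -
  have "\<forall>B\<in>\<pi>. \<forall>z\<in>B. \<forall>w\<in>B. z \<in> {x<..y} \<longrightarrow> w \<in> {x<..y}"
    using assms(1) unfolding kreweras_rel_def mem_Collect_eq prod.case min_absorb1[OF assms(2)]
      max_absorb2[OF assms(2)] by (elim conjE)
  then have "z \<in> {x<..y} \<longrightarrow> w \<in> {x<..y}" using assms(3-5) by blast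
  then show ?thesis using assms(6,7) by simp
qed

lemma kreweras_on_noncrossing: "kreweras_on S \<pi> \<in> noncrossing_partitions S"
proof (rule noncrossingI[OF partition_on_kreweras_on])
  fix A B a b c d
  assume AB: "A \<in> kreweras_on S \<pi>" "B \<in> kreweras_on S \<pi>" and less: "a < b" "b < c" "c < d"
    and mem: "a \<in> A" "c \<in> A" "b \<in> B" "d \<in> B"
  have ac: "(a, c) \<in> kreweras_rel S \<pi>" and bd: "(b, d) \<in> kreweras_rel S \<pi>"
    using kreweras_on_sameblock_iff[OF AB(1) mem(1)] kreweras_on_sameblock_iff[OF AB(2) mem(3)] mem
    by blast+
  \<comment> \<open>\<open>{b<..c}\<close> is the intersection of the two unions of blocks \<open>{a<..c}\<close> and \<open>{b<..d}\<close>\<close>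
  have "b < w \<and> w \<le> c" if "C \<in> \<pi>" "z \<in> C" "w \<in> C" "b < z" "z \<le> c" for C z w
    using kreweras_relD[OF ac _ that(1-3)] kreweras_relD[OF bd _ that(1-3)] that(4,5) less by linarith
  moreover have "b \<in> S" "c \<in> S" using ac bd by (simp_all only: kreweras_rel_def mem_Collect_eq prod.case)
  moreover have "b \<le> c" using less by simp
  ultimately have "(b, c) \<in> kreweras_rel S \<pi>" by (intro kreweras_relI(1))
  then have "c \<in> B" using kreweras_on_sameblock_iff[OF AB(2) mem(3)] by blast
  then show "A = B" by (rule partition_on_blockD[OF partition_on_kreweras_on AB mem(2)])
qed

text \<open>
  Let \<open>t\<close> be the cyclic successor of \<open>x\<close> in \<open>S\<close>, let \<open>A\<close> be its block in \<open>\<pi>\<close> and let \<open>y\<close> precede \<open>t\<close>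
  on the cycle of \<open>A\<close>.  Because \<open>\<pi>\<close> is non-crossing, the points cyclically between two
  consecutive points of \<open>A\<close> form a union of blocks; therefore \<open>y\<close> lies in the block of \<open>x\<close> in the complement.  No
  closer point does, since an interval that contains one of \<open>t\<close> and \<open>y\<close> must contain the other.  Hence
  the complement maps \<open>x\<close> to \<open>y\<close>, and \<open>\<pi>\<close> maps \<open>y\<close> to \<open>t\<close>.  The second conjunct records when \<open>x < y\<close>
  happens: precisely if \<open>t\<close> is the minimum of its block without being the minimum of \<open>S\<close>.  It is what
  makes the block count below possible.
\<close>

lemma part_perm_kreweras_step:
  assumes S: "finite S" and \<pi>: "\<pi> \<in> noncrossing_partitions S" and x: "x \<in> S"
  shows "part_perm \<pi> (part_perm (kreweras_on S \<pi>) x) = cyclic_succ S x \<and>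
    (x < part_perm (kreweras_on S \<pi>) x \<longleftrightarrow>
      cyclic_succ S x \<le> part_perm (kreweras_on S \<pi>) x \<and> cyclic_succ S x \<noteq> Min S)"
proof -
  note p = noncrossing_partition_on[OF \<pi>]
  define t where "t = cyclic_succ S x"
  have t: "t \<in> S" using S x by (simp add: t_def cyclic_succ_in)
  obtain A where A: "A \<in> \<pi>" "t \<in> A" using partition_on_blockE[OF p t] by blast
  note finA = finite_block[OF S p A(1)]
  obtain y where y: "y \<in> A" "cyclic_succ A y = t" using cyclic_succ_surj[OF finA A(2)] by blast
  have yS: "y \<in> S" using block_subset[OF p A(1)] y(1) by blast
  have x_t: "(x < t \<and> (\<forall>z\<in>S. \<not> (x < z \<and> z < t))) \<or> (\<forall>z\<in>S. t \<le> z \<and> z \<le> x)"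
    using cyclic_succ_iff[OF S x t] by (simp add: t_def)
  have y_t: "(y < t \<and> (\<forall>z\<in>A. \<not> (y < z \<and> z < t))) \<or> (\<forall>z\<in>A. t \<le> z \<and> z \<le> y)"
    using cyclic_succ_iff[OF finA y(1) A(2)] y(2) by simp
  obtain C where C: "C \<in> kreweras_on S \<pi>" "x \<in> C"
    using partition_on_blockE[OF partition_on_kreweras_on x] by blast
  note finC = finite_block[OF S partition_on_kreweras_on C(1)]
  let ?R = "kreweras_rel S \<pi>"
  have C_iff: "z \<in> C \<longleftrightarrow> (x, z) \<in> ?R" for z
    by (rule kreweras_on_sameblock_iff[OF C])
  have A_sat: "y \<in> {min x z<..max x z} \<longleftrightarrow> t \<in> {min x z<..max x z}" if "z \<in> C" for z
    using that A y unfolding C_iff kreweras_rel_def by blast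
  have C_S: "z \<in> S" if "z \<in> C" for z using block_subset[OF partition_on_kreweras_on C(1)] that by blast
  have cross: "w \<in> A" if "B \<in> \<pi>" "z \<in> B" "w \<in> B" "a \<in> A" "a' \<in> A"
      "(w < a \<and> a < z \<and> z < a') \<or> (a < z \<and> z < a' \<and> a' < w) \<or> (z < a \<and> a < w \<and> w < a')
       \<or> (a < w \<and> w < a' \<and> a' < z)" for B z w a a'
    using that noncrossingD[OF \<pi> that(1) A(1)] noncrossingD[OF \<pi> A(1) that(1)] by blast
  have "y \<in> C \<and> ((x < y \<and> (\<forall>z\<in>C. \<not> (x < z \<and> z < y))) \<or> (\<forall>z\<in>C. y \<le> z \<and> z \<le> x)) \<and>
      (x < y \<longleftrightarrow> t \<le> y \<and> t \<noteq> Min S)"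
  proof (cases "x < t")
    case xt: True
    then have "\<forall>z\<in>S. \<not> (x < z \<and> z < t)" using x_t x by (metis leD)
    then have gap: "z \<le> x \<or> t \<le> z" if "z \<in> S" for z using that by force
    have tMin: "t \<noteq> Min S" using xt S x by (metis Min_le leD)
    show ?thesis
    \<comment> \<open>y < t: A continues from y to t across the gap; otherwise t is the minimum of A and y its maximum\<close>
    proof (cases "y < t")
      case yt: True
      then have yx: "y \<le> x" using gap[OF yS] by auto
      have "y < w \<and> w \<le> x" if "B \<in> \<pi>" "z \<in> B" "w \<in> B" "y < z" "z \<le> x" for B z w
      proof -
        have z: "z \<notin> A" "z < t" using y_t that xt by auto
        then have "w \<notin> A" using partition_on_blockD[OF p that(1) A(1) that(3)] that(2) by blast
        then have "w \<noteq> y" "w \<noteq> t" using y(1) A(2) by blast+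
        then have "y < w \<and> w < t"
          using cross[OF that(1-3) y(1) A(2)] that(4) z \<open>w \<notin> A\<close> by linarith
        then show ?thesis using gap[of w] block_subset[OF p that(1)] that(3) by auto
      qed
      then have "y \<in> C" unfolding C_iff by (rule kreweras_relI(2)[OF yS x yx])
      moreover have "y \<le> z \<and> z \<le> x" if "z \<in> C" for z
      proof (rule ccontr)
        assume "\<not> (y \<le> z \<and> z \<le> x)"
        then have "z < y \<or> (x < z \<and> t \<le> z)" using gap[OF C_S[OF that]] by force
        then show False using A_sat[OF that] xt yx by (auto simp: min_def max_def)
      qed
      ultimately show ?thesis using leD[OF yx] leD[of t y] yt by blast
    next
      case False
      then have tA: "t \<le> z \<and> z \<le> y" if "z \<in> A" for z using y_t that by auto
      have "x < w \<and> w \<le> y" if "B \<in> \<pi>" "z \<in> B" "w \<in> B" "x < z" "z \<le> y" for B z w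
      proof (cases "w \<in> A")
        case True
        then show ?thesis using tA[OF True] xt by auto
      next
        case False
        then have z: "z \<notin> A" using partition_on_blockD[OF p that(1) A(1) that(2)] that(3) by blast
        moreover have "t \<le> z" using gap[of z] block_subset[OF p that(1)] that by auto
        moreover have "z \<noteq> t" "z \<noteq> y" using z A(2) y(1) by blast+
        ultimately have "t < z" "z < y" using that(5) by auto
        moreover have "w \<noteq> t" "w \<noteq> y" using False A(2) y(1) by blast+
        ultimately have "t < w \<and> w < y"
          using cross[OF that(1-3) A(2) y(1)] False by linarith
        then show ?thesis using xt by auto
      qed
      moreover have xy: "x < y" using tA[OF A(2)] xt by auto
      ultimately have "y \<in> C" unfolding C_iff by (intro kreweras_relI(1)[OF x yS less_imp_le])
      moreover have "\<not> (x < z \<and> z < y)" if "z \<in> C" for z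
        using gap[OF C_S[OF that]] A_sat[OF that] xt tA[OF A(2)] by (auto simp: min_def max_def)
      ultimately show ?thesis using xy tA[OF y(1)] tMin by auto
    qed
  next
    case False
    then have Sx: "t \<le> z \<and> z \<le> x" if "z \<in> S" for z using x_t that by auto
    then have tMin: "t = Min S" using S t by (intro Min_eqI[symmetric]) auto
    have tA: "t \<le> z \<and> z \<le> y" if "z \<in> A" for z
      using y_t that Sx[OF yS] by auto
    have "y < w \<and> w \<le> x" if "B \<in> \<pi>" "z \<in> B" "w \<in> B" "y < z" "z \<le> x" for B z w
    proof -
      have "z \<notin> A" using tA[of z] that(4) by auto
      then have wA: "w \<notin> A" using partition_on_blockD[OF p that(1) A(1) that(3)] that(2) by blast
      have w: "t \<le> w \<and> w \<le> x" using Sx[of w] block_subset[OF p that(1)] that by auto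
      have "t \<noteq> w" "y \<noteq> w" using wA A y by blast+
      then have "y < w" using cross[OF that(1-3) A(2) y(1)] wA w that(4) by linarith
      then show ?thesis using w by auto
    qed
    moreover have "y \<le> x" using Sx[OF yS] by simp
    ultimately have "y \<in> C" unfolding C_iff by (intro kreweras_relI(2)[OF yS x])
    moreover have "y \<le> z \<and> z \<le> x" if "z \<in> C" for z
    proof -
      have "\<not> z < y"
        using A_sat[OF that] Sx[OF yS] Sx[OF C_S[OF that]] by (auto simp: min_def max_def)
      then show ?thesis using Sx[OF C_S[OF that]] by auto
    qed
    ultimately show ?thesis using tMin \<open>y \<le> x\<close> leD[OF \<open>y \<le> x\<close>] by blast
  qed
  then have "cyclic_succ C x = y" "x < y \<longleftrightarrow> t \<le> y \<and> t \<noteq> Min S"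
    using cyclic_succ_iff[OF finC C(2)] by auto
  moreover have "part_perm (kreweras_on S \<pi>) x = cyclic_succ C x"
    by (rule part_perm_eq_cyclic_succ[OF partition_on_kreweras_on C])
  moreover have "part_perm \<pi> y = t"
    using part_perm_eq_cyclic_succ[OF p A(1) y(1)] y(2) by simp
  ultimately show ?thesis unfolding t_def by metis
qed

lemmas part_perm_kreweras = part_perm_kreweras_step[THEN conjunct1]

text \<open>
  The complement is characterized by \<open>P\<^sub>\<pi> P\<^sub>\<sigma> = P\<^sub>1\<close>, since \<open>P\<^sub>\<pi>\<close> is injective and \<open>P\<^sub>\<sigma>\<close> determines \<open>\<sigma>\<close>.
\<close>

lemma kreweras_on_unique:
  assumes S: "finite S" and \<pi>: "\<pi> \<in> noncrossing_partitions S" and \<sigma>: "partition_on S \<sigma>"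
    and eq: "\<And>x. x \<in> S \<Longrightarrow> part_perm \<pi> (part_perm \<sigma> x) = cyclic_succ S x"
  shows "\<sigma> = kreweras_on S \<pi>"
  by (rule part_perm_determines_partition[OF S \<sigma> partition_on_kreweras_on])
    (metis eq part_perm_kreweras[OF S \<pi>] part_perm_inj[OF S noncrossing_partition_on[OF \<pi>]] injD)

lemma part_perm_one_block: "S \<noteq> {} \<Longrightarrow> x \<in> S \<Longrightarrow> part_perm {S} x = cyclic_succ S x"
  by (rule part_perm_eq_cyclic_succ[OF partition_on_space]) auto

lemma kreweras_eq_kreweras_on:
  assumes "\<pi> \<in> NC n" "n \<ge> 1"
  shows "kreweras n \<pi> = kreweras_on {1..n} \<pi>"
  unfolding kreweras_def
proof (rule the_equality)
  let ?S = "{1..n}"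
  have \<pi>: "\<pi> \<in> noncrossing_partitions ?S" and p: "partition_on ?S \<pi>"
    using assms noncrossing_partition_on by (auto simp: NC_eq_noncrossing_partitions)
  have ne: "?S \<noteq> {}" using assms by auto
  have bij: "bij (part_perm \<pi>)" by (rule part_perm_bij[OF _ p]) simp
  have iff: "part_perm \<sigma> = inv (part_perm \<pi>) \<circ> part_perm {?S} \<longleftrightarrow>
      (\<forall>x\<in>?S. part_perm \<pi> (part_perm \<sigma> x) = cyclic_succ ?S x)" if \<sigma>: "partition_on ?S \<sigma>" for \<sigma>
  proof -
    have "part_perm \<sigma> = inv (part_perm \<pi>) \<circ> part_perm {?S} \<longleftrightarrow>
        (\<forall>x. part_perm \<pi> (part_perm \<sigma> x) = part_perm {?S} x)"
      using bij by (auto simp: fun_eq_iff bij_inv_eq_iff bij_is_surj surj_f_inv_f) 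
    moreover have "part_perm \<pi> (part_perm \<sigma> x) = part_perm {?S} x" if "x \<notin> ?S" for x
      using part_perm_outside[OF p that] part_perm_outside[OF \<sigma> that]
        part_perm_outside[OF partition_on_space[OF ne] that] by simp
    ultimately show ?thesis using part_perm_one_block[OF ne] by metis
  qed
  show "kreweras_on ?S \<pi> \<in> NC n \<and>
      part_perm (kreweras_on ?S \<pi>) = inv (part_perm \<pi>) \<circ> part_perm {?S}"
    using kreweras_on_noncrossing iff[OF partition_on_kreweras_on] part_perm_kreweras[OF _ \<pi>]
    by (auto simp: NC_eq_noncrossing_partitions)
  fix \<sigma> assume \<sigma>: "\<sigma> \<in> NC n \<and> part_perm \<sigma> = inv (part_perm \<pi>) \<circ> part_perm {?S}"
  then have "partition_on ?S \<sigma>" by (auto simp: NC_eq_noncrossing_partitions noncrossing_partition_on)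
  then show "\<sigma> = kreweras_on ?S \<pi>"
    using iff \<sigma> by (intro kreweras_on_unique[OF _ \<pi>]) auto
qed

text \<open>
  The points that \<open>P\<^sub>K\<^sub>(\<^sub>\<pi>\<^sub>)\<close> moves upwards number \<open>|S| - |K(\<pi>)|\<close>.  Their images are the maxima of the
  blocks of \<open>\<pi>\<close>, except for the block that contains the minimum of \<open>S\<close>, so they also number
  \<open>|\<pi>| - 1\<close>.
\<close>

lemma card_kreweras_on:
  assumes S: "finite S" "S \<noteq> {}" and \<pi>: "\<pi> \<in> noncrossing_partitions S"
  shows "card \<pi> + card (kreweras_on S \<pi>) = card S + 1"
proof -
  let ?K = "kreweras_on S \<pi>"
  note p = noncrossing_partition_on[OF \<pi>] and q = partition_on_kreweras_on[of S \<pi>]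
  let ?D = "{y \<in> S. part_perm \<pi> y \<le> y}"
  let ?U = "{x \<in> S. x < part_perm ?K x}"
  note inj = part_perm_inj[OF S(1) p] and injK = part_perm_inj[OF S(1) q]
  obtain m where m: "m \<in> S" "part_perm \<pi> m = Min S"
    using part_perm_surj_on[OF S(1) p] Min_in[OF S] by (metis imageE)
  have "part_perm ?K ` ?U = ?D - {m}"
  proof (intro equalityI subsetI)
    fix y assume "y \<in> part_perm ?K ` ?U"
    then obtain x where x: "x \<in> S" "x < part_perm ?K x" "y = part_perm ?K x" by blast
    then show "y \<in> ?D - {m}"
      using part_perm_kreweras_step[OF S(1) \<pi> x(1)] m part_perm_in[OF S(1) q x(1)] by auto
  next
    fix y assume y: "y \<in> ?D - {m}"
    then obtain x where x: "x \<in> S" "y = part_perm ?K x"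
      using part_perm_surj_on[OF S(1) q] by (metis (no_types, lifting) DiffD1 imageE mem_Collect_eq)
    have "part_perm \<pi> y \<noteq> Min S" using y m inj by (metis DiffD2 injD singletonI)
    then show "y \<in> part_perm ?K ` ?U"
      using part_perm_kreweras_step[OF S(1) \<pi> x(1)] y x by auto
  qed
  then have "card ?U = card (?D - {m})"
    using card_image[OF inj_on_subset[OF injK subset_UNIV], of ?U] by simp
  moreover have "m \<in> ?D" using m S by simp
  then have "card (?D - {m}) = card ?D - 1" "card ?D > 0" using S(1) by (auto simp: card_gt_0_iff)
  moreover have "card ?U + card {x \<in> S. part_perm ?K x \<le> x} = card S"
  proof -
    have "S = ?U \<union> {x \<in> S. part_perm ?K x \<le> x}" by auto
    then show ?thesis using S(1) by (subst card_Un_disjoint[symmetric]) auto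
  qed
  ultimately show ?thesis using card_weak_descents[OF S(1) p] card_weak_descents[OF S(1) q] by simp
qed

section \<open>Intervals of non-crossing partitions\<close>

definition noncrossing_below :: "nat set \<Rightarrow> nat set set \<Rightarrow> nat set set set" where
  "noncrossing_below S \<pi> = {\<rho> \<in> noncrossing_partitions S. \<forall>B\<in>\<rho>. \<exists>A\<in>\<pi>. B \<subseteq> A}"

text \<open>
  For \<open>\<rho> \<le> \<pi>\<close> and a block \<open>A\<close> of \<open>\<pi>\<close> this is the partition that \<open>\<rho>\<close> induces on \<open>A\<close>.
\<close>

definition blocks_inside :: "nat set set \<Rightarrow> nat set \<Rightarrow> nat set set" where
  "blocks_inside \<rho> A = {B \<in> \<rho>. B \<subseteq> A}"

text \<open>
  The complement of \<open>\<rho>\<close> in the interval below \<open>\<pi>\<close>, which is the product of the lattices of the blocks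
  of \<open>\<pi>\<close>; in terms of permutations it is \<open>P\<^sub>\<rho>\<^sup>-\<^sup>1 P\<^sub>\<pi>\<close>.
\<close>

definition relative_kreweras :: "nat set set \<Rightarrow> nat set set \<Rightarrow> nat set set" where
  "relative_kreweras \<pi> \<rho> = (\<Union>A\<in>\<pi>. kreweras_on A (blocks_inside \<rho> A))"

lemma finite_noncrossing_below: "finite S \<Longrightarrow> finite (noncrossing_below S \<pi>)"
  unfolding noncrossing_below_def by (simp add: finite_noncrossing_partitions)

lemma noncrossing_belowD:
  assumes "\<rho> \<in> noncrossing_below S \<pi>"
  shows "\<rho> \<in> noncrossing_partitions S" "partition_on S \<rho>"
  using assms noncrossing_partition_on by (auto simp: noncrossing_below_def)

lemma noncrossing_below_block:
  assumes \<pi>: "partition_on S \<pi>" and \<rho>: "\<rho> \<in> noncrossing_below S \<pi>"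
    and A: "A \<in> \<pi>" and B: "B \<in> \<rho>" and x: "x \<in> A" "x \<in> B"
  shows "B \<subseteq> A"
proof -
  obtain A' where "A' \<in> \<pi>" "B \<subseteq> A'" using \<rho> B unfolding noncrossing_below_def by blast
  then show ?thesis using partition_on_blockD[OF \<pi> A] x by blast
qed

lemma blocks_inside_noncrossing:
  assumes \<pi>: "partition_on S \<pi>" and \<rho>: "\<rho> \<in> noncrossing_below S \<pi>" and A: "A \<in> \<pi>"
  shows "blocks_inside \<rho> A \<in> noncrossing_partitions A"
proof (rule noncrossingI)
  note \<rho>' = noncrossing_belowD[OF \<rho>]
  show "partition_on A (blocks_inside \<rho> A)"
  proof (rule partition_onI)
    show "\<Union>(blocks_inside \<rho> A) = A"
    proof
      show "A \<subseteq> \<Union>(blocks_inside \<rho> A)"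
      proof
        fix x assume x: "x \<in> A"
        then have "x \<in> S" using block_subset[OF \<pi> A] by blast
        then obtain B where B: "B \<in> \<rho>" "x \<in> B" using partition_on_blockE[OF \<rho>'(2)] by blast
        then show "x \<in> \<Union>(blocks_inside \<rho> A)"
          using noncrossing_below_block[OF \<pi> \<rho> A B(1) x B(2)] by (auto simp: blocks_inside_def)
      qed
    qed (auto simp: blocks_inside_def)
    show "{} \<notin> blocks_inside \<rho> A"
      using partition_onD3[OF \<rho>'(2)] by (auto simp: blocks_inside_def)
    fix B C assume "B \<in> blocks_inside \<rho> A" "C \<in> blocks_inside \<rho> A" "B \<noteq> C"
    then show "disjnt B C"
      using partition_onD2[OF \<rho>'(2)] unfolding blocks_inside_def disjoint_def disjnt_def by blast
  qed
  fix B C a b c d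
  assume "B \<in> blocks_inside \<rho> A" "C \<in> blocks_inside \<rho> A" and
    h: "a < b" "b < c" "c < d" "a \<in> B" "c \<in> B" "b \<in> C" "d \<in> C"
  then show "B = C"
    by (intro noncrossingD[OF \<rho>'(1) _ _ h]) (simp_all add: blocks_inside_def)
qed

lemma partition_on_glue:
  assumes \<pi>: "partition_on S \<pi>" and f: "\<And>A. A \<in> \<pi> \<Longrightarrow> partition_on A (f A)"
  shows "partition_on S (\<Union>A\<in>\<pi>. f A)"
proof (rule partition_onI)
  show "\<Union>(\<Union>A\<in>\<pi>. f A) = S"
    using partition_onD1[OF \<pi>] partition_onD1[OF f] by blast
  fix B C assume BC: "B \<in> (\<Union>A\<in>\<pi>. f A)" "C \<in> (\<Union>A\<in>\<pi>. f A)" "B \<noteq> C"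
  then obtain A A' where A: "A \<in> \<pi>" "B \<in> f A" "A' \<in> \<pi>" "C \<in> f A'" by blast
  show "disjnt B C"
  proof (cases "A = A'")
    case True
    then show ?thesis using partition_onD2[OF f[OF A(1)]] A BC(3) unfolding disjoint_def disjnt_def by blast
  next
    case False
    then have "A \<inter> A' = {}" using partition_onD2[OF \<pi>] A unfolding disjoint_def by blast
    then show ?thesis
      using block_subset[OF f[OF A(1)] A(2)] block_subset[OF f[OF A(3)] A(4)] unfolding disjnt_def by blast
  qed
next
  show "{} \<notin> (\<Union>A\<in>\<pi>. f A)" using partition_onD3[OF f] by blast
qed

text \<open>
  A crossing of two blocks that come from different blocks of \<open>\<pi>\<close> would be a crossing of those.
\<close>

lemma glue_noncrossing:
  assumes \<pi>: "\<pi> \<in> noncrossing_partitions S"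
    and f: "\<And>A. A \<in> \<pi> \<Longrightarrow> f A \<in> noncrossing_partitions A"
  shows "(\<Union>A\<in>\<pi>. f A) \<in> noncrossing_below S \<pi>"
proof -
  note p = noncrossing_partition_on[OF \<pi>] and fp = noncrossing_partition_on[OF f]
  have "(\<Union>A\<in>\<pi>. f A) \<in> noncrossing_partitions S"
  proof (rule noncrossingI[OF partition_on_glue[OF p fp]])
    fix B C a b c d
    assume BC: "B \<in> (\<Union>A\<in>\<pi>. f A)" "C \<in> (\<Union>A\<in>\<pi>. f A)"
      and less: "a < b" "b < c" "c < d" and mem: "a \<in> B" "c \<in> B" "b \<in> C" "d \<in> C"
    obtain A A' where A: "A \<in> \<pi>" "B \<in> f A" "A' \<in> \<pi>" "C \<in> f A'" using BC by blast
    have "B \<subseteq> A" "C \<subseteq> A'" using block_subset[OF fp[OF A(1)] A(2)] block_subset[OF fp[OF A(3)] A(4)] .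
    then have "A = A'"
      using mem by (intro noncrossingD[OF \<pi> A(1,3) less]) blast+
    then show "B = C" using noncrossingD[OF f[OF A(1)] A(2) _ less mem] A(4) by blast
  qed
  moreover have "\<exists>A\<in>\<pi>. B \<subseteq> A" if B: "B \<in> (\<Union>A\<in>\<pi>. f A)" for B
    using B block_subset[OF fp] by blast
  ultimately show ?thesis unfolding noncrossing_below_def by blast
qed

lemma blocks_inside_glue:
  assumes \<pi>: "partition_on S \<pi>" and f: "\<And>A. A \<in> \<pi> \<Longrightarrow> partition_on A (f A)" and A: "A \<in> \<pi>"
  shows "blocks_inside (\<Union>A\<in>\<pi>. f A) A = f A"
proof
  show "blocks_inside (\<Union>A\<in>\<pi>. f A) A \<subseteq> f A"
  proof
    fix B assume "B \<in> blocks_inside (\<Union>A\<in>\<pi>. f A) A"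
    then obtain A' where B: "B \<subseteq> A" "A' \<in> \<pi>" "B \<in> f A'" unfolding blocks_inside_def by blast
    obtain x where "x \<in> B" using block_nonempty[OF f[OF B(2)] B(3)] by blast
    then have "A' = A" using partition_on_blockD[OF \<pi> B(2) A] block_subset[OF f[OF B(2)] B(3)] B(1) by blast
    then show "B \<in> f A" using B(3) by simp
  qed
  show "f A \<subseteq> blocks_inside (\<Union>A\<in>\<pi>. f A) A"
    using block_subset[OF f[OF A]] A unfolding blocks_inside_def by blast
qed

lemma glue_blocks_inside:
  assumes \<rho>: "\<rho> \<in> noncrossing_below S \<pi>"
  shows "(\<Union>A\<in>\<pi>. blocks_inside \<rho> A) = \<rho>"
  using assms unfolding noncrossing_below_def blocks_inside_def by blast

text \<open>
  The lower interval of \<open>\<pi>\<close> is the product of the lattices of its blocks.  This turns the product over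
  the blocks that arises in the coproduct of \<open>Y\<^sub>w\<^sub>;\<^sub>\<pi>\<close> into a single sum.
\<close>

lemma bij_betw_noncrossing_below:
  assumes \<pi>: "\<pi> \<in> noncrossing_partitions S"
  shows "bij_betw (\<lambda>f. \<Union>A\<in>\<pi>. f A) (PiE \<pi> noncrossing_partitions) (noncrossing_below S \<pi>)"
proof (rule bij_betw_byWitness[where f' = "\<lambda>\<rho>. restrict (blocks_inside \<rho>) \<pi>"])
  note p = noncrossing_partition_on[OF \<pi>]
  have *: "blocks_inside (\<Union>A\<in>\<pi>. f A) A = f A"
    if f: "f \<in> PiE \<pi> noncrossing_partitions" and A: "A \<in> \<pi>" for f A
    by (rule blocks_inside_glue[OF p noncrossing_partition_on[OF PiE_mem[OF f]] A])
  show "\<forall>f\<in>PiE \<pi> noncrossing_partitions. restrict (blocks_inside (\<Union>A\<in>\<pi>. f A)) \<pi> = f"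
  proof (intro ballI ext)
    fix f A assume f: "f \<in> PiE \<pi> noncrossing_partitions"
    show "restrict (blocks_inside (\<Union>A\<in>\<pi>. f A)) \<pi> A = f A"
      using *[OF f, of A] PiE_arb[OF f, of A] by (cases "A \<in> \<pi>") simp_all
  qed
  show "\<forall>\<rho>\<in>noncrossing_below S \<pi>. (\<Union>A\<in>\<pi>. restrict (blocks_inside \<rho>) \<pi> A) = \<rho>"
    using glue_blocks_inside by simp
  show "(\<lambda>f. \<Union>A\<in>\<pi>. f A) ` PiE \<pi> noncrossing_partitions \<subseteq> noncrossing_below S \<pi>"
  proof (rule image_subsetI)
    fix f assume "f \<in> PiE \<pi> noncrossing_partitions"
    from PiE_mem[OF this] show "(\<Union>A\<in>\<pi>. f A) \<in> noncrossing_below S \<pi>"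
      by (rule glue_noncrossing[OF \<pi>])
  qed
  show "(\<lambda>\<rho>. restrict (blocks_inside \<rho>) \<pi>) ` noncrossing_below S \<pi> \<subseteq> PiE \<pi> noncrossing_partitions"
    unfolding image_subset_iff restrict_PiE_iff using blocks_inside_noncrossing[OF p] by blast
qed

lemma relative_kreweras_noncrossing:
  assumes "\<pi> \<in> noncrossing_partitions S"
  shows "relative_kreweras \<pi> \<rho> \<in> noncrossing_below S \<pi>"
  unfolding relative_kreweras_def by (rule glue_noncrossing[OF assms kreweras_on_noncrossing])

lemma part_perm_blocks_inside:
  assumes \<pi>: "partition_on S \<pi>" and \<rho>: "\<rho> \<in> noncrossing_below S \<pi>" and A: "A \<in> \<pi>" "x \<in> A"
  shows "part_perm (blocks_inside \<rho> A) x = part_perm \<rho> x"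
proof -
  note \<rho>' = noncrossing_belowD[OF \<rho>]
  have pA: "partition_on A (blocks_inside \<rho> A)"
    by (rule noncrossing_partition_on[OF blocks_inside_noncrossing[OF \<pi> \<rho> A(1)]])
  obtain B where B: "B \<in> blocks_inside \<rho> A" "x \<in> B" using partition_on_blockE[OF pA A(2)] by blast
  then have "B \<in> \<rho>" by (simp add: blocks_inside_def)
  then show ?thesis
    using part_perm_eq_cyclic_succ[OF pA B] part_perm_eq_cyclic_succ[OF \<rho>'(2) _ B(2)] by simp
qed

lemma part_perm_relative_kreweras:
  assumes S: "finite S" and \<pi>: "\<pi> \<in> noncrossing_partitions S"
    and \<rho>: "\<rho> \<in> noncrossing_below S \<pi>" and x: "x \<in> S"
  shows "part_perm \<rho> (part_perm (relative_kreweras \<pi> \<rho>) x) = part_perm \<pi> x"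
proof -
  note p = noncrossing_partition_on[OF \<pi>]
  note q = relative_kreweras_noncrossing[OF \<pi>, of \<rho>]
  obtain A where A: "A \<in> \<pi>" "x \<in> A" using partition_on_blockE[OF p x] by blast
  note fA = finite_block[OF S p A(1)]
  have "blocks_inside (relative_kreweras \<pi> \<rho>) A = kreweras_on A (blocks_inside \<rho> A)"
    unfolding relative_kreweras_def
    by (rule blocks_inside_glue[OF p partition_on_kreweras_on A(1)])
  then have "part_perm (relative_kreweras \<pi> \<rho>) x = part_perm (kreweras_on A (blocks_inside \<rho> A)) x"
    using part_perm_blocks_inside[OF p q A] by simp
  moreover have "part_perm (kreweras_on A (blocks_inside \<rho> A)) x \<in> A"
    by (rule part_perm_in[OF fA partition_on_kreweras_on A(2)])
  ultimately have "part_perm \<rho> (part_perm (relative_kreweras \<pi> \<rho>) x)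
      = part_perm (blocks_inside \<rho> A) (part_perm (kreweras_on A (blocks_inside \<rho> A)) x)"
    using part_perm_blocks_inside[OF p \<rho> A(1)] by simp
  also have "\<dots> = cyclic_succ A x"
    by (rule part_perm_kreweras[OF fA blocks_inside_noncrossing[OF p \<rho> A(1)] A(2)])
  also have "\<dots> = part_perm \<pi> x" by (rule part_perm_eq_cyclic_succ[OF p A, symmetric])
  finally show ?thesis .
qed

text \<open>
  If the points of a block \<open>A\<close> of \<open>\<pi>\<close> in \<open>{x<..y}\<close>, with \<open>x, y \<in> A\<close>, form a union of blocks of \<open>\<rho>\<close>,
  then so do all points of \<open>S\<close> in \<open>{x<..y}\<close>: the additional ones lie in blocks of \<open>\<pi>\<close> that cannot
  cross \<open>A\<close> and are therefore enclosed between \<open>x\<close> and \<open>y\<close>.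
\<close>

lemma relative_kreweras_below:
  assumes \<pi>: "\<pi> \<in> noncrossing_partitions S" and \<rho>: "\<rho> \<in> noncrossing_below S \<pi>"
  shows "relative_kreweras \<pi> \<rho> \<in> noncrossing_below S (kreweras_on S \<rho>)"
proof -
  note p = noncrossing_partition_on[OF \<pi>] and \<rho>' = noncrossing_belowD[OF \<rho>]
  have step: "(x, y) \<in> kreweras_rel S \<rho>"
    if A: "A \<in> \<pi>" and xy: "x \<le> y" "(x, y) \<in> kreweras_rel A (blocks_inside \<rho> A)" for A x y
  proof (rule kreweras_relI(1))
    have "x \<in> A" "y \<in> A"
      using xy(2) by (simp_all only: kreweras_rel_def mem_Collect_eq prod.case)
    then show "x \<in> S" "y \<in> S" using block_subset[OF p A] by blast+
    fix B z w assume h: "B \<in> \<rho>" "z \<in> B" "w \<in> B" "x < z" "z \<le> y"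
    show "x < w \<and> w \<le> y"
    proof (cases "z \<in> A")
      case True
      then have "B \<in> blocks_inside \<rho> A"
        using noncrossing_below_block[OF p \<rho> A h(1) True h(2)] h(1) by (simp add: blocks_inside_def)
      then show ?thesis using kreweras_relD[OF xy(2,1) _ h(2-5)] by blast
    next
      case False
      obtain A' where A': "A' \<in> \<pi>" "B \<subseteq> A'" using \<rho> h(1) unfolding noncrossing_below_def by blast
      then have zw: "z \<in> A'" "w \<in> A'" using h by blast+
      then have "w \<notin> A" using partition_on_blockD[OF p A A'(1)] False by blast
      then have ne: "w \<noteq> x" "w \<noteq> y" "z \<noteq> y" using \<open>x \<in> A\<close> \<open>y \<in> A\<close> False by blast+
      have "A \<noteq> A'" using False zw by blast
      have "\<not> w < x" 
        using noncrossingD[OF \<pi> A'(1) A _ h(4) _ zw(2) zw(1) \<open>x \<in> A\<close> \<open>y \<in> A\<close>] \<open>A \<noteq> A'\<close> h(5) ne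
        by (metis order_less_le)
      moreover have "\<not> y < w"
        using noncrossingD[OF \<pi> A A'(1) h(4) _ _ \<open>x \<in> A\<close> \<open>y \<in> A\<close> zw] \<open>A \<noteq> A'\<close> h(5) ne
        by (metis order_less_le)
      ultimately show ?thesis using ne by linarith
    qed
  qed (rule xy(1))
  have "\<exists>D\<in>kreweras_on S \<rho>. C \<subseteq> D" if C: "C \<in> relative_kreweras \<pi> \<rho>" for C
  proof -
    obtain A where A: "A \<in> \<pi>" "C \<in> kreweras_on A (blocks_inside \<rho> A)"
      using C unfolding relative_kreweras_def by blast
    obtain x where x: "x \<in> C" using block_nonempty[OF partition_on_kreweras_on A(2)] by blast
    have "x \<in> S" using x block_subset[OF partition_on_kreweras_on A(2)] block_subset[OF p A(1)] by blast
    then obtain D where D: "D \<in> kreweras_on S \<rho>" "x \<in> D"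
      using partition_on_blockE[OF partition_on_kreweras_on] by blast
    have "y \<in> D" if y: "y \<in> C" for y
    proof -
      have xy: "(x, y) \<in> kreweras_rel A (blocks_inside \<rho> A)" "(y, x) \<in> kreweras_rel A (blocks_inside \<rho> A)"
        using kreweras_on_sameblock_iff[OF A(2) x] kreweras_on_sameblock_iff[OF A(2) y] x y by blast+
      have "(x, y) \<in> kreweras_rel S \<rho>"
      proof (cases "x \<le> y")
        case True
        then show ?thesis by (rule step[OF A(1) _ xy(1)])
      next
        case False
        then have "(y, x) \<in> kreweras_rel S \<rho>" by (intro step[OF A(1) _ xy(2)]) simp
        then show ?thesis using equiv_kreweras_rel by (meson equivE symE)
      qed
      then show ?thesis using kreweras_on_sameblock_iff[OF D] by blast
    qed
    then show ?thesis using D by blast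
  qed
  then show ?thesis
    using relative_kreweras_noncrossing[OF \<pi>, of \<rho>] unfolding noncrossing_below_def by blast
qed

text \<open>
  The complement determines \<open>P\<^sub>\<pi>\<close>, hence \<open>\<pi>\<close>; finiteness does the rest.
\<close>

lemma bij_betw_kreweras_on:
  assumes S: "finite S"
  shows "bij_betw (kreweras_on S) (noncrossing_partitions S) (noncrossing_partitions S)"
proof -
  have inj: "inj_on (kreweras_on S) (noncrossing_partitions S)"
  proof (rule inj_onI)
    fix \<pi> \<pi>' assume \<pi>: "\<pi> \<in> noncrossing_partitions S" "\<pi>' \<in> noncrossing_partitions S"
      and eq: "kreweras_on S \<pi> = kreweras_on S \<pi>'"
    note p = noncrossing_partition_on[OF \<pi>(1)] noncrossing_partition_on[OF \<pi>(2)]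
    show "\<pi> = \<pi>'"
    proof (rule part_perm_determines_partition[OF S p])
      fix y assume "y \<in> S"
      then obtain x where x: "x \<in> S" "y = part_perm (kreweras_on S \<pi>) x"
        using part_perm_surj_on[OF S partition_on_kreweras_on[of S \<pi>]] by blast
      then show "part_perm \<pi> y = part_perm \<pi>' y"
        using part_perm_kreweras[OF S \<pi>(1) x(1)] part_perm_kreweras[OF S \<pi>(2) x(1)] eq by simp
    qed
  qed
  then have "kreweras_on S ` noncrossing_partitions S = noncrossing_partitions S"
    using kreweras_on_noncrossing by (intro endo_inj_surj finite_noncrossing_partitions S) blast+
  with inj show ?thesis by (simp add: bij_betw_def)
qed

text \<open>
  The two ways of splitting \<open>P\<^sub>1\<close> into three factors.  Injectivity holds since \<open>P\<^sub>\<pi> = P\<^sub>\<rho> P\<^sub>\<sigma>\<close>, and the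
  two index sets have the same size: summing the sizes of the lower intervals of \<open>K(\<rho>)\<close> over all
  \<open>\<rho>\<close> is the same as summing those of \<open>\<pi>\<close> over all \<open>\<pi>\<close>, because \<open>K\<close> is a bijection.
\<close>

lemma bij_betw_factorizations:
  assumes S: "finite S"
  shows "bij_betw (\<lambda>(\<pi>, \<rho>). (\<rho>, relative_kreweras \<pi> \<rho>))
    (SIGMA \<pi>:noncrossing_partitions S. noncrossing_below S \<pi>)
    (SIGMA \<rho>:noncrossing_partitions S. noncrossing_below S (kreweras_on S \<rho>))"
    (is "bij_betw ?\<Phi> ?X ?Z")
proof -
  have inj: "inj_on ?\<Phi> ?X"
  proof (rule inj_onI, clarify)
    fix \<pi> \<rho> \<pi>' \<rho>'
    assume \<pi>: "\<pi> \<in> noncrossing_partitions S" "\<pi>' \<in> noncrossing_partitions S"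
      and \<rho>: "\<rho> \<in> noncrossing_below S \<pi>" "\<rho> \<in> noncrossing_below S \<pi>'"
      and eq: "relative_kreweras \<pi> \<rho> = relative_kreweras \<pi>' \<rho>"
    have "\<pi> = \<pi>'"
      using part_perm_relative_kreweras[OF S \<pi>(1) \<rho>(1)] part_perm_relative_kreweras[OF S \<pi>(2) \<rho>(2)] eq
      by (intro part_perm_determines_partition[OF S] noncrossing_partition_on \<pi>) simp
    then show "\<pi> = \<pi>' \<and> \<rho> = \<rho>" by simp
  qed
  have sub: "?\<Phi> ` ?X \<subseteq> ?Z"
    using relative_kreweras_below noncrossing_belowD(1) by fastforce
  have fin: "finite ?Z"
    using S by (intro finite_SigmaI finite_noncrossing_partitions finite_noncrossing_below)
  have "card ?Z = (\<Sum>\<rho>\<in>noncrossing_partitions S. card (noncrossing_below S (kreweras_on S \<rho>)))"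
    using S by (intro card_SigmaI finite_noncrossing_partitions ballI finite_noncrossing_below)
  also have "\<dots> = (\<Sum>\<pi>\<in>noncrossing_partitions S. card (noncrossing_below S \<pi>))"
    by (rule sum.reindex_bij_betw[OF bij_betw_kreweras_on[OF S]])
  also have "\<dots> = card ?X"
    using S by (intro card_SigmaI[symmetric] finite_noncrossing_partitions ballI finite_noncrossing_below)
  also have "\<dots> = card (?\<Phi> ` ?X)" using card_image[OF inj] by simp
  finally have "?\<Phi> ` ?X = ?Z" using card_subset_eq[OF fin sub] by simp
  with inj show ?thesis by (simp add: bij_betw_def)
qed

text \<open>
  The third factor agrees for both splittings: \<open>P\<^sub>\<sigma>\<^sup>-\<^sup>1 (P\<^sub>\<rho>\<^sup>-\<^sup>1 P\<^sub>1) = (P\<^sub>\<rho> P\<^sub>\<sigma>)\<^sup>-\<^sup>1 P\<^sub>1 = P\<^sub>\<pi>\<^sup>-\<^sup>1 P\<^sub>1\<close>.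
\<close>

lemma relative_kreweras_kreweras_on:
  assumes S: "finite S" and \<pi>: "\<pi> \<in> noncrossing_partitions S" and \<rho>: "\<rho> \<in> noncrossing_below S \<pi>"
  shows "relative_kreweras (kreweras_on S \<rho>) (relative_kreweras \<pi> \<rho>) = kreweras_on S \<pi>"
proof (rule kreweras_on_unique[OF S \<pi>])
  note K = kreweras_on_noncrossing[of S \<rho>]
  note \<rho>' = noncrossing_belowD[OF \<rho>]
  note \<sigma> = relative_kreweras_below[OF \<pi> \<rho>]
  let ?\<tau> = "relative_kreweras (kreweras_on S \<rho>) (relative_kreweras \<pi> \<rho>)"
  show \<tau>: "partition_on S ?\<tau>"
    by (rule noncrossing_belowD(2)[OF relative_kreweras_noncrossing[OF K]])
  fix x assume x: "x \<in> S"
  have "part_perm \<pi> (part_perm ?\<tau> x) = part_perm \<rho> (part_perm (relative_kreweras \<pi> \<rho>) (part_perm ?\<tau> x))"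
    by (rule part_perm_relative_kreweras[OF S \<pi> \<rho> part_perm_in[OF S \<tau> x], symmetric])
  also have "\<dots> = part_perm \<rho> (part_perm (kreweras_on S \<rho>) x)"
    by (simp only: part_perm_relative_kreweras[OF S K \<sigma> x])
  also have "\<dots> = cyclic_succ S x" by (rule part_perm_kreweras[OF S \<rho>'(1) x])
  finally show "part_perm \<pi> (part_perm ?\<tau> x) = cyclic_succ S x" .
qed

lemma one_block_noncrossing: "S \<noteq> {} \<Longrightarrow> {S} \<in> noncrossing_partitions S"
  by (intro noncrossingI partition_on_space) auto

lemma singletons_noncrossing: "(\<lambda>x. {x}) ` S \<in> noncrossing_partitions S"
  by (intro noncrossingI partition_on_singletons) auto

lemma part_perm_singletons: "x \<in> S \<Longrightarrow> part_perm ((\<lambda>x. {x}) ` S) x = x"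
  by (subst part_perm_eq_cyclic_succ[OF partition_on_singletons, of "{x}"]) (auto simp: cyclic_succ_def)

lemma kreweras_on_singletons:
  assumes S: "finite S" "S \<noteq> {}"
  shows "kreweras_on S ((\<lambda>x. {x}) ` S) = {S}"
  using S part_perm_one_block[OF S(2)] cyclic_succ_in[OF S(1)] part_perm_singletons
  by (intro kreweras_on_unique[symmetric] singletons_noncrossing partition_on_space) auto

lemma kreweras_on_eq_singletons_iff:
  assumes S: "finite S" "S \<noteq> {}" and \<pi>: "\<pi> \<in> noncrossing_partitions S"
  shows "kreweras_on S \<pi> = (\<lambda>x. {x}) ` S \<longleftrightarrow> \<pi> = {S}"
proof -
  have "kreweras_on S {S} = (\<lambda>x. {x}) ` S"
    using S part_perm_one_block[OF S(2)] part_perm_singletons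
    by (intro kreweras_on_unique[symmetric] one_block_noncrossing partition_on_singletons) auto
  then show ?thesis
    using inj_onD[OF bij_betw_imp_inj_on[OF bij_betw_kreweras_on[OF S(1)]] _ \<pi> one_block_noncrossing[OF S(2)]]
    by auto
qed

text \<open>
  The coproduct of \<open>Y\<^sub>w\<^sub>|\<^sub>A\<close> is a sum over partitions of \<open>{1..card A}\<close>.  The lemmas from here to the end
  of the section transport non-crossing partitions and their complements along the increasing
  enumeration of \<open>A\<close>.
\<close>

lemma partition_on_relabel:
  assumes "inj_on e S" "partition_on S \<pi>"
  shows "partition_on (e ` S) ((`) e ` \<pi>)"
proof -
  have "(`) e ` \<pi> - {{}} = (`) e ` \<pi>" using partition_onD3[OF assms(2)] by auto
  then show ?thesis using partition_on_inj_image[OF assms(2,1)] by simp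
qed

lemma relabel_noncrossing:
  assumes e: "strict_mono_on S e" and \<pi>: "\<pi> \<in> noncrossing_partitions S"
  shows "(`) e ` \<pi> \<in> noncrossing_partitions (e ` S)"
proof (rule noncrossingI)
  note p = noncrossing_partition_on[OF \<pi>]
  show "partition_on (e ` S) ((`) e ` \<pi>)"
    by (rule partition_on_relabel[OF strict_mono_on_imp_inj_on[OF e] p])
  fix B C a b c d
  assume BC: "B \<in> (`) e ` \<pi>" "C \<in> (`) e ` \<pi>" and less: "a < b" "b < c" "c < d"
    and mem: "a \<in> B" "c \<in> B" "b \<in> C" "d \<in> C"
  obtain B' C' where B': "B' \<in> \<pi>" "B = e ` B'" and C': "C' \<in> \<pi>" "C = e ` C'" using BC by blast
  obtain a' b' c' d' where h: "a' \<in> B'" "a = e a'" "c' \<in> B'" "c = e c'" "b' \<in> C'" "b = e b'" "d' \<in> C'" "d = e d'"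
    using mem B' C' by blast
  then have "a' \<in> S" "b' \<in> S" "c' \<in> S" "d' \<in> S" 
    using block_subset[OF p B'(1)] block_subset[OF p C'(1)] by blast+
  then have "a' < b'" "b' < c'" "c' < d'" using less h strict_mono_on_less[OF e] by simp_all
  then show "B = C" using noncrossingD[OF \<pi> B'(1) C'(1) _ _ _ h(1,3,5,7)] B' C' by simp
qed

lemma part_perm_relabel:
  assumes S: "finite S" and e: "strict_mono_on S e" and p: "partition_on S \<pi>" and x: "x \<in> S"
  shows "part_perm ((`) e ` \<pi>) (e x) = e (part_perm \<pi> x)"
proof -
  obtain A where A: "A \<in> \<pi>" "x \<in> A" using partition_on_blockE[OF p x] by blast
  note AS = block_subset[OF p A(1)] and fA = finite_block[OF S p A(1)]
  define y where "y = cyclic_succ A x"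
  have y: "y \<in> A" unfolding y_def by (rule cyclic_succ_in[OF fA A(2)])
  have "cyclic_succ (e ` A) (e x) = e y"
  proof (subst cyclic_succ_iff)
    have "(x < y \<and> (\<forall>z\<in>A. \<not> (x < z \<and> z < y))) \<or> (\<forall>z\<in>A. y \<le> z \<and> z \<le> x)"
      using cyclic_succ_iff[OF fA A(2) y] y_def by simp
    moreover have "e u < e v \<longleftrightarrow> u < v" "e u \<le> e v \<longleftrightarrow> u \<le> v" if "u \<in> A" "v \<in> A" for u v
      using strict_mono_on_less[OF e] strict_mono_on_less_eq[OF e] that AS by blast+
    ultimately show "(e x < e y \<and> (\<forall>z\<in>e ` A. \<not> (e x < z \<and> z < e y))) \<or> (\<forall>z\<in>e ` A. e y \<le> z \<and> z \<le> e x)"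
      using A(2) y by simp
  qed (use fA A y in auto)
  moreover have "part_perm ((`) e ` \<pi>) (e x) = cyclic_succ (e ` A) (e x)"
    using A by (intro part_perm_eq_cyclic_succ[OF partition_on_relabel[OF strict_mono_on_imp_inj_on[OF e] p]]) auto
  ultimately show ?thesis using part_perm_eq_cyclic_succ[OF p A] y_def by simp
qed

lemma kreweras_on_relabel:
  assumes S: "finite S" and e: "strict_mono_on S e" and \<pi>: "\<pi> \<in> noncrossing_partitions S"
  shows "kreweras_on (e ` S) ((`) e ` \<pi>) = (`) e ` kreweras_on S \<pi>"
proof (rule kreweras_on_unique[symmetric])
  note inj = strict_mono_on_imp_inj_on[OF e] and p = noncrossing_partition_on[OF \<pi>]
  show "partition_on (e ` S) ((`) e ` kreweras_on S \<pi>)"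
    by (rule partition_on_relabel[OF inj partition_on_kreweras_on])
  fix u assume "u \<in> e ` S"
  then obtain x where x: "x \<in> S" "u = e x" by blast
  have *: "part_perm (kreweras_on S \<pi>) x \<in> S"
    by (rule part_perm_in[OF S partition_on_kreweras_on x(1)])
  have S': "S \<noteq> {}" using x by blast
  have "part_perm ((`) e ` \<pi>) (part_perm ((`) e ` kreweras_on S \<pi>) u) = e (cyclic_succ S x)"
    unfolding x(2) part_perm_relabel[OF S e partition_on_kreweras_on x(1)] part_perm_relabel[OF S e p *]
      part_perm_kreweras[OF S \<pi> x(1)] ..
  also have "\<dots> = part_perm ((`) e ` {S}) u"
    unfolding x(2) part_perm_relabel[OF S e partition_on_space[OF S'] x(1)] part_perm_one_block[OF S' x(1)] ..
  also have "\<dots> = cyclic_succ (e ` S) u"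
    using part_perm_one_block[of "e ` S" u] x S' by auto
  finally show "part_perm ((`) e ` \<pi>) (part_perm ((`) e ` kreweras_on S \<pi>) u) = cyclic_succ (e ` S) u" .
qed (use S relabel_noncrossing[OF e \<pi>] in auto)

lemma bij_betw_relabel_noncrossing:
  assumes e: "strict_mono_on S e"
  shows "bij_betw (\<lambda>\<pi>. (`) e ` \<pi>) (noncrossing_partitions S) (noncrossing_partitions (e ` S))"
proof -
  define g where "g = inv_into S e"
  note inj = strict_mono_on_imp_inj_on[OF e]
  have ge: "g (e x) = x" if "x \<in> S" for x unfolding g_def using inv_into_f_f[OF inj that] .
  have g: "strict_mono_on (e ` S) g"
    using strict_mono_on_less[OF e] by (auto intro!: strict_mono_onI simp: ge)
  have gS: "g ` e ` S = S" using ge by force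
  have cancel: "(`) g ` (`) e ` \<pi> = \<pi>" if p: "partition_on S \<pi>" for \<pi>
  proof -
    have "g ` e ` A = A" if A: "A \<in> \<pi>" for A using ge block_subset[OF p A] by force
    then show ?thesis by (simp add: image_image)
  qed
  have cancel': "(`) e ` (`) g ` \<pi> = \<pi>" if p: "partition_on (e ` S) \<pi>" for \<pi>
  proof -
    have "e ` g ` A = A" if A: "A \<in> \<pi>" for A
      using ge block_subset[OF p A] by (force simp: image_iff subset_iff)
    then show ?thesis by (simp add: image_image)
  qed
  show ?thesis
  proof (rule bij_betw_byWitness[where f' = "\<lambda>\<pi>. (`) g ` \<pi>"])
    show "\<forall>\<pi>\<in>noncrossing_partitions S. (`) g ` (`) e ` \<pi> = \<pi>"
      using cancel noncrossing_partition_on by blast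
    show "\<forall>\<pi>\<in>noncrossing_partitions (e ` S). (`) e ` (`) g ` \<pi> = \<pi>"
      using cancel' noncrossing_partition_on by blast
    show "(\<lambda>\<pi>. (`) e ` \<pi>) ` noncrossing_partitions S \<subseteq> noncrossing_partitions (e ` S)"
      using relabel_noncrossing[OF e] by blast
    show "(\<lambda>\<pi>. (`) g ` \<pi>) ` noncrossing_partitions (e ` S) \<subseteq> noncrossing_partitions S"
      using relabel_noncrossing[OF g] unfolding gS by blast
  qed
qed

section \<open>Linear maps on tensor products\<close>

lemma clinear_compose: "clinear f \<Longrightarrow> clinear g \<Longrightarrow> clinear (\<lambda>x. f (g x))"
  by (rule clinearI) (simp_all add: clinear_add clinear_scale)

lemma clinear_id: "clinear id"
  by (rule clinearI) simp_all

lemma cbilinear_add: "cbilinear \<beta> \<Longrightarrow> \<beta> (a + a') b = \<beta> a b + \<beta> a' b"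
    "cbilinear \<beta> \<Longrightarrow> \<beta> a (b + b') = \<beta> a b + \<beta> a b'"
  and cbilinear_scale: "cbilinear \<beta> \<Longrightarrow> \<beta> (c *\<^sub>C a) b = c *\<^sub>C \<beta> a b"
    "cbilinear \<beta> \<Longrightarrow> \<beta> a (c *\<^sub>C b) = c *\<^sub>C \<beta> a b"
  by (simp_all add: cbilinear_def clinear_add[of "\<lambda>a. \<beta> a b"] clinear_add[of "\<lambda>b. \<beta> a b"]
      clinear_scale[of "\<lambda>a. \<beta> a b"] clinear_scale[of "\<lambda>b. \<beta> a b"])

lemma cbilinear_compose:
  "cbilinear \<beta> \<Longrightarrow> clinear f \<Longrightarrow> clinear g \<Longrightarrow> cbilinear (\<lambda>a b. \<beta> (f a) (g b))"
  by (rule cbilinearI) (simp_all add: cbilinear_add cbilinear_scale clinear_add clinear_scale)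

lemma cbilinear_times: "cbilinear ((*) :: 'a::complex_algebra_1 \<Rightarrow> 'a \<Rightarrow> 'a)"
  by (rule cbilinearI) (simp_all add: distrib_left distrib_right mult_scaleC_left mult_scaleC_right)

lemmas cbilinear_mult = cbilinear_compose[OF cbilinear_times]

lemma tensor_lift_clinear_compose:
  assumes "clinear f" "cbilinear \<beta>"
  shows "f (tensor_lift \<beta> t) = tensor_lift (\<lambda>a b. f (\<beta> a b)) t"
proof -
  have "(\<lambda>t. f (tensor_lift \<beta> t)) = tensor_lift (\<lambda>a b. f (\<beta> a b))"
  proof (rule tensor_lift_unique)
    show "clinear (\<lambda>t. f (tensor_lift \<beta> t))"
      by (rule clinear_compose[OF assms(1) clinear_tensor_lift[OF assms(2)]])
    show "cbilinear (\<lambda>a b. f (\<beta> a b))"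
      using assms by (intro cbilinearI) (simp_all add: cbilinear_add cbilinear_scale clinear_add clinear_scale)
  qed (simp add: tensor_lift_tens[OF assms(2)])
  then show ?thesis by (rule fun_cong)
qed

lemma clinear_tensor_map:
  assumes "clinear f" "clinear g"
  shows "clinear (tensor_map f g)"
  unfolding tensor_map_def by (rule clinear_tensor_lift[OF cbilinear_compose[OF cbilinear_tens assms]])

lemma clinear_tensor_assoc:
  "clinear (tensor_assoc :: ('a::complex_vector \<otimes>\<^sub>t 'b::complex_vector) \<otimes>\<^sub>t 'c::complex_vector \<Rightarrow> _)"
proof -
  have *: "cbilinear (\<lambda>(a::'a) (b::'b). a \<otimes> (b \<otimes> (c::'c)))" for c
    by (rule cbilinearI) (simp_all add: tens_add_left tens_add_right tens_scale_left tens_scale_right)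
  show ?thesis
    unfolding tensor_assoc_def
  proof (rule clinear_tensor_lift, rule cbilinearI)
    fix s :: "'a \<otimes>\<^sub>t 'b" and c c' :: 'c and d :: complex
    show "tensor_lift (\<lambda>a b. a \<otimes> b \<otimes> (c + c')) s =
        tensor_lift (\<lambda>a b. a \<otimes> b \<otimes> c) s + tensor_lift (\<lambda>a b. a \<otimes> b \<otimes> c') s"
      by (simp add: tens_add_right tensor_lift_add_fun)
    show "tensor_lift (\<lambda>a b. a \<otimes> b \<otimes> (d *\<^sub>C c)) s = d *\<^sub>C tensor_lift (\<lambda>a b. a \<otimes> b \<otimes> c) s"
      by (simp add: tens_scale_right tensor_lift_scale_fun)
  qed (simp_all add: clinear_add[OF clinear_tensor_lift[OF *]] clinear_scale[OF clinear_tensor_lift[OF *]])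
qed


section \<open>The antipode of a graded connected bialgebra\<close>

lemma convolution_add_left:
    "convolution \<Delta> (\<lambda>x. f x + f' x) g x = convolution \<Delta> f g x + convolution \<Delta> f' g x"
  and convolution_add_right:
    "convolution \<Delta> g (\<lambda>x. f x + f' x) x = convolution \<Delta> g f x + convolution \<Delta> g f' x"
  and convolution_scale_left:
    "convolution \<Delta> (\<lambda>x. c *\<^sub>C f x) g x = c *\<^sub>C convolution \<Delta> f g x"
  and convolution_scale_right:
    "convolution \<Delta> g (\<lambda>x. c *\<^sub>C f x) x = c *\<^sub>C convolution \<Delta> g f x"
  by (simp_all add: convolution_def distrib_left distrib_right mult_scaleC_left mult_scaleC_right
      tensor_lift_add_fun tensor_lift_scale_fun)

lemma cbilinear_counit:
  assumes "clinear (\<epsilon> :: 'a::complex_vector \<Rightarrow> complex)"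
  shows "cbilinear (\<lambda>a b. \<epsilon> a *\<^sub>C b)" "cbilinear (\<lambda>a b. \<epsilon> b *\<^sub>C a)"
  by (rule cbilinearI; simp add: clinear_add[OF assms] clinear_scale[OF assms] scaleC_add_left
      scaleC_add_right scaleC_scaleC scaleC_complex_def mult.commute)+

context bialgebra
begin

lemma clinear_\<Delta>: "clinear \<Delta>" and clinear_\<epsilon>: "clinear \<epsilon>"
  using hom_\<Delta> hom_\<epsilon> by (simp_all add: calgebra_hom_def)

lemma counit_1: "\<epsilon> 1 = 1"
  using hom_\<epsilon> by (simp add: calgebra_hom_def)

lemma clinear_convolution:
  assumes "clinear f" "clinear g"
  shows "clinear (convolution \<Delta> f g)"
  unfolding convolution_def
  by (rule clinear_compose[OF clinear_tensor_lift[OF cbilinear_mult[OF assms]] clinear_\<Delta>])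

text \<open>
  Both sides come from the trilinear map \<open>f a * (g b * h c)\<close> on the iterated coproduct of \<open>x\<close>, so
  coassociativity identifies them.
\<close>

lemma convolution_assoc:
  assumes f: "clinear f" and g: "clinear g" and h: "clinear h"
  shows "convolution \<Delta> (convolution \<Delta> f g) h = convolution \<Delta> f (convolution \<Delta> g h)"
proof
  fix x
  note fg = cbilinear_mult[OF f g] and gh = cbilinear_mult[OF g h]
  define F where "F = tensor_lift (\<lambda>a t. f a * tensor_lift (\<lambda>b c. g b * h c) t)"
  have bF: "cbilinear (\<lambda>a t. f a * tensor_lift (\<lambda>b c. g b * h c) t)"
    by (rule cbilinear_mult[OF f clinear_tensor_lift[OF gh]])
  have lF: "clinear F" unfolding F_def by (rule clinear_tensor_lift[OF bF])
  have F: "F (a \<otimes> t) = f a * tensor_lift (\<lambda>b c. g b * h c) t" for a t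
    unfolding F_def by (rule tensor_lift_tens[OF bF])
  have "tensor_lift (\<lambda>a b. convolution \<Delta> f g a * h b) s = F (tensor_assoc (tensor_map \<Delta> id s))" for s
  proof (induction s rule: tensor_induct)
    case (tens a b)
    have "tensor_lift (\<lambda>a b. f a * g b) t * h b = F (tensor_assoc (t \<otimes> b))" for t
    proof (induction t rule: tensor_induct)
      case (tens c d)
      show ?case
        by (simp add: tensor_lift_tens[OF fg] tensor_assoc_tens F tensor_lift_tens[OF gh] mult.assoc)
    next
      case (add s t)
      then show ?case
        by (simp add: clinear_add[OF clinear_tensor_lift[OF fg]] tens_add_left distrib_right
            clinear_add[OF clinear_tensor_assoc] clinear_add[OF lF])
    qed
    then show ?case
      unfolding tensor_lift_tens[OF cbilinear_mult[OF clinear_convolution[OF f g] h]]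
        tensor_map_tens[OF clinear_\<Delta> clinear_id]
      by (simp add: convolution_def)
  next
    case (add s t)
    then show ?case
      by (simp only: clinear_add[OF clinear_tensor_lift[OF cbilinear_mult[OF clinear_convolution[OF f g] h]]]
          clinear_add[OF clinear_tensor_map[OF clinear_\<Delta> clinear_id]]
          clinear_add[OF clinear_tensor_assoc] clinear_add[OF lF])
  qed
  moreover have "tensor_lift (\<lambda>a b. f a * convolution \<Delta> g h b) s = F (tensor_map id \<Delta> s)" for s
  proof (induction s rule: tensor_induct)
    case (tens a b)
    show ?case
      unfolding tensor_lift_tens[OF cbilinear_mult[OF f clinear_convolution[OF g h]]] F
        tensor_map_tens[OF clinear_id clinear_\<Delta>]
      by (simp add: convolution_def)
  next
    case (add s t)
    then show ?case
      by (simp only: clinear_add[OF clinear_tensor_lift[OF cbilinear_mult[OF f clinear_convolution[OF g h]]]]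
          clinear_add[OF clinear_tensor_map[OF clinear_id clinear_\<Delta>]] clinear_add[OF lF])
  qed
  ultimately show "convolution \<Delta> (convolution \<Delta> f g) h x = convolution \<Delta> f (convolution \<Delta> g h) x"
    unfolding convolution_def[of \<Delta> "convolution \<Delta> f g" h] convolution_def[of \<Delta> f "convolution \<Delta> g h"]
    by (simp add: coassoc)
qed

abbreviation convolution_unit :: "'a \<Rightarrow> 'a" where
  "convolution_unit \<equiv> \<lambda>x. \<epsilon> x *\<^sub>C 1"

lemma clinear_convolution_unit: "clinear convolution_unit"
  by (rule clinearI)
    (simp_all add: clinear_add[OF clinear_\<epsilon>] clinear_scale[OF clinear_\<epsilon>] scaleC_add_left
      scaleC_scaleC scaleC_complex_def)

lemma convolution_unit_left:
  assumes "clinear f"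
  shows "convolution \<Delta> convolution_unit f = f"
proof
  fix x
  note b = cbilinear_counit(1)[OF clinear_\<epsilon>]
  have "f x = f (tensor_lift (\<lambda>a b. \<epsilon> a *\<^sub>C b) (\<Delta> x))" by (simp add: counit_left)
  also have "\<dots> = tensor_lift (\<lambda>a b. f (\<epsilon> a *\<^sub>C b)) (\<Delta> x)"
    by (rule tensor_lift_clinear_compose[OF assms b])
  also have "\<dots> = convolution \<Delta> convolution_unit f x"
    by (simp add: convolution_def mult_scaleC_left clinear_scale[OF assms])
  finally show "convolution \<Delta> convolution_unit f x = f x" ..
qed

lemma convolution_unit_right:
  assumes "clinear f"
  shows "convolution \<Delta> f convolution_unit = f"
proof
  fix x
  note b = cbilinear_counit(2)[OF clinear_\<epsilon>]
  have "f x = f (tensor_lift (\<lambda>a b. \<epsilon> b *\<^sub>C a) (\<Delta> x))" by (simp add: counit_right)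
  also have "\<dots> = tensor_lift (\<lambda>a b. f (\<epsilon> b *\<^sub>C a)) (\<Delta> x)"
    by (rule tensor_lift_clinear_compose[OF assms b])
  also have "\<dots> = convolution \<Delta> f convolution_unit x"
    by (simp add: convolution_def mult_scaleC_right clinear_scale[OF assms])
  finally show "convolution \<Delta> f convolution_unit x = f x" ..
qed

text \<open>
  The projection onto the augmentation ideal, \<open>J = id - \<epsilon>1\<close>.  In the convolution algebra
  \<open>id = 1 + J\<close>, and the antipode is the geometric series for the inverse of \<open>1 + J\<close>.
\<close>

definition augmentation_part :: "'a \<Rightarrow> 'a" where
  "augmentation_part x = x - \<epsilon> x *\<^sub>C 1"

lemma clinear_augmentation_part: "clinear augmentation_part"
  unfolding augmentation_part_def
  by (rule clinearI)
    (simp_all add: clinear_add[OF clinear_convolution_unit] clinear_scale[OF clinear_convolution_unit]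
      complex_vector.scale_right_diff_distrib)

fun augmentation_power :: "nat \<Rightarrow> 'a \<Rightarrow> 'a" where
  "augmentation_power 0 = convolution_unit"
| "augmentation_power (Suc k) = convolution \<Delta> augmentation_part (augmentation_power k)"

lemma clinear_augmentation_power: "clinear (augmentation_power k)"
  by (induction k)
    (simp_all add: clinear_convolution_unit clinear_convolution clinear_augmentation_part)

lemma augmentation_power_Suc_right:
  "augmentation_power (Suc k) = convolution \<Delta> (augmentation_power k) augmentation_part"
proof (induction k)
  case 0
  show ?case
    by (simp add: convolution_unit_left convolution_unit_right clinear_augmentation_part)
next
  case (Suc k)
  have "augmentation_power (Suc (Suc k)) =
      convolution \<Delta> augmentation_part (convolution \<Delta> (augmentation_power k) augmentation_part)"
    using Suc by simp
  then show ?case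
    by (simp add: convolution_assoc clinear_augmentation_part clinear_augmentation_power)
qed

definition antipode_approx :: "nat \<Rightarrow> 'a \<Rightarrow> 'a" where
  "antipode_approx N x = (\<Sum>k\<le>N. (-1) ^ k *\<^sub>C augmentation_power k x)"

lemma antipode_approx_Suc:
  "antipode_approx (Suc N) = (\<lambda>x. antipode_approx N x + (-1) ^ Suc N *\<^sub>C augmentation_power (Suc N) x)"
  by (simp add: antipode_approx_def fun_eq_iff)

lemma id_eq_unit_plus_augmentation: "id = (\<lambda>x. \<epsilon> x *\<^sub>C 1 + augmentation_part x)"
  by (simp add: augmentation_part_def fun_eq_iff)

lemma clinear_antipode_approx: "clinear (antipode_approx N)"
  by (rule clinearI)
    (simp_all add: antipode_approx_def clinear_add[OF clinear_augmentation_power] scaleC_add_right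
      sum.distrib clinear_scale[OF clinear_augmentation_power] complex_vector.scale_sum_right
      scaleC_scaleC mult.commute)

text \<open>
  The telescoping identity \<open>(1 + J)(1 - J + J\<^sup>2 - \<dots> \<plusminus> J\<^sup>N) = 1 \<plusminus> J\<^sup>N\<^sup>+\<^sup>1\<close> for convolution powers.
\<close>

lemma convolution_antipode_approx:
  "convolution \<Delta> id (antipode_approx N) x = \<epsilon> x *\<^sub>C 1 + (-1) ^ N *\<^sub>C augmentation_power (Suc N) x"
  "convolution \<Delta> (antipode_approx N) id x = \<epsilon> x *\<^sub>C 1 + (-1) ^ N *\<^sub>C augmentation_power (Suc N) x"
proof -
  have l: "convolution \<Delta> augmentation_part (antipode_approx N) x =
      \<epsilon> x *\<^sub>C 1 + (-1) ^ N *\<^sub>C augmentation_power (Suc N) x - antipode_approx N x" for x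
  proof (induction N)
    case 0
    have "antipode_approx 0 = convolution_unit" by (simp add: antipode_approx_def fun_eq_iff scaleC_one)
    then show ?case by (simp add: scaleC_one)
  next
    case (Suc N)
    have "convolution \<Delta> augmentation_part (antipode_approx (Suc N)) x =
        convolution \<Delta> augmentation_part (antipode_approx N) x + (-1) ^ Suc N *\<^sub>C augmentation_power (Suc (Suc N)) x"
      unfolding antipode_approx_Suc convolution_add_right convolution_scale_right by simp
    then show ?case
      unfolding Suc by (simp add: antipode_approx_Suc del: augmentation_power.simps)
  qed
  have r: "convolution \<Delta> (antipode_approx N) augmentation_part x =
      \<epsilon> x *\<^sub>C 1 + (-1) ^ N *\<^sub>C augmentation_power (Suc N) x - antipode_approx N x" for x
  proof (induction N)
    case 0
    have "antipode_approx 0 = convolution_unit" by (simp add: antipode_approx_def fun_eq_iff scaleC_one)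
    then show ?case by (simp add: scaleC_one augmentation_power_Suc_right del: augmentation_power.simps(2))
  next
    case (Suc N)
    have "convolution \<Delta> (antipode_approx (Suc N)) augmentation_part x =
        convolution \<Delta> (antipode_approx N) augmentation_part x + (-1) ^ Suc N *\<^sub>C augmentation_power (Suc (Suc N)) x"
      unfolding antipode_approx_Suc convolution_add_left convolution_scale_left
      by (simp add: augmentation_power_Suc_right[of "Suc N"] del: augmentation_power.simps)
    then show ?case
      unfolding Suc by (simp add: antipode_approx_Suc del: augmentation_power.simps)
  qed
  show "convolution \<Delta> id (antipode_approx N) x = \<epsilon> x *\<^sub>C 1 + (-1) ^ N *\<^sub>C augmentation_power (Suc N) x"
    unfolding id_eq_unit_plus_augmentation convolution_add_left
    by (simp add: l convolution_unit_left clinear_antipode_approx)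
  show "convolution \<Delta> (antipode_approx N) id x = \<epsilon> x *\<^sub>C 1 + (-1) ^ N *\<^sub>C augmentation_power (Suc N) x"
    unfolding id_eq_unit_plus_augmentation convolution_add_right
    by (simp add: r convolution_unit_right clinear_antipode_approx)
qed

text \<open>
  Restricting the sum to the nonvanishing terms gives the whole series its value at \<open>x\<close> whenever only
  finitely many of them are nonzero.
\<close>

definition antipode_series :: "'a \<Rightarrow> 'a" where
  "antipode_series x = (\<Sum>k | augmentation_power k x \<noteq> 0. (-1) ^ k *\<^sub>C augmentation_power k x)"

text \<open>
  The series itself is only a pointwise limit.  It may nevertheless be replaced by a partial sum inside
  a convolution, because a tensor involves finitely many elements, on each of which the partial sums
  are eventually constant.
\<close>

lemma locally_nilpotent_antipode:
  assumes nil: "\<And>x. \<forall>\<^sub>F k in sequentially. augmentation_power k x = 0"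
  shows "clinear antipode_series \<and> convolution \<Delta> antipode_series id = convolution_unit \<and>
    convolution \<Delta> id antipode_series = convolution_unit"
proof -
  let ?S = antipode_series
  have ev: "\<forall>\<^sub>F N in sequentially. ?S x = antipode_approx N x" for x
  proof -
    obtain N0 where N0: "\<And>k. k \<ge> N0 \<Longrightarrow> augmentation_power k x = 0"
      using nil[of x] by (auto simp: eventually_sequentially)
    have "?S x = antipode_approx N x" if "N \<ge> N0" for N
      unfolding antipode_series_def antipode_approx_def
    proof (rule sum.mono_neutral_left)
      show "{k. augmentation_power k x \<noteq> 0} \<subseteq> {..N}"
      proof
        fix k assume "k \<in> {k. augmentation_power k x \<noteq> 0}"
        then have "\<not> N0 \<le> k" using N0[of k] by auto
        then show "k \<in> {..N}" using that by simp
      qed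
    qed auto
    then show ?thesis by (auto simp: eventually_sequentially)
  qed
  have lin: "clinear ?S"
  proof (rule clinearI)
    fix x y c
    have "\<forall>\<^sub>F N::nat in sequentially. ?S (x + y) = ?S x + ?S y"
      using ev[of x] ev[of y] ev[of "x + y"]
      by eventually_elim (simp add: clinear_add[OF clinear_antipode_approx])
    then show "?S (x + y) = ?S x + ?S y" by simp
    have "\<forall>\<^sub>F N::nat in sequentially. ?S (c *\<^sub>C x) = c *\<^sub>C ?S x"
      using ev[of x] ev[of "c *\<^sub>C x"]
      by eventually_elim (simp add: clinear_scale[OF clinear_antipode_approx])
    then show "?S (c *\<^sub>C x) = c *\<^sub>C ?S x" by simp
  qed
  note id' = clinear_id
  note bl = cbilinear_mult[OF lin id'] cbilinear_mult[OF clinear_antipode_approx id']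
  note br = cbilinear_mult[OF id' lin] cbilinear_mult[OF id' clinear_antipode_approx]
  have tl: "\<forall>\<^sub>F N in sequentially. tensor_lift (\<lambda>a b. ?S a * id b) t = tensor_lift (\<lambda>a b. antipode_approx N a * id b) t" for t
  proof (induction t rule: tensor_induct)
    case (tens a b)
    show ?case using ev[of a] by eventually_elim (simp only: tensor_lift_tens[OF bl(1)] tensor_lift_tens[OF bl(2)])
  next
    case (add s t)
    then show ?case
      by eventually_elim (simp only: clinear_add[OF clinear_tensor_lift[OF bl(1)]] clinear_add[OF clinear_tensor_lift[OF bl(2)]])
  qed
  have tr: "\<forall>\<^sub>F N in sequentially. tensor_lift (\<lambda>a b. id a * ?S b) t = tensor_lift (\<lambda>a b. id a * antipode_approx N b) t" for t
  proof (induction t rule: tensor_induct)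
    case (tens a b)
    show ?case using ev[of b] by eventually_elim (simp only: tensor_lift_tens[OF br(1)] tensor_lift_tens[OF br(2)])
  next
    case (add s t)
    then show ?case
      by eventually_elim (simp only: clinear_add[OF clinear_tensor_lift[OF br(1)]] clinear_add[OF clinear_tensor_lift[OF br(2)]])
  qed
  have nil': "\<forall>\<^sub>F N in sequentially. augmentation_power (Suc N) x = 0" for x
    using nil[of x] by (subst eventually_sequentially_Suc)
  have "convolution \<Delta> ?S id x = \<epsilon> x *\<^sub>C 1" for x
  proof -
    have "\<forall>\<^sub>F N::nat in sequentially. convolution \<Delta> ?S id x = \<epsilon> x *\<^sub>C 1"
      using tl[of "\<Delta> x"] nil'[of x]
    proof eventually_elim
      case (elim N)
      then have "convolution \<Delta> ?S id x = convolution \<Delta> (antipode_approx N) id x"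
        by (simp only: convolution_def)
      then show ?case using elim(2) by (simp add: convolution_antipode_approx(2) del: augmentation_power.simps)
    qed
    then show ?thesis by simp
  qed
  moreover have "convolution \<Delta> id ?S x = \<epsilon> x *\<^sub>C 1" for x
  proof -
    have "\<forall>\<^sub>F N::nat in sequentially. convolution \<Delta> id ?S x = \<epsilon> x *\<^sub>C 1"
      using tr[of "\<Delta> x"] nil'[of x]
    proof eventually_elim
      case (elim N)
      then have "convolution \<Delta> id ?S x = convolution \<Delta> id (antipode_approx N) x"
        by (simp only: convolution_def)
      then show ?case using elim(2) by (simp add: convolution_antipode_approx(1) del: augmentation_power.simps)
    qed
    then show ?thesis by simp
  qed
  ultimately show ?thesis using lin by (simp add: fun_eq_iff)
qed

end

context graded_connected_bialgebra
begin

lemma augmentation_grade_0: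
  assumes "x \<in> B 0"
  shows "augmentation_part x = 0"
proof -
  obtain c where "x = c *\<^sub>C 1"
    using assms connected complex_vector.span_singleton[of "1::'a"] by auto
  then show ?thesis
    by (simp add: augmentation_part_def clinear_scale[OF clinear_\<epsilon>] counit_1 scaleC_complex_def)
qed

text \<open>
  \<open>J\<close> kills degree 0 by connectedness, so each factor of \<open>J\<^sup>k\<close> uses up at least one degree.
\<close>

lemma augmentation_power_eq_0:
  assumes "x \<in> B n" "n < k"
  shows "augmentation_power k x = 0"
  using assms
proof (induction k arbitrary: n x)
  case (Suc k)
  let ?L = "tensor_lift (\<lambda>a b. augmentation_part a * augmentation_power k b)"
  note b = cbilinear_mult[OF clinear_augmentation_part clinear_augmentation_power, of k]
  note lin = clinear_tensor_lift[OF b]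
  obtain t where t: "\<Delta> x = (\<Sum>i\<le>n. t i)" "\<And>i. i \<le> n \<Longrightarrow> t i \<in> tensor_sub (B i) (B (n - i))"
    using comult_grade[OF Suc.prems(1)] by blast
  have "?L (t i) = 0" if i: "i \<le> n" for i
  proof -
    have gen: "?L (a \<otimes> b) = 0" if "a \<in> B i" "b \<in> B (n - i)" for a b
    proof (cases "i = 0")
      case True
      then show ?thesis using that by (simp add: tensor_lift_tens[OF b] augmentation_grade_0)
    next
      case False
      then have "n - i < k" using Suc.prems(2) i by auto
      then show ?thesis using Suc.IH[OF that(2)] by (simp add: tensor_lift_tens[OF b])
    qed
    have "t i \<in> complex_vector.span {a \<otimes> b | a b. a \<in> B i \<and> b \<in> B (n - i)}"
      using t(2)[OF i] by (simp add: tensor_sub_def)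
    then show ?thesis
    proof (induction rule: complex_vector.span_induct_alt)
      case base
      show ?case by (rule clinear_0[OF lin])
    next
      case (step c x y)
      then show ?case using gen by (auto simp: clinear_add[OF lin] clinear_scale[OF lin])
    qed
  qed
  then have "?L (\<Delta> x) = 0" unfolding t(1) clinear_sum[OF lin] by (intro sum.neutral) simp
  then show ?case by (simp add: convolution_def)
qed simp

lemma eventually_augmentation_power_eq_0: "\<forall>\<^sub>F k in sequentially. augmentation_power k x = 0"
proof -
  obtain f where f: "\<And>n. f n \<in> B n" "finite {n. f n \<noteq> 0}" "x = (\<Sum>n | f n \<noteq> 0. f n)"
    using direct_sum[unfolded is_direct_sum_def, THEN conjunct2, rule_format, THEN ex1_implies_ex, of x]
    by blast
  have "\<forall>\<^sub>F k in sequentially. \<forall>n\<in>{n. f n \<noteq> 0}. n < k"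
    using eventually_gt_at_top by (intro eventually_ball_finite f(2)) blast
  then show ?thesis
  proof eventually_elim
    case (elim k)
    then show ?case
      unfolding f(3) clinear_sum[OF clinear_augmentation_power]
      using augmentation_power_eq_0[OF f(1)] by (intro sum.neutral) blast
  qed
qed

theorem graded_connected_hopf: "graded_connected_hopf_algebra \<Delta> \<epsilon> B"
proof -
  have "hopf_algebra \<Delta> \<epsilon>"
    by unfold_locales
      (rule exI[of _ antipode_series],
       rule locally_nilpotent_antipode[OF eventually_augmentation_power_eq_0])
  then show ?thesis
    by (intro graded_connected_hopf_algebra.intro graded_connected_bialgebra_axioms)
qed

end

section \<open>Homomorphisms on tensor products\<close>

lemma calgebra_homD:
  assumes "calgebra_hom f"
  shows "clinear f" "f 1 = 1" "f (x * y) = f x * f y"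
  using assms by (simp_all add: calgebra_hom_def)

lemma calgebra_hom_prod:
  fixes f :: "'a::complex_comm_algebra_1 \<Rightarrow> 'b::complex_comm_algebra_1"
  assumes "calgebra_hom f"
  shows "f (\<Prod>i\<in>I. g i) = (\<Prod>i\<in>I. f (g i))"
  by (induction I rule: infinite_finite_induct) (simp_all add: calgebra_homD[OF assms])

lemma calgebra_hom_prod_list:
  assumes "calgebra_hom f"
  shows "f (prod_list xs) = prod_list (map f xs)"
  by (induction xs) (simp_all add: calgebra_homD[OF assms])

lemma calgebra_hom_compose: "calgebra_hom f \<Longrightarrow> calgebra_hom g \<Longrightarrow> calgebra_hom (\<lambda>x. f (g x))"
  by (simp add: calgebra_hom_def clinear_compose)

lemma calgebra_hom_id: "calgebra_hom id"
  unfolding calgebra_hom_def by (simp only: clinear_id id_apply simp_thms)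

text \<open>
  Pure tensors span the tensor product, and both sides of the multiplicativity law are bilinear.
\<close>

lemma calgebra_hom_tensorI:
  assumes lin: "clinear f" and one: "f (1 \<otimes> 1) = 1"
    and mult: "\<And>a b c d. f ((a * c) \<otimes> (b * d)) = f (a \<otimes> b) * f (c \<otimes> d)"
  shows "calgebra_hom f"
proof -
  have "f ((a \<otimes> b) * t) = f (a \<otimes> b) * f t" for a b t
    by (induction t rule: tensor_induct)
      (simp_all add: tens_mult_tens mult distrib_left clinear_add[OF lin])
  then have "f (s * t) = f s * f t" for s t
    by (induction s rule: tensor_induct) (simp_all add: distrib_right clinear_add[OF lin])
  then show ?thesis using lin one by (simp add: calgebra_hom_def one_tensor_def)
qed

lemma calgebra_hom_tensor_map:
  assumes f: "calgebra_hom f" and g: "calgebra_hom g"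
  shows "calgebra_hom (tensor_map f g)"
proof (rule calgebra_hom_tensorI)
  note t = tensor_map_tens[OF calgebra_homD(1)[OF f] calgebra_homD(1)[OF g]]
  show "clinear (tensor_map f g)"
    by (rule clinear_tensor_map[OF calgebra_homD(1)[OF f] calgebra_homD(1)[OF g]])
  show "tensor_map f g (1 \<otimes> 1) = 1"
    by (simp add: t calgebra_homD[OF f] calgebra_homD[OF g] one_tensor_def)
  show "tensor_map f g ((a * c) \<otimes> (b * d)) = tensor_map f g (a \<otimes> b) * tensor_map f g (c \<otimes> d)" for a b c d
    by (simp add: t calgebra_homD[OF f] calgebra_homD[OF g] tens_mult_tens)
qed

lemma calgebra_hom_tensor_assoc:
  "calgebra_hom (tensor_assoc :: ('a::complex_algebra_1 \<otimes>\<^sub>t 'b::complex_algebra_1) \<otimes>\<^sub>t 'c::complex_algebra_1 \<Rightarrow> _)"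
    (is "calgebra_hom ?F")
proof (rule calgebra_hom_tensorI)
  note lin = clinear_tensor_assoc
  show "clinear ?F" by (rule lin)
  show "?F (1 \<otimes> 1) = 1" by (simp add: one_tensor_def tensor_assoc_tens)
  show "?F ((s * t) \<otimes> (b * d)) = ?F (s \<otimes> b) * ?F (t \<otimes> d)" for s t and b d :: 'c
  proof -
    have "?F (((a1 \<otimes> a2) * t) \<otimes> (b * d)) = ?F ((a1 \<otimes> a2) \<otimes> b) * ?F (t \<otimes> d)" for a1 a2
      by (induction t rule: tensor_induct)
        (simp_all add: tens_mult_tens tensor_assoc_tens distrib_left tens_add_left clinear_add[OF lin])
    then show ?thesis
      by (induction s rule: tensor_induct)
        (simp_all add: distrib_right tens_add_left clinear_add[OF lin])
  qed
qed

lemma tens_sum_left: "(\<Sum>i\<in>I. f i) \<otimes> b = (\<Sum>i\<in>I. f i \<otimes> b)"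
  by (induction I rule: infinite_finite_induct) (simp_all add: tens_zero_left tens_add_left)

lemma tens_sum_right: "a \<otimes> (\<Sum>i\<in>I. f i) = (\<Sum>i\<in>I. a \<otimes> f i)"
  by (induction I rule: infinite_finite_induct) (simp_all add: tens_zero_right tens_add_right)

lemma prod_tens:
  fixes f :: "'i \<Rightarrow> 'a::complex_comm_algebra_1" and g :: "'i \<Rightarrow> 'b::complex_comm_algebra_1"
  shows "(\<Prod>i\<in>I. f i \<otimes> g i) = (\<Prod>i\<in>I. f i) \<otimes> (\<Prod>i\<in>I. g i)"
  by (induction I rule: infinite_finite_induct) (simp_all add: tens_mult_tens one_tensor_def)


section \<open>Coassociativity\<close>

lemma calgebra_hom_Y_comult: "calgebra_hom Y_comult"
  unfolding Y_comult_def by (rule calgebra_hom_poly_eval)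

lemma calgebra_hom_Y_counit: "calgebra_hom Y_counit"
  unfolding Y_counit_def by (rule calgebra_hom_poly_eval)

lemma length_subword [simp]: "length (subword w A) = card A"
  by (simp add: subword_def)

lemma subword_full: "subword w {1..length w} = w"
proof -
  have "sorted_list_of_set {1..length w} = [1..<Suc (length w)]"
    using sorted_list_of_set_range[of 1 "Suc (length w)"] by (simp add: atLeastLessThanSuc_atLeastAtMost del: upt_Suc)
  then show ?thesis by (auto simp: subword_def intro!: nth_equalityI simp del: upt_Suc)
qed

lemma Y_eq_1: "length w < 2 \<Longrightarrow> Y w = 1"
  by (simp add: Y_def)

lemma noncrossing_partitions_singleton: "noncrossing_partitions {x} = {{{x}}}"
proof
  show "{{{x}}} \<subseteq> noncrossing_partitions {x}" using one_block_noncrossing[of "{x}"] by simp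
  show "noncrossing_partitions {x} \<subseteq> {{{x}}}"
  proof
    fix \<pi> assume "\<pi> \<in> noncrossing_partitions {x}"
    then have p: "partition_on {x} \<pi>" by (rule noncrossing_partition_on)
    have "A = {x}" if "A \<in> \<pi>" for A using block_subset[OF p that] block_nonempty[OF p that] by blast
    moreover have "\<pi> \<noteq> {}" using partition_onD1[OF p] by auto
    ultimately show "\<pi> \<in> {{{x}}}" by blast
  qed
qed

text \<open>
  The defining formula of the coproduct also holds for words of length 1, with \<open>Y\<^sub>w = 1\<close>.  Blocks of
  size 1 therefore need no special treatment when coproducts are multiplied over the blocks.
\<close>

lemma Y_comult_Y:
  assumes "length w \<ge> 1"
  shows "Y_comult (Y w) = (\<Sum>\<pi>\<in>noncrossing_partitions {1..length w}.
    Y_part w \<pi> \<otimes> Y_part w (kreweras_on {1..length w} \<pi>))"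
proof (cases "length w = 1")
  case True
  have "kreweras_on {1} {{1}} \<in> {{{1}}}"
    unfolding noncrossing_partitions_singleton[symmetric] by (rule kreweras_on_noncrossing)
  moreover have "subword w {1} = w" using subword_full[of w] True by simp
  ultimately show ?thesis using True
    by (simp add: Y_eq_1 noncrossing_partitions_singleton Y_part_def calgebra_homD[OF calgebra_hom_Y_comult]
        one_tensor_def tens_mult_tens)
next
  case False
  then have "Y_comult (Y w) = (\<Sum>\<pi>\<in>NC (length w). Y_part w \<pi> \<otimes> Y_part w (kreweras (length w) \<pi>))"
    using assms by (simp add: Y_comult_def poly_eval_Y Abs_idx_inverse Let_def)
  then show ?thesis
    unfolding NC_eq_noncrossing_partitions[symmetric]
    using assms by (simp add: kreweras_eq_kreweras_on)
qed

lemma Y_comult_subword: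
  assumes A: "finite A" "A \<noteq> {}"
  shows "Y_comult (Y (subword w A)) =
    (\<Sum>\<tau>\<in>noncrossing_partitions A. Y_part w \<tau> \<otimes> Y_part w (kreweras_on A \<tau>))"
proof -
  define m where "m = card A"
  define e where "e i = sorted_list_of_set A ! (i - 1)" for i
  have m: "m \<ge> 1" using A by (simp add: m_def card_gt_0_iff Suc_le_eq)
  have len: "length (sorted_list_of_set A) = m" by (simp add: m_def)
  have e: "strict_mono_on {1..m} e"
  proof (rule strict_mono_onI)
    fix i j assume "i \<in> {1..m}" "j \<in> {1..m}" "i < j"
    then show "e i < e j"
      unfolding e_def using len
      by (intro sorted_wrt_nth_less[OF strict_sorted_list_of_set]) auto
  qed
  note inj = strict_mono_on_imp_inj_on[OF e]
  have "e ` {1..m} = set (sorted_list_of_set A)"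
  proof (intro equalityI subsetI)
    fix x assume "x \<in> e ` {1..m}"
    then obtain i where i: "i \<in> {1..m}" "x = sorted_list_of_set A ! (i - 1)" by (auto simp: e_def)
    then have "i - 1 < length (sorted_list_of_set A)" using len by auto
    then show "x \<in> set (sorted_list_of_set A)" unfolding i(2) by (rule nth_mem)
  next
    fix x assume "x \<in> set (sorted_list_of_set A)"
    then obtain j where j: "j < m" "sorted_list_of_set A ! j = x" unfolding in_set_conv_nth len by blast
    show "x \<in> e ` {1..m}"
    proof (rule image_eqI)
      show "x = e (Suc j)" "Suc j \<in> {1..m}" using j by (simp_all add: e_def)
    qed
  qed
  then have eA: "e ` {1..m} = A" using A by simp
  \<comment> \<open>e lists the elements of A in increasing order, so it carries positions in w|A to positions in w\<close>
  have sub: "subword (subword w A) B = subword w (e ` B)" if B: "B \<subseteq> {1..m}" for B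
  proof -
    have fB: "finite B" by (rule finite_subset[OF B]) simp
    have "sorted_wrt (<) (map e (sorted_list_of_set B))"
      unfolding sorted_wrt_map
    proof (rule sorted_wrt_mono_rel[OF _ strict_sorted_list_of_set])
      fix x y assume "x \<in> set (sorted_list_of_set B)" "y \<in> set (sorted_list_of_set B)" "x < y"
      then show "e x < e y" using fB B by (intro strict_mono_onD[OF e]) auto
    qed
    moreover have "sorted_wrt (<) (sorted_list_of_set (e ` B))" by (rule strict_sorted_list_of_set)
    ultimately have "sorted_list_of_set (e ` B) = map e (sorted_list_of_set B)"
      using fB by (intro strict_sorted_equal) simp_all
    moreover have "subword w A ! (b - 1) = w ! (e b - 1)" if b: "b \<in> B" for b
    proof -
      have "b - 1 < length (sorted_list_of_set A)" using B b len by force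
      then show ?thesis by (simp add: subword_def e_def)
    qed
    ultimately show ?thesis using fB by (simp add: subword_def[of _ B] subword_def[of _ "e ` B"])
  qed
  have part: "Y_part (subword w A) \<tau> = Y_part w ((`) e ` \<tau>)" if \<tau>: "partition_on {1..m} \<tau>" for \<tau>
  proof -
    have "inj_on ((`) e) \<tau>"
      using block_subset[OF \<tau>] inj_on_image_Pow[OF inj] by (auto intro: inj_on_subset)
    then show ?thesis
      using block_subset[OF \<tau>] by (simp add: Y_part_def prod.reindex sub)
  qed
  have "Y_comult (Y (subword w A)) = (\<Sum>\<tau>\<in>noncrossing_partitions {1..m}.
      Y_part (subword w A) \<tau> \<otimes> Y_part (subword w A) (kreweras_on {1..m} \<tau>))"
    using Y_comult_Y[of "subword w A"] m by (simp add: m_def)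
  also have "\<dots> = (\<Sum>\<tau>\<in>noncrossing_partitions {1..m}.
      Y_part w ((`) e ` \<tau>) \<otimes> Y_part w (kreweras_on A ((`) e ` \<tau>)))"
  proof (rule sum.cong[OF refl])
    fix \<tau> assume \<tau>: "\<tau> \<in> noncrossing_partitions {1..m}"
    show "Y_part (subword w A) \<tau> \<otimes> Y_part (subword w A) (kreweras_on {1..m} \<tau>) =
        Y_part w ((`) e ` \<tau>) \<otimes> Y_part w (kreweras_on A ((`) e ` \<tau>))"
      unfolding part[OF noncrossing_partition_on[OF \<tau>]] part[OF partition_on_kreweras_on]
        kreweras_on_relabel[OF finite_atLeastAtMost e \<tau>, symmetric] eA ..
  qed
  also have "\<dots> = (\<Sum>\<tau>\<in>noncrossing_partitions A. Y_part w \<tau> \<otimes> Y_part w (kreweras_on A \<tau>))"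
    using sum.reindex_bij_betw[OF bij_betw_relabel_noncrossing[OF e],
        of "\<lambda>\<tau>. Y_part w \<tau> \<otimes> Y_part w (kreweras_on A \<tau>)"] unfolding eA .
  finally show ?thesis .
qed

lemma Y_part_glue:
  assumes S: "finite S" and \<pi>: "partition_on S \<pi>" and f: "\<And>A. A \<in> \<pi> \<Longrightarrow> partition_on A (f A)"
  shows "(\<Prod>A\<in>\<pi>. Y_part w (f A)) = Y_part w (\<Union>A\<in>\<pi>. f A)"
  unfolding Y_part_def
proof (rule prod.UNION_disjoint[symmetric])
  show "finite \<pi>" by (rule finite_elements[OF S \<pi>])
  show "\<forall>A\<in>\<pi>. finite (f A)" using finite_elements[OF finite_block[OF S \<pi>] f] by blast
  show "\<forall>A\<in>\<pi>. \<forall>B\<in>\<pi>. A \<noteq> B \<longrightarrow> f A \<inter> f B = {}"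
  proof (intro ballI impI, rule ccontr)
    fix A B assume AB: "A \<in> \<pi>" "B \<in> \<pi>" "A \<noteq> B" "f A \<inter> f B \<noteq> {}"
    then obtain C where C: "C \<in> f A" "C \<in> f B" by blast
    obtain x where "x \<in> C" using block_nonempty[OF f[OF AB(1)] C(1)] by blast
    then have "x \<in> A" "x \<in> B" using block_subset[OF f[OF AB(1)] C(1)] block_subset[OF f[OF AB(2)] C(2)] by blast+
    then show False using partition_on_blockD[OF \<pi> AB(1,2)] AB(3) by blast
  qed
qed

text \<open>
  Expand the product over the blocks of \<open>\<pi>\<close> by distributivity: a choice of a non-crossing partition of
  each block is the same as one \<open>\<rho> \<le> \<pi>\<close>.
\<close>

lemma Y_comult_Y_part:
  assumes S: "finite S" and \<pi>: "\<pi> \<in> noncrossing_partitions S"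
  shows "Y_comult (Y_part w \<pi>) =
    (\<Sum>\<rho>\<in>noncrossing_below S \<pi>. Y_part w \<rho> \<otimes> Y_part w (relative_kreweras \<pi> \<rho>))"
proof -
  note p = noncrossing_partition_on[OF \<pi>]
  let ?T = "\<lambda>A \<tau>. Y_part w \<tau> \<otimes> Y_part w (kreweras_on A \<tau>)"
  have "Y_comult (Y_part w \<pi>) = (\<Prod>A\<in>\<pi>. Y_comult (Y (subword w A)))"
    unfolding Y_part_def by (rule calgebra_hom_prod[OF calgebra_hom_Y_comult])
  also have "\<dots> = (\<Prod>A\<in>\<pi>. \<Sum>\<tau>\<in>noncrossing_partitions A. ?T A \<tau>)"
    by (intro prod.cong refl Y_comult_subword finite_block[OF S p] block_nonempty[OF p])
  also have "\<dots> = (\<Sum>f\<in>PiE \<pi> noncrossing_partitions. \<Prod>A\<in>\<pi>. ?T A (f A))"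
    by (intro prod_sum_PiE finite_elements[OF S p] finite_noncrossing_partitions finite_block[OF S p])
  also have "\<dots> = (\<Sum>f\<in>PiE \<pi> noncrossing_partitions.
      Y_part w (\<Union>A\<in>\<pi>. f A) \<otimes> Y_part w (relative_kreweras \<pi> (\<Union>A\<in>\<pi>. f A)))"
  proof (rule sum.cong[OF refl])
    fix f assume f: "f \<in> PiE \<pi> noncrossing_partitions"
    note fp = noncrossing_partition_on[OF PiE_mem[OF f]]
    have "relative_kreweras \<pi> (\<Union>A\<in>\<pi>. f A) = (\<Union>A\<in>\<pi>. kreweras_on A (f A))"
      unfolding relative_kreweras_def by (intro SUP_cong refl) (simp add: blocks_inside_glue[OF p fp])
    moreover have "(\<Prod>A\<in>\<pi>. Y_part w (f A)) = Y_part w (\<Union>A\<in>\<pi>. f A)"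
      by (rule Y_part_glue[OF S p fp])
    ultimately show "(\<Prod>A\<in>\<pi>. ?T A (f A)) =
        Y_part w (\<Union>A\<in>\<pi>. f A) \<otimes> Y_part w (relative_kreweras \<pi> (\<Union>A\<in>\<pi>. f A))"
      unfolding prod_tens Y_part_glue[OF S p partition_on_kreweras_on] by simp
  qed
  also have "\<dots> = (\<Sum>\<rho>\<in>noncrossing_below S \<pi>. Y_part w \<rho> \<otimes> Y_part w (relative_kreweras \<pi> \<rho>))"
    by (rule sum.reindex_bij_betw[OF bij_betw_noncrossing_below[OF \<pi>]])
  finally show ?thesis .
qed

lemma Y_comult_coassoc_generator:
  assumes "length w \<ge> 1"
  shows "tensor_assoc (tensor_map Y_comult id (Y_comult (Y w))) = tensor_map id Y_comult (Y_comult (Y w))"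
proof -
  define S where "S = {1..length w}"
  have S: "finite S" by (simp add: S_def)
  let ?N = "noncrossing_partitions S" and ?P = "Y_part w"
  note lin = calgebra_homD(1)[OF calgebra_hom_Y_comult] clinear_id
  let ?h = "\<lambda>(\<rho>, \<sigma>). ?P \<rho> \<otimes> (?P \<sigma> \<otimes> ?P (relative_kreweras (kreweras_on S \<rho>) \<sigma>))"
  have "tensor_assoc (tensor_map Y_comult id (Y_comult (Y w))) =
      (\<Sum>\<pi>\<in>?N. tensor_assoc (Y_comult (?P \<pi>) \<otimes> ?P (kreweras_on S \<pi>)))"
    unfolding Y_comult_Y[OF assms] S_def[symmetric] clinear_sum[OF clinear_tensor_map[OF lin]]
      clinear_sum[OF clinear_tensor_assoc] tensor_map_tens[OF lin] by simp
  also have "\<dots> = (\<Sum>\<pi>\<in>?N. \<Sum>\<rho>\<in>noncrossing_below S \<pi>.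
      ?P \<rho> \<otimes> (?P (relative_kreweras \<pi> \<rho>) \<otimes> ?P (kreweras_on S \<pi>)))"
    by (intro sum.cong refl)
      (simp add: Y_comult_Y_part[OF S] tens_sum_left clinear_sum[OF clinear_tensor_assoc] tensor_assoc_tens)
  also have "\<dots> = (\<Sum>\<pi>\<in>?N. \<Sum>\<rho>\<in>noncrossing_below S \<pi>. ?h (\<rho>, relative_kreweras \<pi> \<rho>))"
    by (intro sum.cong refl) (simp add: relative_kreweras_kreweras_on[OF S])
  also have "\<dots> = (\<Sum>x\<in>(SIGMA \<pi>:?N. noncrossing_below S \<pi>).
      ?h (case x of (\<pi>, \<rho>) \<Rightarrow> (\<rho>, relative_kreweras \<pi> \<rho>)))"
    by (subst sum.Sigma) (auto simp: finite_noncrossing_partitions[OF S] finite_noncrossing_below[OF S] case_prod_beta)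
  also have "\<dots> = (\<Sum>x\<in>(SIGMA \<rho>:?N. noncrossing_below S (kreweras_on S \<rho>)). ?h x)"
    by (rule sum.reindex_bij_betw[OF bij_betw_factorizations[OF S]])
  also have "\<dots> = (\<Sum>\<rho>\<in>?N. \<Sum>\<sigma>\<in>noncrossing_below S (kreweras_on S \<rho>). ?h (\<rho>, \<sigma>))"
    by (subst sum.Sigma) (auto simp: finite_noncrossing_partitions[OF S] finite_noncrossing_below[OF S])
  also have "\<dots> = (\<Sum>\<rho>\<in>?N. ?P \<rho> \<otimes> Y_comult (?P (kreweras_on S \<rho>)))"
    by (simp add: Y_comult_Y_part[OF S kreweras_on_noncrossing] tens_sum_right)
  also have "\<dots> = tensor_map id Y_comult (Y_comult (Y w))"
    unfolding Y_comult_Y[OF assms] S_def[symmetric] clinear_sum[OF clinear_tensor_map[OF lin(2,1)]]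
      tensor_map_tens[OF lin(2,1)] by simp
  finally show ?thesis .
qed


section \<open>Counit\<close>

lemma Y_counit_Y: "Y_counit (Y w) = (if length w \<ge> 2 then 0 else 1)"
proof (cases "length w \<ge> 2")
  case True
  then show ?thesis by (simp add: Y_counit_def poly_eval_Y)
next
  case False
  then show ?thesis by (simp add: Y_eq_1 calgebra_homD[OF calgebra_hom_Y_counit])
qed

text \<open>
  A block with at least two points contributes a factor 0.
\<close>

lemma Y_counit_Y_part:
  assumes S: "finite S" and \<pi>: "partition_on S \<pi>"
  shows "Y_counit (Y_part w \<pi>) = (if \<pi> = (\<lambda>x. {x}) ` S then 1 else 0)"
proof -
  have val: "Y_counit (Y_part w \<pi>) = (\<Prod>A\<in>\<pi>. if card A \<ge> 2 then 0 else 1)"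
    unfolding Y_part_def calgebra_hom_prod[OF calgebra_hom_Y_counit] by (simp add: Y_counit_Y)
  show ?thesis
  proof (cases "\<exists>A\<in>\<pi>. card A \<ge> 2")
    case True
    then have "Y_counit (Y_part w \<pi>) = 0"
      unfolding val using finite_elements[OF S \<pi>] by (auto simp: prod_zero_iff)
    moreover have "\<pi> \<noteq> (\<lambda>x. {x}) ` S" using True by auto
    ultimately show ?thesis by simp
  next
    case False
    have single: "\<exists>x. A = {x}" if A: "A \<in> \<pi>" for A
    proof -
      have "card A = 1"
        using False A finite_block[OF S \<pi> A] block_nonempty[OF \<pi> A] card_gt_0_iff[of A] by force
      then show ?thesis by (rule card_1_singletonE) blast
    qed
    have "\<pi> = (\<lambda>x. {x}) ` S"
    proof (intro equalityI subsetI)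
      fix A assume A: "A \<in> \<pi>"
      then show "A \<in> (\<lambda>x. {x}) ` S" using single[OF A] block_subset[OF \<pi> A] by auto
    next
      fix A assume "A \<in> (\<lambda>x. {x}) ` S"
      then obtain x where x: "A = {x}" "x \<in> S" by blast
      obtain B where B: "B \<in> \<pi>" "x \<in> B" using partition_on_blockE[OF \<pi> x(2)] by blast
      then show "A \<in> \<pi>" using single[OF B(1)] x(1) by auto
    qed
    moreover have "Y_counit (Y_part w \<pi>) = 1" unfolding val using False by (intro prod.neutral) auto
    ultimately show ?thesis by simp
  qed
qed

lemma Y_part_one_block: "Y_part w {{1..length w}} = Y w"
  by (simp add: Y_part_def subword_full del: One_nat_def)

text \<open>
  Only the partition into singletons survives the counit on the left, and its complement has one block.
\<close>

lemma Y_counit_left: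
  fixes x :: "'k Yalg"
  shows "tensor_lift (\<lambda>a b. Y_counit a *\<^sub>C b) (Y_comult x) = x"
proof -
  note hom = calgebra_homD[OF calgebra_hom_Y_counit]
  note b = cbilinear_counit(1)[OF hom(1)]
  let ?L = "tensor_lift (\<lambda>a b. Y_counit a *\<^sub>C b) :: 'k Yalg \<otimes>\<^sub>t 'k Yalg \<Rightarrow> 'k Yalg"
  have "calgebra_hom ?L"
    by (rule calgebra_hom_tensorI[OF clinear_tensor_lift[OF b]])
      (simp_all add: tensor_lift_tens[OF b] hom scaleC_one mult_scaleC_left mult_scaleC_right scaleC_scaleC mult.commute)
  then have "calgebra_hom (\<lambda>x. ?L (Y_comult x))" by (rule calgebra_hom_compose[OF _ calgebra_hom_Y_comult])
  moreover have "?L (Y_comult (Y w)) = id (Y w)" if w: "length w \<ge> 2" for w :: "'k list"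
  proof -
    let ?S = "{1..length w}"
    have S: "finite ?S" "?S \<noteq> {}" and w1: "length w \<ge> 1" using w by auto
    have "?L (Y_comult (Y w)) = (\<Sum>\<pi>\<in>noncrossing_partitions ?S.
        Y_counit (Y_part w \<pi>) *\<^sub>C Y_part w (kreweras_on ?S \<pi>))"
      unfolding Y_comult_Y[OF w1] clinear_sum[OF clinear_tensor_lift[OF b]] tensor_lift_tens[OF b] ..
    also have "\<dots> = (\<Sum>\<pi>\<in>noncrossing_partitions ?S. if \<pi> = (\<lambda>x. {x}) ` ?S then Y w else 0)"
    proof (rule sum.cong[OF refl])
      fix \<pi> assume \<pi>: "\<pi> \<in> noncrossing_partitions ?S"
      show "Y_counit (Y_part w \<pi>) *\<^sub>C Y_part w (kreweras_on ?S \<pi>) =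
          (if \<pi> = (\<lambda>x. {x}) ` ?S then Y w else 0)"
        unfolding Y_counit_Y_part[OF S(1) noncrossing_partition_on[OF \<pi>]]
        using kreweras_on_singletons[OF S] by (simp add: Y_part_one_block scaleC_one del: One_nat_def)
    qed
    also have "\<dots> = Y w"
      using singletons_noncrossing[of ?S] by (simp add: finite_noncrossing_partitions)
    finally show ?thesis by simp
  qed
  ultimately have "(\<lambda>x. ?L (Y_comult x)) = id" by (intro Yalg_hom_unique calgebra_hom_id)
  then show ?thesis by (simp add: fun_eq_iff)
qed

text \<open>
  Only the complement into singletons survives, which is that of the partition with one block.
\<close>

lemma Y_counit_right:
  fixes x :: "'k Yalg"
  shows "tensor_lift (\<lambda>a b. Y_counit b *\<^sub>C a) (Y_comult x) = x"
proof -
  note hom = calgebra_homD[OF calgebra_hom_Y_counit]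
  note b = cbilinear_counit(2)[OF hom(1)]
  let ?L = "tensor_lift (\<lambda>a b. Y_counit b *\<^sub>C a) :: 'k Yalg \<otimes>\<^sub>t 'k Yalg \<Rightarrow> 'k Yalg"
  have "calgebra_hom ?L"
    by (rule calgebra_hom_tensorI[OF clinear_tensor_lift[OF b]])
      (simp_all add: tensor_lift_tens[OF b] hom scaleC_one mult_scaleC_left mult_scaleC_right scaleC_scaleC mult.commute)
  then have "calgebra_hom (\<lambda>x. ?L (Y_comult x))" by (rule calgebra_hom_compose[OF _ calgebra_hom_Y_comult])
  moreover have "?L (Y_comult (Y w)) = id (Y w)" if w: "length w \<ge> 2" for w :: "'k list"
  proof -
    let ?S = "{1..length w}"
    have S: "finite ?S" "?S \<noteq> {}" and w1: "length w \<ge> 1" using w by auto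
    have "?L (Y_comult (Y w)) = (\<Sum>\<pi>\<in>noncrossing_partitions ?S.
        Y_counit (Y_part w (kreweras_on ?S \<pi>)) *\<^sub>C Y_part w \<pi>)"
      unfolding Y_comult_Y[OF w1] clinear_sum[OF clinear_tensor_lift[OF b]] tensor_lift_tens[OF b] ..
    also have "\<dots> = (\<Sum>\<pi>\<in>noncrossing_partitions ?S. if \<pi> = {?S} then Y w else 0)"
    proof (rule sum.cong[OF refl])
      fix \<pi> assume \<pi>: "\<pi> \<in> noncrossing_partitions ?S"
      show "Y_counit (Y_part w (kreweras_on ?S \<pi>)) *\<^sub>C Y_part w \<pi> = (if \<pi> = {?S} then Y w else 0)"
        unfolding Y_counit_Y_part[OF S(1) partition_on_kreweras_on] kreweras_on_eq_singletons_iff[OF S \<pi>]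
        by (simp add: Y_part_one_block scaleC_one del: One_nat_def)
    qed
    also have "\<dots> = Y w"
      using one_block_noncrossing[OF S(2)] by (simp add: finite_noncrossing_partitions)
    finally show ?thesis by simp
  qed
  ultimately have "(\<lambda>x. ?L (Y_comult x)) = id" by (intro Yalg_hom_unique calgebra_hom_id)
  then show ?thesis by (simp add: fun_eq_iff)
qed

lemma Y_bialgebra: "bialgebra Y_comult Y_counit"
proof
  fix x :: "'k Yalg"
  have "(\<lambda>x :: 'k Yalg. tensor_assoc (tensor_map Y_comult id (Y_comult x))) = (\<lambda>x. tensor_map id Y_comult (Y_comult x))"
  proof (rule Yalg_hom_unique)
    show "calgebra_hom (\<lambda>x :: 'k Yalg. tensor_assoc (tensor_map Y_comult id (Y_comult x)))"
      by (rule calgebra_hom_compose[OF calgebra_hom_tensor_assoc calgebra_hom_compose[OF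
            calgebra_hom_tensor_map[OF calgebra_hom_Y_comult calgebra_hom_id] calgebra_hom_Y_comult]])
    show "calgebra_hom (\<lambda>x :: 'k Yalg. tensor_map id Y_comult (Y_comult x))"
      by (rule calgebra_hom_compose[OF
            calgebra_hom_tensor_map[OF calgebra_hom_id calgebra_hom_Y_comult] calgebra_hom_Y_comult])
  qed (simp add: Y_comult_coassoc_generator del: id_apply)
  then show "tensor_assoc (tensor_map Y_comult id (Y_comult x)) = tensor_map id Y_comult (Y_comult x)"
    by (rule fun_cong)
qed (rule calgebra_hom_Y_comult calgebra_hom_Y_counit Y_counit_left Y_counit_right)+

section \<open>The grading\<close>

text \<open>
  The degree of a monomial when \<open>Y\<^sub>w\<close> is given degree \<open>|w| - 1\<close>.
\<close>

definition weight :: "('k idx \<Rightarrow>\<^sub>0 nat) \<Rightarrow> nat" where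
  "weight m = (\<Sum>v\<in>Poly_Mapping.keys m. Poly_Mapping.lookup m v * (length (Rep_idx v) - 1))"

lemma weight_superset:
  assumes "finite K" "Poly_Mapping.keys m \<subseteq> K"
  shows "weight m = (\<Sum>v\<in>K. Poly_Mapping.lookup m v * (length (Rep_idx v) - 1))"
  unfolding weight_def using assms by (intro sum.mono_neutral_left) (auto simp: in_keys_iff)

lemma weight_0 [simp]: "weight 0 = 0"
  by (simp add: weight_def)

lemma weight_add: "weight (m + m') = weight m + weight m'"
proof -
  let ?K = "Poly_Mapping.keys m \<union> Poly_Mapping.keys m'"
  show ?thesis
    using weight_superset[of ?K m] weight_superset[of ?K m'] weight_superset[of ?K "m + m'"] keys_add[of m m']
    by (simp add: lookup_add distrib_right sum.distrib)
qed

lemma weight_single: "weight (Poly_Mapping.single v e) = e * (length (Rep_idx v) - 1)"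
  by (simp add: weight_def)

lemma weight_eq_0_iff: "weight m = 0 \<longleftrightarrow> m = 0"
proof
  assume w: "weight m = 0"
  have "Poly_Mapping.keys m = {}"
  proof (rule equals0I)
    fix v assume v: "v \<in> Poly_Mapping.keys m"
    then have "Poly_Mapping.lookup m v * (length (Rep_idx v) - 1) = 0"
      using w by (simp add: weight_def)
    then show False using v Rep_idx[of v] by (auto simp: in_keys_iff)
  qed
  then show "m = 0" by simp
qed simp

lemma prod_list_Y_monomial:
  assumes "\<forall>w\<in>set ws. length w \<ge> 1"
  obtains m where "prod_list (map Y ws) = Poly_Mapping.single m 1"
    and "weight m + length ws = sum_list (map length ws)"
proof -
  have "\<exists>m. prod_list (map Y ws) = Poly_Mapping.single m 1 \<and> weight m + length ws = sum_list (map length ws)"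
    using assms
  proof (induction ws)
    case Nil
    show ?case by (rule exI[of _ 0]) simp
  next
    case (Cons w ws)
    obtain m where m: "prod_list (map Y ws) = Poly_Mapping.single m 1"
      "weight m + length ws = sum_list (map length ws)"
      using Cons by auto
    show ?case
    proof (cases "length w \<ge> 2")
      case True
      then have "Y w = Poly_Mapping.single (Poly_Mapping.single (Abs_idx w) 1) 1"
        by (simp add: Y_def)
      then show ?thesis
        using True m
        by (intro exI[of _ "Poly_Mapping.single (Abs_idx w) 1 + m"])
          (auto simp: mult_single weight_add weight_single Abs_idx_inverse)
    next
      case False
      then show ?thesis
        using m Cons.prems by (intro exI[of _ m]) (auto simp: Y_eq_1 le_Suc_eq)
    qed
  qed
  then show thesis using that by blast
qed

text \<open>
  The constant monomial is represented by a single word of length 1, because the list of words spanning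
  a graded piece has to be nonempty.
\<close>

lemma monomial_prod_list_Y:
  obtains ws where "length ws \<ge> 1" "\<forall>w\<in>set ws. length w \<ge> 1"
    "sum_list (map length ws) = weight m + length ws" "prod_list (map Y ws) = Poly_Mapping.single m 1"
proof -
  let ?P = "\<lambda>m ws. length ws \<ge> 1 \<and> (\<forall>w\<in>set ws. length w \<ge> 1) \<and>
    sum_list (map length ws) = weight m + length ws \<and> prod_list (map Y ws) = Poly_Mapping.single m 1"
  have "\<exists>ws. ?P m ws"
  proof (induction m rule: poly_mapping_single_induct)
    case (single v e)
    show ?case
    proof (induction e)
      case 0
      show ?case by (rule exI[of _ "[[undefined]]"]) (simp add: Y_def)
    next
      case (Suc e)
      then obtain ws where ws: "?P (Poly_Mapping.single v e) ws" by blast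
      have v: "length (Rep_idx v) \<ge> 2" using Rep_idx[of v] by simp
      then have "Y (Rep_idx v) = Poly_Mapping.single (Poly_Mapping.single v 1) 1"
        by (simp add: Y_def Rep_idx_inverse)
      then have "Y (Rep_idx v) * Poly_Mapping.single (Poly_Mapping.single v e) 1 =
          Poly_Mapping.single (Poly_Mapping.single v (Suc e)) 1"
        by (simp add: mult_single flip: single_add)
      then have "?P (Poly_Mapping.single v (Suc e)) (Rep_idx v # ws)"
        using ws v by (auto simp: weight_single)
      then show ?case by blast
    qed
  next
    case (add m m')
    then obtain ws ws' where ws: "?P m ws" "?P m' ws'" by blast
    then have "?P (m + m') (ws @ ws')" by (auto simp: weight_add mult_single)
    then show ?case by blast
  qed
  then show thesis using that by blast
qed

text \<open>
  In a product of \<open>q\<close> variables with total length \<open>n + q\<close> the weights \<open>|w| - 1\<close> add up to \<open>n\<close>.  So the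
  graded pieces split the basis of monomials according to weight, which makes the direct sum
  decomposition a matter of sorting coefficients.
\<close>

lemma Y_grade_eq: "Y_grade n = {p. \<forall>m\<in>Poly_Mapping.keys p. weight m = n}" (is "_ = ?H")
proof
  have sub: "complex_vector.subspace ?H"
    unfolding complex_vector.subspace_def
  proof (intro conjI ballI allI)
    fix p q assume "p \<in> ?H" "q \<in> ?H"
    then show "p + q \<in> ?H" using keys_add[of p q] by blast
  next
    fix c p assume "p \<in> ?H"
    then show "c *\<^sub>C p \<in> ?H" by (auto simp: in_keys_iff lookup_scaleC scaleC_complex_def)
  qed simp
  show "Y_grade n \<subseteq> ?H"
    unfolding Y_grade_def
  proof (rule complex_vector.span_minimal[OF _ sub], clarify)
    fix ws :: "'a list list" and m
    assume ws: "\<forall>w\<in>set ws. 1 \<le> length w" "sum_list (map length ws) = n + length ws"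
      and m: "m \<in> Poly_Mapping.keys (prod_list (map Y ws))"
    obtain m' where "prod_list (map Y ws) = Poly_Mapping.single m' 1"
      "weight m' + length ws = sum_list (map length ws)"
      using prod_list_Y_monomial[OF ws(1)] .
    then show "weight m = n" using ws(2) m by simp
  qed
  show "?H \<subseteq> Y_grade n"
  proof
    fix p :: "'a Yalg" assume p: "p \<in> ?H"
    have "Poly_Mapping.single m (Poly_Mapping.lookup p m) \<in> Y_grade n" if m: "m \<in> Poly_Mapping.keys p" for m
    proof -
      obtain ws where ws: "length ws \<ge> 1" "\<forall>w\<in>set ws. length w \<ge> 1"
        "sum_list (map length ws) = weight m + length ws" "prod_list (map Y ws) = Poly_Mapping.single m 1"
        by (rule monomial_prod_list_Y)
      have "weight m = n" using p m by blast
      then have "Poly_Mapping.single m 1 \<in> Y_grade n"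
        unfolding Y_grade_def using ws by (intro complex_vector.span_base) force
      then have "Poly_Mapping.lookup p m *\<^sub>C Poly_Mapping.single m 1 \<in> Y_grade n"
        unfolding Y_grade_def by (rule complex_vector.span_scale)
      then show ?thesis by (simp add: scaleC_single scaleC_complex_def)
    qed
    then have "(\<Sum>m\<in>Poly_Mapping.keys p. Poly_Mapping.single m (Poly_Mapping.lookup p m)) \<in> Y_grade n"
      unfolding Y_grade_def by (rule complex_vector.span_sum)
    then show "p \<in> Y_grade n" using poly_mapping_eq_sum_single[of p] by simp
  qed
qed

lemma subspace_Y_grade: "complex_vector.subspace (Y_grade n)"
  by (simp add: Y_grade_def)

lemma Y_grade_direct_sum: "is_direct_sum Y_grade"
  unfolding is_direct_sum_def
proof (intro conjI allI subspace_Y_grade)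
  fix p :: "'k Yalg"
  let ?ok = "\<lambda>f. (\<forall>n. f n \<in> Y_grade n) \<and> finite {n. f n \<noteq> 0} \<and> p = (\<Sum>n | f n \<noteq> 0. f n)"
  define g where "g n = (\<Sum>m\<in>{m\<in>Poly_Mapping.keys p. weight m = n}. Poly_Mapping.single m (Poly_Mapping.lookup p m))" for n
  have lg: "Poly_Mapping.lookup (g n) m = (if weight m = n then Poly_Mapping.lookup p m else 0)" for n m
    by (auto simp: g_def lookup_sum lookup_single when_def sum.delta in_keys_iff)
  have gn: "g n \<in> Y_grade n" for n
    unfolding Y_grade_eq by (auto simp: in_keys_iff lg split: if_splits)
  have gsub: "{n. g n \<noteq> 0} \<subseteq> weight ` Poly_Mapping.keys p"
  proof
    fix n assume "n \<in> {n. g n \<noteq> 0}"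
    then have "{m \<in> Poly_Mapping.keys p. weight m = n} \<noteq> {}" unfolding g_def by (metis (mono_tags) mem_Collect_eq sum.empty)
    then show "n \<in> weight ` Poly_Mapping.keys p" by blast
  qed
  then have gfin: "finite {n. g n \<noteq> 0}" by (rule finite_subset) simp
  have sum_lookup: "Poly_Mapping.lookup (\<Sum>n | f n \<noteq> 0. f n) m = Poly_Mapping.lookup (f (weight m)) m"
    if f: "\<And>n. f n \<in> Y_grade n" "finite {n. f n \<noteq> 0}" for f m
  proof -
    have z: "Poly_Mapping.lookup (f n) m = 0" if "n \<noteq> weight m" for n
      using f(1)[of n] that unfolding Y_grade_eq by (auto simp: in_keys_iff)
    have "Poly_Mapping.lookup (\<Sum>n | f n \<noteq> 0. f n) m = (\<Sum>n | f n \<noteq> 0. Poly_Mapping.lookup (f n) m)"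
      by (rule lookup_sum)
    also have "\<dots> = (\<Sum>n | f n \<noteq> 0. if n = weight m then Poly_Mapping.lookup (f (weight m)) m else 0)"
      using z by (intro sum.cong) auto
    also have "\<dots> = Poly_Mapping.lookup (f (weight m)) m"
      using f(2) by (auto simp: sum.delta)
    finally show ?thesis .
  qed
  show "\<exists>!f. ?ok f"
  proof (rule ex1I[of _ g])
    have "p = (\<Sum>n | g n \<noteq> 0. g n)"
      by (rule poly_mapping_eqI) (simp add: sum_lookup[OF gn gfin] lg)
    then show "?ok g" using gn gfin by blast
    fix f assume f: "?ok f"
    have p: "Poly_Mapping.lookup p m = Poly_Mapping.lookup (f (weight m)) m" for m
      using sum_lookup[of f m] f by metis
    show "f = g"
    proof (intro ext poly_mapping_eqI)
      fix n m
      have "n = weight m \<or> Poly_Mapping.lookup (f n) m = 0"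
        using f unfolding Y_grade_eq by (auto simp: in_keys_iff)
      then show "Poly_Mapping.lookup (f n) m = Poly_Mapping.lookup (g n) m"
        by (auto simp: lg p)
    qed
  qed
qed

lemma one_in_Y_grade_0: "1 \<in> Y_grade 0"
  by (simp add: Y_grade_eq)

lemma Y_grade_mult:
  assumes "x \<in> Y_grade m" "y \<in> Y_grade n"
  shows "x * y \<in> Y_grade (m + n)"
proof -
  have "weight u = m + n" if u: "u \<in> Poly_Mapping.keys (x * y)" for u
  proof -
    obtain a b where "u = a + b" "a \<in> Poly_Mapping.keys x" "b \<in> Poly_Mapping.keys y"
      using u keys_mult[of x y] by blast
    then show ?thesis using assms by (simp add: Y_grade_eq weight_add)
  qed
  then show ?thesis by (simp add: Y_grade_eq)
qed

lemma Y_in_Y_grade: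
  assumes "length w \<ge> 1"
  shows "Y w \<in> Y_grade (length w - 1)"
  unfolding Y_grade_def using assms by (intro complex_vector.span_base CollectI exI[of _ "[w]"]) simp

lemma Y_grade_prod:
  assumes "\<And>i. i \<in> I \<Longrightarrow> f i \<in> Y_grade (d i)"
  shows "(\<Prod>i\<in>I. f i) \<in> Y_grade (\<Sum>i\<in>I. d i)"
  using assms
  by (induction I rule: infinite_finite_induct) (simp_all add: one_in_Y_grade_0 Y_grade_mult)

lemma Y_part_in_Y_grade:
  assumes S: "finite S" and p: "partition_on S \<pi>"
  shows "Y_part w \<pi> \<in> Y_grade (card S - card \<pi>)"
proof -
  have c: "card A \<ge> 1" if "A \<in> \<pi>" for A
    using finite_block[OF S p that] block_nonempty[OF p that] by (simp add: card_gt_0_iff Suc_le_eq)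
  have "card S = (\<Sum>A\<in>\<pi>. card A)" using sum.partition[OF S p, of "\<lambda>_. 1::nat"] by simp
  also have "\<dots> = (\<Sum>A\<in>\<pi>. (card A - 1) + 1)"
  proof (rule sum.cong[OF refl])
    fix A assume "A \<in> \<pi>"
    from c[OF this] show "card A = card A - 1 + 1" by simp
  qed
  also have "\<dots> = (\<Sum>A\<in>\<pi>. card A - 1) + card \<pi>" by (subst sum.distrib) simp
  finally have "card S - card \<pi> = (\<Sum>A\<in>\<pi>. card A - 1)" by simp
  moreover have "Y_part w \<pi> \<in> Y_grade (\<Sum>A\<in>\<pi>. card A - 1)"
    unfolding Y_part_def
  proof (rule Y_grade_prod)
    fix A assume "A \<in> \<pi>"
    then show "Y (subword w A) \<in> Y_grade (card A - 1)"
      using Y_in_Y_grade[of "subword w A"] c by simp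
  qed
  ultimately show ?thesis by simp
qed

text \<open>
  The degree \<open>n\<close> part of the tensor square as the span of all homogeneous pure tensors of total degree
  \<open>n\<close>.  Its compatibility with products is immediate, unlike that of the sum over \<open>i \<le> n\<close>, to
  which it is converted at the end.
\<close>

definition tensor_grade :: "nat \<Rightarrow> ('k Yalg \<otimes>\<^sub>t 'k Yalg) set" where
  "tensor_grade n = complex_vector.span {a \<otimes> b | a b i j. a \<in> Y_grade i \<and> b \<in> Y_grade j \<and> i + j = n}"

lemma tens_in_tensor_grade:
  "a \<in> Y_grade i \<Longrightarrow> b \<in> Y_grade j \<Longrightarrow> i + j = n \<Longrightarrow> a \<otimes> b \<in> tensor_grade n"
  unfolding tensor_grade_def by (rule complex_vector.span_base) blast

lemma tensor_grade_mult:
  assumes "s \<in> tensor_grade m" "t \<in> tensor_grade n"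
  shows "s * t \<in> tensor_grade (m + n)"
proof -
  have g: "(a \<otimes> b) * t \<in> tensor_grade (m + n)"
    if ab: "a \<in> Y_grade i" "b \<in> Y_grade j" "i + j = m" for a b i j
    using assms(2) unfolding tensor_grade_def[of n]
  proof (induction rule: complex_vector.span_induct_alt)
    case base
    show ?case by (simp add: tensor_grade_def complex_vector.span_zero)
  next
    case (step c x y)
    then obtain a' b' i' j' where x: "x = a' \<otimes> b'" "a' \<in> Y_grade i'" "b' \<in> Y_grade j'" "i' + j' = n" by blast
    have "(a \<otimes> b) * x \<in> tensor_grade (m + n)"
      unfolding x(1) tens_mult_tens
      by (rule tens_in_tensor_grade[OF Y_grade_mult[OF ab(1) x(2)] Y_grade_mult[OF ab(2) x(3)]])
        (use ab x in simp)
    then show ?case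
      using step(2) unfolding distrib_left mult_scaleC_right tensor_grade_def
      by (intro complex_vector.span_add complex_vector.span_scale)
  qed
  show ?thesis
    using assms(1) unfolding tensor_grade_def[of m]
  proof (induction rule: complex_vector.span_induct_alt)
    case base
    show ?case by (simp add: tensor_grade_def complex_vector.span_zero)
  next
    case (step c x y)
    then have "x * t \<in> tensor_grade (m + n)" using g by blast
    then show ?case
      using step(2) unfolding distrib_right mult_scaleC_left tensor_grade_def
      by (intro complex_vector.span_add complex_vector.span_scale)
  qed
qed

text \<open>
  The term of \<open>\<pi>\<close> has degrees \<open>n - |\<pi>|\<close> and \<open>n - |K(\<pi>)|\<close>, where \<open>n = |w|\<close>; by the block count
  these add up to \<open>n - 1\<close>.
\<close>

lemma Y_comult_Y_in_tensor_grade: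
  assumes "length w \<ge> 1"
  shows "Y_comult (Y w) \<in> tensor_grade (length w - 1)"
  unfolding Y_comult_Y[OF assms] tensor_grade_def
proof (rule complex_vector.span_sum, fold tensor_grade_def)
  let ?S = "{1..length w}"
  fix \<pi> assume \<pi>: "\<pi> \<in> noncrossing_partitions ?S"
  have S: "finite ?S" "?S \<noteq> {}" using assms by auto
  note p = noncrossing_partition_on[OF \<pi>]
  have "kreweras_on ?S \<pi> \<noteq> {}" "\<pi> \<noteq> {}"
    using partition_onD1[OF p] partition_onD1[OF partition_on_kreweras_on[of ?S \<pi>]] S(2) by auto
  then have "card \<pi> \<ge> 1" "card (kreweras_on ?S \<pi>) \<ge> 1"
    using finite_elements[OF S(1) p] finite_elements[OF S(1) partition_on_kreweras_on[of ?S \<pi>]]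
    by (simp_all add: card_gt_0_iff Suc_le_eq)
  then have "(card ?S - card \<pi>) + (card ?S - card (kreweras_on ?S \<pi>)) = length w - 1"
    using card_kreweras_on[OF S \<pi>] by simp
  then show "Y_part w \<pi> \<otimes> Y_part w (kreweras_on ?S \<pi>) \<in> tensor_grade (length w - 1)"
    by (rule tens_in_tensor_grade[OF Y_part_in_Y_grade[OF S(1) p] Y_part_in_Y_grade[OF S(1) partition_on_kreweras_on]])
qed

lemma Y_comult_in_tensor_grade:
  assumes "x \<in> Y_grade n"
  shows "Y_comult x \<in> tensor_grade n"
proof -
  note lin = calgebra_homD(1)[OF calgebra_hom_Y_comult]
  have list: "\<exists>d. d + length ws = sum_list (map length ws) \<and> Y_comult (prod_list (map Y ws)) \<in> tensor_grade d"
    if "\<forall>w\<in>set ws. length w \<ge> 1" for ws :: "'a list list"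
    using that
  proof (induction ws)
    case Nil
    have "1 \<otimes> 1 \<in> tensor_grade 0" by (rule tens_in_tensor_grade[OF one_in_Y_grade_0 one_in_Y_grade_0]) simp
    then show ?case by (simp add: calgebra_homD(2)[OF calgebra_hom_Y_comult] one_tensor_def)
  next
    case (Cons w ws)
    then obtain d where d: "d + length ws = sum_list (map length ws)"
      "Y_comult (prod_list (map Y ws)) \<in> tensor_grade d" by auto
    have w: "length w \<ge> 1" using Cons.prems by simp
    have "Y_comult (prod_list (map Y (w # ws))) \<in> tensor_grade (length w - 1 + d)"
      using tensor_grade_mult[OF Y_comult_Y_in_tensor_grade[OF w] d(2)]
      by (simp add: calgebra_homD(3)[OF calgebra_hom_Y_comult])
    then show ?case using d(1) w by (intro exI[of _ "length w - 1 + d"]) simp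
  qed
  show ?thesis
    using assms unfolding Y_grade_def
  proof (induction rule: complex_vector.span_induct_alt)
    case base
    show ?case by (simp add: clinear_0[OF lin] tensor_grade_def complex_vector.span_zero)
  next
    case (step c x y)
    then obtain ws where ws: "x = prod_list (map Y ws)" "\<forall>w\<in>set ws. length w \<ge> 1"
      "sum_list (map length ws) = n + length ws" by blast
    then have "Y_comult x \<in> tensor_grade n" using list[OF ws(2)] by auto
    then show ?case
      using step(2) unfolding clinear_add[OF lin] clinear_scale[OF lin] tensor_grade_def
      by (intro complex_vector.span_add complex_vector.span_scale)
  qed
qed

lemma tensor_grade_decompose:
  assumes "s \<in> tensor_grade n"
  shows "s \<in> {\<Sum>i\<le>n. t i | t. \<forall>i\<le>n. t i \<in> tensor_sub (Y_grade i) (Y_grade (n - i))}"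
proof -
  have "\<exists>t. s = (\<Sum>i\<le>n. t i) \<and> (\<forall>i\<le>n. t i \<in> tensor_sub (Y_grade i) (Y_grade (n - i)))"
    using assms unfolding tensor_grade_def
  proof (induction rule: complex_vector.span_induct_alt)
    case base
    show ?case by (rule exI[of _ "\<lambda>_. 0"]) (simp add: tensor_sub_def complex_vector.span_zero)
  next
    case (step c x y)
    then obtain a b i j where x: "x = a \<otimes> b" "a \<in> Y_grade i" "b \<in> Y_grade j" "i + j = n" by blast
    obtain t where t: "y = (\<Sum>i\<le>n. t i)" "\<forall>i\<le>n. t i \<in> tensor_sub (Y_grade i) (Y_grade (n - i))"
      using step by blast
    let ?t = "\<lambda>k. (if k = i then c *\<^sub>C x else 0) + t k"
    have "c *\<^sub>C x + y = (\<Sum>k\<le>n. ?t k)"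
      using x(4) by (simp add: sum.distrib t(1))
    moreover have "?t k \<in> tensor_sub (Y_grade k) (Y_grade (n - k))" if "k \<le> n" for k
    proof -
      have "(if k = i then c *\<^sub>C x else 0) \<in> tensor_sub (Y_grade k) (Y_grade (n - k))"
      proof (cases "k = i")
        case True
        then have "n - k = j" using x(4) by simp
        then have "x \<in> tensor_sub (Y_grade k) (Y_grade (n - k))"
          unfolding tensor_sub_def using x True by (intro complex_vector.span_base) blast
        then show ?thesis using True by (simp add: tensor_sub_def complex_vector.span_scale)
      qed (simp add: tensor_sub_def complex_vector.span_zero)
      moreover have "t k \<in> tensor_sub (Y_grade k) (Y_grade (n - k))" using t(2) that by blast
      ultimately show ?thesis unfolding tensor_sub_def by (rule complex_vector.span_add)
    qed
    ultimately show ?case by (intro exI[of _ ?t]) blast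
  qed
  then show ?thesis by blast
qed

text \<open>
  A spanning product of positive degree has a factor \<open>Y\<^sub>w\<close> with \<open>|w| \<ge> 2\<close>, which the counit kills.
\<close>

lemma Y_counit_grade:
  assumes n: "n \<ge> 1" and x: "x \<in> Y_grade n"
  shows "Y_counit x = 0"
  using x unfolding Y_grade_def
proof (induction rule: complex_vector.span_induct_alt)
  note lin = calgebra_homD(1)[OF calgebra_hom_Y_counit]
  case base
  show ?case by (rule clinear_0[OF lin])
next
  note lin = calgebra_homD(1)[OF calgebra_hom_Y_counit]
  case (step c x y)
  then obtain ws where ws: "x = prod_list (map Y ws)" "\<forall>w\<in>set ws. length w \<ge> 1"
    "sum_list (map length ws) = n + length ws" by blast
  have "\<exists>w\<in>set ws. length w \<ge> 2"
  proof (rule ccontr)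
    assume "\<not> (\<exists>w\<in>set ws. length w \<ge> 2)"
    then have "\<forall>w\<in>set ws. length w \<le> 1" by auto
    then have "sum_list (map length ws) \<le> length ws" by (induction ws) auto
    then show False using ws(3) n by simp
  qed
  then have "0 \<in> set (map Y_counit (map Y ws))" by (force simp: Y_counit_Y)
  then have "Y_counit x = 0"
    unfolding ws(1) calgebra_hom_prod_list[OF calgebra_hom_Y_counit] by (simp only: prod_list_zero_iff)
  then show ?case using step(2) by (simp add: clinear_add[OF lin] clinear_scale[OF lin] scaleC_complex_def)
qed

lemma Y_grade_0: "(Y_grade 0 :: 'k Yalg set) = complex_vector.span {1}"
proof
  show "complex_vector.span {1} \<subseteq> (Y_grade 0 :: 'k Yalg set)"
    using one_in_Y_grade_0 by (intro complex_vector.span_minimal subspace_Y_grade) simp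
  show "(Y_grade 0 :: 'k Yalg set) \<subseteq> complex_vector.span {1}"
  proof
    fix p :: "'k Yalg" assume "p \<in> Y_grade 0"
    then have k: "\<forall>m\<in>Poly_Mapping.keys p. m = 0" by (simp add: Y_grade_eq weight_eq_0_iff)
    have "p = Poly_Mapping.lookup p 0 *\<^sub>C 1"
    proof (rule poly_mapping_eqI)
      fix m
      show "Poly_Mapping.lookup p m = Poly_Mapping.lookup (Poly_Mapping.lookup p 0 *\<^sub>C 1) m"
        using k by (cases "m = 0") (auto simp: lookup_scaleC lookup_one scaleC_complex_def in_keys_iff)
    qed
    then show "p \<in> complex_vector.span {1}"
      by (metis complex_vector.span_base complex_vector.span_scale singletonI)
  qed
qed

lemma Y_graded_connected_bialgebra:
  "graded_connected_bialgebra (Y_comult :: 'k Yalg \<Rightarrow> 'k Yalg \<otimes>\<^sub>t 'k Yalg) Y_counit Y_grade"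
proof -
  interpret bialgebra "Y_comult :: 'k Yalg \<Rightarrow> 'k Yalg \<otimes>\<^sub>t 'k Yalg" Y_counit
    by (rule Y_bialgebra)
  show ?thesis
  proof unfold_locales
    fix x :: "'k Yalg" and n assume "x \<in> Y_grade n"
    then show "Y_comult x \<in> {\<Sum>i\<le>n. t i | t. \<forall>i\<le>n. t i \<in> tensor_sub (Y_grade i) (Y_grade (n - i))}"
      by (intro tensor_grade_decompose Y_comult_in_tensor_grade)
  qed (fact Y_grade_direct_sum one_in_Y_grade_0 Y_grade_mult Y_counit_grade Y_grade_0)+
qed

theorem proposition3p6:
  "graded_connected_hopf_algebra
    (Y_comult :: 'k::finite Yalg \<Rightarrow> 'k Yalg \<otimes>\<^sub>t 'k Yalg) Y_counit Y_grade"
  by (rule graded_connected_bialgebra.graded_connected_hopf[OF Y_graded_connected_bialgebra])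

end
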